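(* Let $\mathcal{A}[\tau]$ be a commutative locally convex quasi $C^*$-algebra over the unital $C^*$-algebra $\mathcal{A}_0$, and let $\mathcal{F}(\mathcal{M}(\mathcal{A}_0))_+ := \{ \hat{a} : a \in \mathcal{A}[\tau]_{q+}\}$. Then: (1) $\mathcal{F}(\mathcal{M}(\mathcal{A}_0))_+$ is a wedge on $\mathcal{M}(\mathcal{A}_0)$. (2) The map $\Phi: \mathfrak{M}(\mathcal{A}_0, \mathcal{A}[\tau]_{q+}) \to \mathcal{F}(\mathcal{M}(\mathcal{A}_0))$, $ax+y \mapsto \widehat{ax+y}$, is a bijection with the properties: (i) $\Phi(\mathcal{A}[\tau]_{q+}) = \mathcal{F}(\mathcal{M}(\mathcal{A}_0))_+$, and $\Phi(a+b)=\Phi(a)+\Phi(b)$, $\Phi(\lambda a)=\lambda\Phi(a)$ for all $a,b\in\mathcal{A}[\tau]_{q+}$ and $\lambda\ge 0$; (ii) $\Phi(\mathcal{A}_0)=C(\mathcal{M}(\mathcal{A}_0))$, and $\Phi$ restricted to $\mathcal{A}_0$ is an isometric $*$-isomorphism of $\mathcal{A}_0$ onto $C(\mathcal{M}(\mathcal{A}_0))$; (iii) $\Phi(ax)=\Phi(a)\Phi(x)$ for all $a\in\mathcal{A}[\tau]_{q+}$, $x\in\mathcal{A}_0$; $\Phi((a+b)x)=(\Phi(a)+\Phi(b))\Phi(x)$ for all $a,b\in\mathcal{A}[\tau]_{q+}$, $x\in\mathcal{A}_0$; $\Phi(\lambda a x)=\lambda\Phi(a)\Phi(x)$ for all $a\in\mathcal{A}[\tau]_{q+}$,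 $x\in\mathcal{A}_0$, $\lambda\ge0$; $\Phi(a(x_1+x_2))=\Phi(a)(\Phi(x_1)+\Phi(x_2))$ for all $a\in\mathcal{A}[\tau]_{q+}$, $x_1,x_2\in\mathcal{A}_0$.
   Context: Let $\mathcal{A}_0$ be a unital $C^*$-algebra with $C^*$-norm $\|\cdot\|_0$, unit $\mathit{1}$, positive cone $(\mathcal{A}_0)_+$, and $\mathcal{U}(\mathcal{A}_0)_+=\{x\in(\mathcal{A}_0)_+:\|x\|_0\le1\}$. Let $\tau$ be a locally convex topology on $\mathcal{A}_0$ defined by seminorms $\{p_\lambda\}_{\lambda\in\Lambda}$, compatible with $\|\cdot\|_0$ (each net Cauchy in both topologies and convergent in one converges in the other). $\widetilde{\mathcal{A}_0}[\tau]$ is the completion; it contains $\mathcal{A}_0$ and is a quasi $*$-algebra over $\mathcal{A}_0$: if $a=\tau$-$\lim_\alpha x_\alpha$ with $x_\alpha\in\mathcal{A}_0$ and $x\in\mathcal{A}_0$, then $ax=\lim_\alpha x_\alpha x$, $xa=\lim_\alpha xx_\alpha$, and the involution is extended by continuity. An element of $\widetilde{\mathcal{A}_0}[\tau]$ is quasi-positive (resp. commutatively quasi-positive) if it is the $\tau$-limit of a net (resp. a net of mutually commuting elements) of $(\mathcal{A}_0)_+$; these sets are $\widetilde{\mathcal{A}_0}[\tau]_{q+}$, $\widetilde{\mathcal{A}_0}[\tau]_{cq+}$. Conditions: (T1) $\mathcal{A}_0[\tau]$ is a locally convex $*$-algebra with separately continuous multiplication; (T2) $\tau$ is coarser than the $\|\cdot\|_0$-topology;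 (T3) for each $\lambda\in\Lambda$ there is $\lambda'\in\Lambda$ with $p_\lambda(xy)\le\|x\|_0p_{\lambda'}(y)$ for all $x,y\in\mathcal{A}_0$ with $xy=yx$; (T4) $\mathcal{U}(\mathcal{A}_0)_+$ is $\tau$-closed and $\widetilde{\mathcal{A}_0}[\tau]_{q+}\cap\mathcal{A}_0=(\mathcal{A}_0)_+$. A locally convex quasi $C^*$-algebra over $\mathcal{A}_0$, written $\mathcal{A}[\tau]$, is a $*$-invariant subspace $\mathcal{A}$ of $\widetilde{\mathcal{A}_0}[\tau]$ containing $\mathcal{A}_0$ with $ax,xa\in\mathcal{A}$ for $a\in\mathcal{A},x\in\mathcal{A}_0$, where $\tau$ satisfies (T1)–(T4). It is commutative if $\mathcal{A}_0$ is commutative. Put $\mathcal{A}[\tau]_{q+}=\mathcal{A}\cap\widetilde{\mathcal{A}_0}[\tau]_{q+}$. For $b\in\mathcal{A}$, "$(\mathit{1}+b)^{-1}$" denotes $z\in\mathcal{A}_0$ with $(\mathit{1}+b)z=z(\mathit{1}+b)=\mathit{1}$. For $x\in\mathcal{A}_0$, $|x|=(x^*x)^{1/2}$. In the commutative case, for $a\in\mathcal{A}[\tau]_{q+}$ and $x,y\in\mathcal{A}_0$ the elements $(\mathit{1}+a|x|)^{-1}$ and $(ax+y)(\mathit{1}+a|x|)^{-1}$ exist and lie in $\mathcal{A}_0$. Let $\mathfrak{M}(\mathcal{A}_0,\mathcal{A}[\tau]_{q+})=\{ax+y: a\in\mathcal{A}[\tau]_{q+}, x,y\in\mathcal{A}_0\}$,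 and $\mathcal{M}(\mathcal{A}_0)$ the Gel'fand space (nonzero multiplicative linear functionals, weak$^*$ topology). For $\varphi\in\mathcal{M}(\mathcal{A}_0)$ define $\varphi'(ax+y)=\varphi((ax+y)(\mathit{1}+a|x|)^{-1})/\varphi((\mathit{1}+a|x|)^{-1})$ if $\varphi((\mathit{1}+a|x|)^{-1})\neq0$ and $=\infty$ otherwise (a well-defined $\mathbb{C}^*=\mathbb{C}\cup\{\infty\}$-valued map), and $\widehat{ax+y}(\varphi):=\varphi'(ax+y)$. Wedge: for a completely regular space $W$, let $\mathcal{F}(W)_+$ be a set of $\mathbb{C}^*$-valued positive continuous functions on $W$ each taking the value $\infty$ on at most a nowhere dense set; it is a wedge on $W$ if for $f,g\in\mathcal{F}(W)_+$, $\lambda\ge0$, the functions $f+g$, $\lambda f$ defined pointwise where $f,g$ are finite extend to $\mathbb{C}^*$-valued positive continuous functions on $W$ belonging to $\mathcal{F}(W)_+$ (denoted again $f+g$, $\lambda f$). $\mathcal{F}(W)=\{fg_0+h_0: f\in\mathcal{F}(W)_+, g_0,h_0\in C(W)\}$; sums and products of such functions are understood pointwise on the dense set where all functions involved are finite, extended by continuity. *)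

theory Defs
  imports "HOL-Analysis.Analysis"
begin

definition complex_vs :: "(complex \<Rightarrow> 'a::ab_group_add \<Rightarrow> 'a) \<Rightarrow> bool" where
  "complex_vs smul \<longleftrightarrow> (\<forall>c a b. smul c (a + b) = smul c a + smul c b)
     \<and> (\<forall>c d a. smul (c + d) a = smul c a + smul d a)
     \<and> (\<forall>c d a. smul (c * d) a = smul c (smul d a)) \<and> (\<forall>a. smul 1 a = a)"

definition seminorm_family :: "(complex \<Rightarrow> 'a::ab_group_add \<Rightarrow> 'a) \<Rightarrow> ('l \<Rightarrow> 'a \<Rightarrow> real) \<Rightarrow> bool" where
  "seminorm_family smul p \<longleftrightarrow> (\<forall>l. (\<forall>a. 0 \<le> p l a) \<and> (\<forall>a b. p l (a + b) \<le> p l a + p l b)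
      \<and> (\<forall>c a. p l (smul c a) = cmod c * p l a))"

text \<open>Nets are represented by filters.\<close>
definition tconv :: "('l \<Rightarrow> 'a::ab_group_add \<Rightarrow> real) \<Rightarrow> 'a filter \<Rightarrow> 'a \<Rightarrow> bool" where
  "tconv p F a \<longleftrightarrow> (\<forall>l \<epsilon>. \<epsilon> > 0 \<longrightarrow> eventually (\<lambda>b. p l (b - a) < \<epsilon>) F)"

definition tcauchy :: "('l \<Rightarrow> 'a::ab_group_add \<Rightarrow> real) \<Rightarrow> 'a filter \<Rightarrow> bool" where
  "tcauchy p F \<longleftrightarrow> (\<forall>l \<epsilon>. \<epsilon> > 0 \<longrightarrow>
      (\<exists>S. eventually (\<lambda>b. b \<in> S) F \<and> (\<forall>b\<in>S. \<forall>c\<in>S. p l (b - c) < \<epsilon>)))"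

definition nconv :: "('a::ab_group_add \<Rightarrow> real) \<Rightarrow> 'a filter \<Rightarrow> 'a \<Rightarrow> bool" where
  "nconv n F a \<longleftrightarrow> (\<forall>\<epsilon>. \<epsilon> > 0 \<longrightarrow> eventually (\<lambda>b. n (b - a) < \<epsilon>) F)"

definition ncauchy :: "('a::ab_group_add \<Rightarrow> real) \<Rightarrow> 'a filter \<Rightarrow> bool" where
  "ncauchy n F \<longleftrightarrow> (\<forall>\<epsilon>. \<epsilon> > 0 \<longrightarrow>
      (\<exists>S. eventually (\<lambda>b. b \<in> S) F \<and> (\<forall>b\<in>S. \<forall>c\<in>S. n (b - c) < \<epsilon>)))"

definition tcont :: "('l \<Rightarrow> 'a::ab_group_add \<Rightarrow> real) \<Rightarrow> ('a \<Rightarrow> 'a) \<Rightarrow> bool" where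
  "tcont p f \<longleftrightarrow> (\<forall>a l \<epsilon>. \<epsilon> > 0 \<longrightarrow> (\<exists>L \<delta>. finite L \<and> \<delta> > 0 \<and>
      (\<forall>b. (\<forall>m\<in>L. p m (b - a) < \<delta>) \<longrightarrow> p l (f b - f a) < \<epsilon>)))"

definition cstar_algebra ::
  "(complex \<Rightarrow> 'a::ab_group_add \<Rightarrow> 'a) \<Rightarrow> 'a set \<Rightarrow> 'a \<Rightarrow> ('a \<Rightarrow> 'a \<Rightarrow> 'a) \<Rightarrow> ('a \<Rightarrow> 'a) \<Rightarrow> ('a \<Rightarrow> real) \<Rightarrow> bool" where
  "cstar_algebra smul A0 one mul invl nrm \<longleftrightarrow>
     0 \<in> A0 \<and> (\<forall>x\<in>A0. \<forall>y\<in>A0. x + y \<in> A0) \<and> (\<forall>c. \<forall>x\<in>A0. smul c x \<in> A0)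
   \<and> one \<in> A0 \<and> (\<forall>x\<in>A0. \<forall>y\<in>A0. mul x y \<in> A0) \<and> (\<forall>x\<in>A0. invl x \<in> A0)
   \<and> (\<forall>x\<in>A0. \<forall>y\<in>A0. \<forall>z\<in>A0. mul (mul x y) z = mul x (mul y z))
   \<and> (\<forall>x\<in>A0. \<forall>y\<in>A0. \<forall>z\<in>A0. mul x (y + z) = mul x y + mul x z
                                 \<and> mul (x + y) z = mul x z + mul y z)
   \<and> (\<forall>c. \<forall>x\<in>A0. \<forall>y\<in>A0. mul (smul c x) y = smul c (mul x y) \<and> mul x (smul c y) = smul c (mul x y))
   \<and> (\<forall>x\<in>A0. mul one x = x \<and> mul x one = x)
   \<and> (\<forall>x\<in>A0. \<forall>y\<in>A0. invl (x + y) = invl x + invl y)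
   \<and> (\<forall>c. \<forall>x\<in>A0. invl (smul c x) = smul (cnj c) (invl x))
   \<and> (\<forall>x\<in>A0. invl (invl x) = x)
   \<and> (\<forall>x\<in>A0. \<forall>y\<in>A0. invl (mul x y) = mul (invl y) (invl x))
   \<and> (\<forall>x\<in>A0. 0 \<le> nrm x) \<and> (\<forall>x\<in>A0. nrm x = 0 \<longleftrightarrow> x = 0)
   \<and> (\<forall>x\<in>A0. \<forall>y\<in>A0. nrm (x + y) \<le> nrm x + nrm y)
   \<and> (\<forall>c. \<forall>x\<in>A0. nrm (smul c x) = cmod c * nrm x)
   \<and> (\<forall>x\<in>A0. \<forall>y\<in>A0. nrm (mul x y) \<le> nrm x * nrm y)
   \<and> (\<forall>x\<in>A0. nrm (mul (invl x) x) = nrm x ^ 2)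
   \<and> nrm one = 1
   \<and> (\<forall>X::nat \<Rightarrow> 'a. (\<forall>n. X n \<in> A0) \<and> (\<forall>\<epsilon>>0. \<exists>N. \<forall>m\<ge>N. \<forall>n\<ge>N. nrm (X m - X n) < \<epsilon>)
          \<longrightarrow> (\<exists>x\<in>A0. \<forall>\<epsilon>>0. \<exists>N. \<forall>n\<ge>N. nrm (X n - x) < \<epsilon>))"

definition cpos :: "'a set \<Rightarrow> ('a \<Rightarrow> 'a \<Rightarrow> 'a) \<Rightarrow> ('a \<Rightarrow> 'a) \<Rightarrow> 'a set" where
  "cpos A0 mul invl = {z. \<exists>y\<in>A0. z = mul (invl y) y}"

definition upos :: "'a set \<Rightarrow> ('a \<Rightarrow> 'a \<Rightarrow> 'a) \<Rightarrow> ('a \<Rightarrow> 'a) \<Rightarrow> ('a \<Rightarrow> real) \<Rightarrow> 'a set" where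
  "upos A0 mul invl nrm = {x \<in> cpos A0 mul invl. nrm x \<le> 1}"

definition qpos :: "'a::ab_group_add set \<Rightarrow> ('a \<Rightarrow> 'a \<Rightarrow> 'a) \<Rightarrow> ('a \<Rightarrow> 'a)
                     \<Rightarrow> ('l \<Rightarrow> 'a \<Rightarrow> real) \<Rightarrow> 'a set" where
  "qpos A0 mul invl p = {a. \<exists>F. F \<noteq> bot \<and> eventually (\<lambda>x. x \<in> cpos A0 mul invl) F \<and> tconv p F a}"

definition is_completion :: "(complex \<Rightarrow> 'a::ab_group_add \<Rightarrow> 'a) \<Rightarrow> 'a set \<Rightarrow> ('l \<Rightarrow> 'a \<Rightarrow> real) \<Rightarrow> bool" where
  "is_completion smul A0 p \<longleftrightarrow> seminorm_family smul p
    \<and> (\<forall>a. (\<forall>l. p l a = 0) \<longrightarrow> a = 0)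
    \<and> (\<forall>F. F \<noteq> bot \<and> tcauchy p F \<longrightarrow> (\<exists>a. tconv p F a))
    \<and> (\<forall>a L \<epsilon>. finite L \<and> \<epsilon> > 0 \<longrightarrow> (\<exists>x\<in>A0. \<forall>l\<in>L. p l (a - x) < \<epsilon>))"

text \<open>Condition (T1) together with the extension of the multiplication by an element of
  A0 and of the involution to the completion by continuity.\<close>
definition T1_ext :: "(complex \<Rightarrow> 'a::ab_group_add \<Rightarrow> 'a) \<Rightarrow> 'a set \<Rightarrow> ('a \<Rightarrow> 'a \<Rightarrow> 'a) \<Rightarrow> ('a \<Rightarrow> 'a)
                      \<Rightarrow> ('l \<Rightarrow> 'a \<Rightarrow> real) \<Rightarrow> bool" where
  "T1_ext smul A0 mul invl p \<longleftrightarrow>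
     (\<forall>x\<in>A0. (\<forall>a b. mul (a + b) x = mul a x + mul b x \<and> mul x (a + b) = mul x a + mul x b)
          \<and> (\<forall>c a. mul (smul c a) x = smul c (mul a x) \<and> mul x (smul c a) = smul c (mul x a))
          \<and> tcont p (\<lambda>a. mul a x) \<and> tcont p (\<lambda>a. mul x a))
   \<and> (\<forall>a b. invl (a + b) = invl a + invl b) \<and> (\<forall>c a. invl (smul c a) = smul (cnj c) (invl a))
   \<and> tcont p invl"

definition compatible :: "'a::ab_group_add set \<Rightarrow> ('a \<Rightarrow> real) \<Rightarrow> ('l \<Rightarrow> 'a \<Rightarrow> real) \<Rightarrow> bool" where
  "compatible A0 nrm p \<longleftrightarrow> (\<forall>F. F \<noteq> bot \<and> eventually (\<lambda>b. b \<in> A0) F \<and> ncauchy nrm F \<and> tcauchy p F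
       \<longrightarrow> ((\<exists>x\<in>A0. tconv p F x) \<longleftrightarrow> (\<exists>x\<in>A0. nconv nrm F x)))"

definition T2 :: "'a set \<Rightarrow> ('a \<Rightarrow> real) \<Rightarrow> ('l \<Rightarrow> 'a \<Rightarrow> real) \<Rightarrow> bool" where
  "T2 A0 nrm p \<longleftrightarrow> (\<forall>l. \<exists>C. \<forall>x\<in>A0. p l x \<le> C * nrm x)"

definition T3 :: "'a set \<Rightarrow> ('a \<Rightarrow> 'a \<Rightarrow> 'a) \<Rightarrow> ('a \<Rightarrow> real) \<Rightarrow> ('l \<Rightarrow> 'a \<Rightarrow> real) \<Rightarrow> bool" where
  "T3 A0 mul nrm p \<longleftrightarrow> (\<forall>l. \<exists>l'. \<forall>x\<in>A0. \<forall>y\<in>A0. mul x y = mul y x \<longrightarrow> p l (mul x y) \<le> nrm x * p l' y)"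

definition T4 :: "'a::ab_group_add set \<Rightarrow> ('a \<Rightarrow> 'a \<Rightarrow> 'a) \<Rightarrow> ('a \<Rightarrow> 'a) \<Rightarrow> ('a \<Rightarrow> real)
                  \<Rightarrow> ('l \<Rightarrow> 'a \<Rightarrow> real) \<Rightarrow> bool" where
  "T4 A0 mul invl nrm p \<longleftrightarrow>
     (\<forall>F a. F \<noteq> bot \<and> eventually (\<lambda>x. x \<in> upos A0 mul invl nrm) F \<and> tconv p F a
            \<longrightarrow> a \<in> upos A0 mul invl nrm)
   \<and> qpos A0 mul invl p \<inter> A0 = cpos A0 mul invl"

definition lcqca :: "(complex \<Rightarrow> 'a::ab_group_add \<Rightarrow> 'a) \<Rightarrow> 'a set \<Rightarrow> 'a \<Rightarrow> ('a \<Rightarrow> 'a \<Rightarrow> 'a) \<Rightarrow> ('a \<Rightarrow> 'a) \<Rightarrow> ('a \<Rightarrow> real)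
                     \<Rightarrow> ('l \<Rightarrow> 'a \<Rightarrow> real) \<Rightarrow> 'a set \<Rightarrow> bool" where
  "lcqca smul A0 one mul invl nrm p A \<longleftrightarrow>
     complex_vs smul \<and> cstar_algebra smul A0 one mul invl nrm \<and> is_completion smul A0 p \<and> compatible A0 nrm p
   \<and> T1_ext smul A0 mul invl p \<and> T2 A0 nrm p \<and> T3 A0 mul nrm p \<and> T4 A0 mul invl nrm p
   \<and> A0 \<subseteq> A \<and> (\<forall>a\<in>A. \<forall>b\<in>A. a + b \<in> A) \<and> (\<forall>c. \<forall>a\<in>A. smul c a \<in> A) \<and> (\<forall>a\<in>A. invl a \<in> A)
   \<and> (\<forall>a\<in>A. \<forall>x\<in>A0. mul a x \<in> A \<and> mul x a \<in> A)"

definition absv :: "'a set \<Rightarrow> ('a \<Rightarrow> 'a \<Rightarrow> 'a) \<Rightarrow> ('a \<Rightarrow> 'a) \<Rightarrow> 'a \<Rightarrow> 'a" where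
  "absv A0 mul invl x = (THE z. z \<in> cpos A0 mul invl \<and> mul z z = mul (invl x) x)"

definition resinv :: "'a::ab_group_add set \<Rightarrow> 'a \<Rightarrow> ('a \<Rightarrow> 'a \<Rightarrow> 'a) \<Rightarrow> 'a \<Rightarrow> 'a" where
  "resinv A0 one mul b = (THE z. z \<in> A0 \<and> mul (one + b) z = one \<and> mul z (one + b) = one)"

text \<open>Gel'fand space: nonzero multiplicative linear functionals on A0 (extended by 0 off A0);
  the weak* topology is the subspace topology of the product topology on \<open>'a \<Rightarrow> complex\<close>.\<close>
definition gelfand :: "(complex \<Rightarrow> 'a::ab_group_add \<Rightarrow> 'a) \<Rightarrow> 'a set \<Rightarrow> ('a \<Rightarrow> 'a \<Rightarrow> 'a) \<Rightarrow> ('a \<Rightarrow> complex) set" where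
  "gelfand smul A0 mul = {\<phi>. (\<forall>x\<in>A0. \<forall>y\<in>A0. \<phi> (x + y) = \<phi> x + \<phi> y) \<and> (\<forall>c. \<forall>x\<in>A0. \<phi> (smul c x) = c * \<phi> x)
       \<and> (\<forall>x\<in>A0. \<forall>y\<in>A0. \<phi> (mul x y) = \<phi> x * \<phi> y) \<and> (\<exists>x\<in>A0. \<phi> x \<noteq> 0)
       \<and> (\<forall>a. a \<notin> A0 \<longrightarrow> \<phi> a = 0)}"

text \<open>C* = C \<union> {\<infinity>} is modelled as \<open>complex option\<close>, None standing for \<infinity>.\<close>
definition phi' :: "'a::ab_group_add set \<Rightarrow> 'a \<Rightarrow> ('a \<Rightarrow> 'a \<Rightarrow> 'a) \<Rightarrow> ('a \<Rightarrow> 'a)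
                    \<Rightarrow> 'a \<Rightarrow> 'a \<Rightarrow> 'a \<Rightarrow> ('a \<Rightarrow> complex) \<Rightarrow> complex option" where
  "phi' A0 one mul invl a x y \<phi> =
     (let z = resinv A0 one mul (mul a (absv A0 mul invl x));
          w = mul (mul a x + y) z
      in if \<phi> z \<noteq> 0 then Some (\<phi> w / \<phi> z) else None)"

definition Mset :: "'a::ab_group_add set \<Rightarrow> ('a \<Rightarrow> 'a \<Rightarrow> 'a) \<Rightarrow> 'a set \<Rightarrow> 'a set" where
  "Mset A0 mul Aq = {mul a x + y | a x y. a \<in> Aq \<and> x \<in> A0 \<and> y \<in> A0}"

definition Phi :: "(complex \<Rightarrow> 'a::ab_group_add \<Rightarrow> 'a) \<Rightarrow> 'a set \<Rightarrow> 'a \<Rightarrow> ('a \<Rightarrow> 'a \<Rightarrow> 'a) \<Rightarrow> ('a \<Rightarrow> 'a) \<Rightarrow> 'a set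
                   \<Rightarrow> 'a \<Rightarrow> ('a \<Rightarrow> complex) \<Rightarrow> complex option" where
  "Phi smul A0 one mul invl Aq c = (\<lambda>\<phi>. if \<phi> \<in> gelfand smul A0 mul then
      (let r = (SOME r. fst r \<in> Aq \<and> fst (snd r) \<in> A0 \<and> snd (snd r) \<in> A0
                        \<and> c = mul (fst r) (fst (snd r)) + snd (snd r))
       in phi' A0 one mul invl (fst r) (fst (snd r)) (snd (snd r)) \<phi>)
    else Some 0)"

definition cont_star :: "'w::topological_space set \<Rightarrow> ('w \<Rightarrow> complex option) \<Rightarrow> bool" where
  "cont_star W f \<longleftrightarrow> (\<forall>w\<in>W. case f w of
      None \<Rightarrow> (\<forall>M. eventually (\<lambda>v. case f v of None \<Rightarrow> True | Some c \<Rightarrow> cmod c > M) (at w within W))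
    | Some c \<Rightarrow> eventually (\<lambda>v. f v \<noteq> None) (at w within W) \<and> ((\<lambda>v. the (f v)) \<longlongrightarrow> c) (at w within W))"

definition nowhere_dense_in :: "'w::topological_space set \<Rightarrow> 'w set \<Rightarrow> bool" where
  "nowhere_dense_in W S \<longleftrightarrow> (\<forall>U. openin (top_of_set W) U \<and> U \<noteq> {} \<longrightarrow>
      (\<exists>V. openin (top_of_set W) V \<and> V \<noteq> {} \<and> V \<subseteq> U \<and> V \<inter> S = {}))"

definition pos_cfuns :: "'w::topological_space set \<Rightarrow> ('w \<Rightarrow> complex option) set" where
  "pos_cfuns W = {f. cont_star W f
      \<and> (\<forall>w\<in>W. case f w of None \<Rightarrow> True | Some c \<Rightarrow> Im c = 0 \<and> 0 \<le> Re c)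
      \<and> nowhere_dense_in W {w\<in>W. f w = None}}"

definition wedge :: "'w::topological_space set \<Rightarrow> ('w \<Rightarrow> complex option) set \<Rightarrow> bool" where
  "wedge W F \<longleftrightarrow> F \<subseteq> pos_cfuns W
     \<and> (\<forall>f\<in>F. \<forall>g\<in>F. \<exists>h\<in>F. \<forall>w\<in>W. f w \<noteq> None \<and> g w \<noteq> None \<longrightarrow> h w = Some (the (f w) + the (g w)))
     \<and> (\<forall>f\<in>F. \<forall>r::real. r \<ge> 0 \<longrightarrow> (\<exists>h\<in>F. \<forall>w\<in>W. f w \<noteq> None \<longrightarrow> h w = Some (complex_of_real r * the (f w))))"

definition ext_fun :: "'w set \<Rightarrow> ('w \<Rightarrow> complex option) \<Rightarrow> bool" where
  "ext_fun W h \<longleftrightarrow> (\<forall>w. w \<notin> W \<longrightarrow> h w = Some 0)"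

definition fin_fun :: "'w set \<Rightarrow> ('w \<Rightarrow> complex) \<Rightarrow> 'w \<Rightarrow> complex option" where
  "fin_fun W g = (\<lambda>w. if w \<in> W then Some (g w) else Some 0)"

definition Cfun :: "'w::topological_space set \<Rightarrow> ('w \<Rightarrow> complex option) set" where
  "Cfun W = {k. \<exists>g. continuous_on W g \<and> k = fin_fun W g}"

text \<open>F(W) = {f g0 + h0}: continuous C*-valued extensions of the pointwise expression.\<close>
definition Ffun :: "'w::topological_space set \<Rightarrow> ('w \<Rightarrow> complex option) set \<Rightarrow> ('w \<Rightarrow> complex option) set" where
  "Ffun W F = {k. cont_star W k \<and> ext_fun W k \<and> (\<exists>f\<in>F. \<exists>g0 h0. continuous_on W g0 \<and> continuous_on W h0
       \<and> (\<forall>w\<in>W. f w \<noteq> None \<longrightarrow> k w = Some (the (f w) * g0 w + h0 w)))}"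

text \<open>\<open>agrees W D e h\<close>: h is the continuous C*-valued extension to W of the expression e,
  defined pointwise on the set D where all the functions involved are finite.\<close>
definition agrees :: "'w::topological_space set \<Rightarrow> ('w \<Rightarrow> bool) \<Rightarrow> ('w \<Rightarrow> complex)
                      \<Rightarrow> ('w \<Rightarrow> complex option) \<Rightarrow> bool" where
  "agrees W D e h \<longleftrightarrow> cont_star W h \<and> ext_fun W h \<and> (\<forall>w\<in>W. D w \<longrightarrow> h w = Some (e w))"

end

theory Submission
  imports Defs
begin

text \<open>
  A character of the C*-algebra attaining the norm at a given element comes from a maximal
  preordering of the self-adjoint part: Zorn's lemma makes the preordering total, completeness of
  the norm makes it Archimedean, and the induced cuts of the real line are multiplicative. This
  gives the isometry with \<open>C(W)\<close> without spectral theory, with Stone-Weierstrass for surjectivity.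

  For quasi-positive \<open>a\<close> and positive \<open>m\<close>, if \<open>x \<rightarrow> a\<close> with \<open>x\<close> positive, the resolvent identity and (T3)
  make \<open>(1 + xm)\<^sup>-\<^sup>1\<close> a \<open>\<tau>\<close>-Cauchy net, whose limit \<open>z\<close> is positive of norm at most 1 by (T4);
  likewise \<open>avz\<close>, as the limit of \<open>xv(1 + xm)\<^sup>-\<^sup>1\<close>, lies in the C*-algebra whenever \<open>0 \<le> v \<le> m\<close>.
  Such a \<open>z\<close> is cancellable even in the completion, because \<open>(1 + \<epsilon>am)\<^sup>-\<^sup>1\<close> is a multiple
  of \<open>z\<close> and tends to 1. Hence an element \<open>c = ax + y\<close> is a fraction \<open>w / z\<close> with \<open>w\<close>, \<open>z\<close> in the
  C*-algebra, the transforms of \<open>w\<close> and \<open>z\<close> have no common zero, and the transform of \<open>c\<close> is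
  the quotient of theirs, for every such representation. The asserted identities become
  identities between fractions, and uniqueness of continuous extensions follows from the zeros of the
  transform of \<open>z\<close> being nowhere dense.
\<close>

text \<open>The obstacle is that a character has no value at an element outside \<open>A0\<close>,
  and that the product of two tau-convergent nets need not converge to the product of the limits. So
  a quasi-positive element is only studied through its products with elements of \<open>A0\<close>,
  and an identity is transported by multiplying both sides with cancellable elements until
  everything lies in \<open>A0\<close>. The absolute value in the denominator z = (1 + a|x|)^{-1} is
  what keeps w = (ax + y)z and z from vanishing together: formally |axz| = a|x|z = 1 - z, so the
  numerator has modulus 1 at every zero of z. The transform is defined through an arbitrarily chosen
  representation ax + y, so independence of that choice is part of what has to be shown.\<close>

lemma open_vimage_coordinate:
  "open S \<Longrightarrow> open ((\<lambda>h::'a \<Rightarrow> 'b::topological_space. h i) -` S)"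
  by (rule open_vimage) auto

text \<open>The chain of instances ends in \<open>t2_space\<close>, the class over which
  Stone-Weierstrass is applied: characters are points of a function type.\<close>

instance "fun" :: (type, t0_space) t0_space
proof
  fix f g :: "'a \<Rightarrow> 'b"
  assume "f \<noteq> g"
  then obtain i where "f i \<noteq> g i" by blast
  then obtain U where "open U" "f i \<in> U \<longleftrightarrow> g i \<notin> U"
    using separation_t0[of "f i" "g i"] by blast
  then show "\<exists>U. open U \<and> \<not> (f \<in> U \<longleftrightarrow> g \<in> U)"
    by (intro exI[of _ "(\<lambda>h. h i) -` U"]) (auto simp: open_vimage_coordinate)
qed

instance "fun" :: (type, t1_space) t1_space
proof
  fix f g :: "'a \<Rightarrow> 'b"
  assume "f \<noteq> g"
  then obtain i where "f i \<noteq> g i" by blast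
  then obtain U where "open U" "f i \<in> U" "g i \<notin> U"
    using separation_t1[of "f i" "g i"] by blast
  then show "\<exists>U. open U \<and> f \<in> U \<and> g \<notin> U"
    by (intro exI[of _ "(\<lambda>h. h i) -` U"]) (auto simp: open_vimage_coordinate)
qed

instance "fun" :: (type, t2_space) t2_space
proof
  fix f g :: "'a \<Rightarrow> 'b"
  assume "f \<noteq> g"
  then obtain i where "f i \<noteq> g i" by blast
  then obtain U V where "open U" "open V" "f i \<in> U" "g i \<in> V" "U \<inter> V = {}"
    using separation_t2[of "f i" "g i"] by blast
  then show "\<exists>U V. open U \<and> open V \<and> f \<in> U \<and> g \<in> V \<and> U \<inter> V = {}"
    by (intro exI[of _ "(\<lambda>h. h i) -` U"] exI[of _ "(\<lambda>h. h i) -` V"])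
      (auto simp: open_vimage_coordinate)
qed

text \<open>The extended plane is Hausdorff and the complement of a nowhere dense set is dense. Two
  cases have to be excluded at \<open>w\<close>: one value finite and the other infinite, and two
  distinct finite values.\<close>

lemma cont_star_eqI:
  assumes k: "cont_star X k" and k': "cont_star X k'" and S: "nowhere_dense_in X S"
    and eq: "\<And>x. \<lbrakk>x \<in> X; x \<notin> S\<rbrakk> \<Longrightarrow> k x = k' x" and w: "w \<in> X"
  shows "k w = k' w"
proof (cases "w \<in> S")
  case True
  \<comment> \<open>Since \<open>w\<close> lies in \<open>S\<close>, a point outside
    \<open>S\<close> near \<open>w\<close> differs from \<open>w\<close>, so properties that hold
    eventually at \<open>w\<close> apply to it.\<close>
  have freq: "\<exists>v\<in>X. k v = k' v \<and> Q v" if ev: "eventually Q (at w within X)" for Q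
  proof -
    obtain T where T: "open T" "w \<in> T" "\<And>v. \<lbrakk>v \<in> T; v \<noteq> w; v \<in> X\<rbrakk> \<Longrightarrow> Q v"
      using ev unfolding eventually_at_topological by blast
    have "openin (top_of_set X) (X \<inter> T)" "X \<inter> T \<noteq> {}" using T w by (auto simp: openin_open)
    then obtain V where "V \<noteq> {}" "V \<subseteq> X \<inter> T" "V \<inter> S = {}"
      using S unfolding nowhere_dense_in_def by meson
    then obtain v where "v \<in> X" "v \<in> T" "v \<notin> S" by blast
    then show ?thesis using True T(3)[of v] eq[of v] by auto
  qed
  have no: False if "f w = None" "g w = Some c" "cont_star X f" "cont_star X g"
    and fg: "\<And>v. k v = k' v \<Longrightarrow> f v = g v" for f g c
  proof -
    have "eventually (\<lambda>v. case f v of None \<Rightarrow> True | Some d \<Rightarrow> cmod d > cmod c + 1) (at w within X)"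
      using that w by (force simp: cont_star_def)
    moreover have "eventually (\<lambda>v. g v \<noteq> None) (at w within X)" "((\<lambda>v. the (g v)) \<longlongrightarrow> c) (at w within X)"
      using that w by (force simp: cont_star_def)+
    then have "eventually (\<lambda>v. g v \<noteq> None \<and> dist (the (g v)) c < 1) (at w within X)"
      using tendstoD[of _ c _ 1] by (simp add: eventually_conj_iff)
    ultimately have "eventually (\<lambda>v. (case f v of None \<Rightarrow> True | Some d \<Rightarrow> cmod d > cmod c + 1)
        \<and> g v \<noteq> None \<and> dist (the (g v)) c < 1) (at w within X)"
      by (simp add: eventually_conj_iff)
    from freq[OF this] obtain v where v: "k v = k' v" "case f v of None \<Rightarrow> True | Some d \<Rightarrow> cmod d > cmod c + 1"
      "g v \<noteq> None" "dist (the (g v)) c < 1" by blast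
    then obtain d where d: "g v = Some d" "f v = Some d" using fg[OF v(1)] by auto
    have "cmod d \<le> cmod c + cmod (d - c)" by (rule norm_triangle_sub)
    then show False using v d by (simp add: dist_norm)
  qed
  show ?thesis
  proof (cases "k w")
    case None
    show ?thesis
    proof (cases "k' w")
      case (Some c)
      then show ?thesis using no[OF None Some k k'] by blast
    qed (use None in simp)
  next
    case (Some c)
    show ?thesis
    proof (cases "k' w")
      case None
      then show ?thesis using no[OF None Some k' k] by metis
    next
      case (Some d)
      have "c = d"
      proof (rule ccontr)
        assume "c \<noteq> d"
        then have e: "dist c d / 2 > 0" by simp
        have "((\<lambda>v. the (k v)) \<longlongrightarrow> c) (at w within X)" "((\<lambda>v. the (k' v)) \<longlongrightarrow> d) (at w within X)"
          using k k' w \<open>k w = Some c\<close> Some by (force simp: cont_star_def)+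
        from tendstoD[OF this(1) e] tendstoD[OF this(2) e]
        have "eventually (\<lambda>v. dist (the (k v)) c < dist c d / 2 \<and> dist (the (k' v)) d < dist c d / 2) (at w within X)"
          by (rule eventually_conj)
        from freq[OF this] obtain v where "k v = k' v" "dist (the (k v)) c < dist c d / 2"
          "dist (the (k' v)) d < dist c d / 2" by blast
        then show False using dist_triangle[of c d "the (k v)"] by (simp add: dist_commute)
      qed
      then show ?thesis using Some \<open>k w = Some c\<close> by simp
    qed
  qed
qed (use eq w in blast)

section \<open>Commutative C*-algebras\<close>

locale comm_cstar =
  fixes smul :: "complex \<Rightarrow> 'a::ab_group_add \<Rightarrow> 'a" (infixr "\<star>" 75)
    and A0 :: "'a set" and one :: 'a ("\<one>") and mul :: "'a \<Rightarrow> 'a \<Rightarrow> 'a" (infixl "\<odot>" 70)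
    and invl :: "'a \<Rightarrow> 'a" and nrm :: "'a \<Rightarrow> real"
  assumes vs: "complex_vs smul" and cs: "cstar_algebra smul A0 one mul invl nrm"
    and comm: "\<forall>x\<in>A0. \<forall>y\<in>A0. mul x y = mul y x"
begin

lemma smul_add: "c \<star> (a + b) = c \<star> a + c \<star> b"
  and smul_add_left: "(c + d) \<star> a = c \<star> a + d \<star> a"
  and smul_smul: "c \<star> d \<star> a = (c * d) \<star> a"
  and smul_one [simp]: "1 \<star> a = a"
  using vs by (auto simp: complex_vs_def)

lemma smul_zero [simp]: "c \<star> 0 = 0"
  using smul_add[of c 0 0] by simp

lemma zero_smul [simp]: "0 \<star> a = 0"
  using smul_add_left[of 0 0 a] by simp

lemma smul_minus: "c \<star> (- a) = - (c \<star> a)"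
  using smul_add[of c a "- a"] by (simp add: minus_unique)

lemma minus_smul: "(- c) \<star> a = - (c \<star> a)"
  using smul_add_left[of c "- c" a] by (simp add: minus_unique)

lemma smul_diff: "c \<star> (a - b) = c \<star> a - c \<star> b"
  using smul_add[of c a "- b"] by (simp add: smul_minus)

lemma smul_diff_left: "(c - d) \<star> a = c \<star> a - d \<star> a"
  using smul_add_left[of c "- d" a] by (simp add: minus_smul)

lemma smul_two: "2 \<star> a = a + a"
  using smul_add_left[of 1 1 a] by simp

lemma A0_zero [simp]: "0 \<in> A0"
  and A0_add [simp]: "\<lbrakk>x \<in> A0; y \<in> A0\<rbrakk> \<Longrightarrow> x + y \<in> A0"
  and A0_smul [simp]: "x \<in> A0 \<Longrightarrow> c \<star> x \<in> A0"
  and A0_one [simp]: "\<one> \<in> A0"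
  and A0_mul [simp]: "\<lbrakk>x \<in> A0; y \<in> A0\<rbrakk> \<Longrightarrow> x \<odot> y \<in> A0"
  and A0_invl [simp]: "x \<in> A0 \<Longrightarrow> invl x \<in> A0"
  using cs by (simp_all add: cstar_algebra_def)

lemma A0_uminus [simp]: "x \<in> A0 \<Longrightarrow> - x \<in> A0"
  using A0_smul[of x "-1"] by (simp add: minus_smul)

lemma A0_diff [simp]: "\<lbrakk>x \<in> A0; y \<in> A0\<rbrakk> \<Longrightarrow> x - y \<in> A0"
  using A0_add[of x "- y"] by simp

lemma mul_assoc: "\<lbrakk>x \<in> A0; y \<in> A0; z \<in> A0\<rbrakk> \<Longrightarrow> x \<odot> y \<odot> z = x \<odot> (y \<odot> z)"
  and mul_add: "\<lbrakk>x \<in> A0; y \<in> A0; z \<in> A0\<rbrakk> \<Longrightarrow> x \<odot> (y + z) = x \<odot> y + x \<odot> z"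
  and add_mul: "\<lbrakk>x \<in> A0; y \<in> A0; z \<in> A0\<rbrakk> \<Longrightarrow> (x + y) \<odot> z = x \<odot> z + y \<odot> z"
  and smul_mul: "\<lbrakk>x \<in> A0; y \<in> A0\<rbrakk> \<Longrightarrow> (c \<star> x) \<odot> y = c \<star> (x \<odot> y)"
  and mul_smul: "\<lbrakk>x \<in> A0; y \<in> A0\<rbrakk> \<Longrightarrow> x \<odot> (c \<star> y) = c \<star> (x \<odot> y)"
  and one_mul [simp]: "x \<in> A0 \<Longrightarrow> \<one> \<odot> x = x"
  and mul_one [simp]: "x \<in> A0 \<Longrightarrow> x \<odot> \<one> = x"
  using cs by (simp_all add: cstar_algebra_def)

lemma mul_comm: "\<lbrakk>x \<in> A0; y \<in> A0\<rbrakk> \<Longrightarrow> x \<odot> y = y \<odot> x"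
  using comm by blast

lemma mul_left_comm: "\<lbrakk>x \<in> A0; y \<in> A0; z \<in> A0\<rbrakk> \<Longrightarrow> x \<odot> (y \<odot> z) = y \<odot> (x \<odot> z)"
  by (metis mul_assoc mul_comm)

lemma zero_mul [simp]: "x \<in> A0 \<Longrightarrow> 0 \<odot> x = 0"
  and mul_zero [simp]: "x \<in> A0 \<Longrightarrow> x \<odot> 0 = 0"
  using smul_mul[of 0 x 0] mul_smul[of x 0 0] by simp_all

lemma mul_minus: "\<lbrakk>x \<in> A0; y \<in> A0\<rbrakk> \<Longrightarrow> x \<odot> (- y) = - (x \<odot> y)"
  and minus_mul: "\<lbrakk>x \<in> A0; y \<in> A0\<rbrakk> \<Longrightarrow> (- x) \<odot> y = - (x \<odot> y)"
  using smul_mul[of x y "-1"] mul_smul[of x y "-1"] by (simp_all add: minus_smul)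

lemma mul_diff: "\<lbrakk>x \<in> A0; y \<in> A0; z \<in> A0\<rbrakk> \<Longrightarrow> x \<odot> (y - z) = x \<odot> y - x \<odot> z"
  and diff_mul: "\<lbrakk>x \<in> A0; y \<in> A0; z \<in> A0\<rbrakk> \<Longrightarrow> (x - y) \<odot> z = x \<odot> z - y \<odot> z"
  using mul_add[of x y "- z"] add_mul[of x "- y" z] by (simp_all add: mul_minus minus_mul)

lemmas distribs = mul_add add_mul smul_mul mul_smul mul_minus minus_mul mul_diff diff_mul
  smul_add smul_add_left smul_diff smul_diff_left smul_minus minus_smul smul_smul
lemmas mul_ac = mul_assoc mul_comm mul_left_comm

lemma invl_add: "\<lbrakk>x \<in> A0; y \<in> A0\<rbrakk> \<Longrightarrow> invl (x + y) = invl x + invl y"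
  and invl_smul: "x \<in> A0 \<Longrightarrow> invl (c \<star> x) = cnj c \<star> invl x"
  and invl_invl [simp]: "x \<in> A0 \<Longrightarrow> invl (invl x) = x"
  using cs by (simp_all add: cstar_algebra_def)

lemma invl_mul: "\<lbrakk>x \<in> A0; y \<in> A0\<rbrakk> \<Longrightarrow> invl (x \<odot> y) = invl x \<odot> invl y"
  using cs mul_comm by (simp add: cstar_algebra_def)

lemma invl_minus: "x \<in> A0 \<Longrightarrow> invl (- x) = - invl x"
  using invl_smul[of x "-1"] by (simp add: minus_smul)

lemma invl_diff: "\<lbrakk>x \<in> A0; y \<in> A0\<rbrakk> \<Longrightarrow> invl (x - y) = invl x - invl y"
  using invl_add[of x "- y"] by (simp add: invl_minus)

lemma invl_zero [simp]: "invl 0 = 0"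
  using invl_add[of 0 0] by simp

lemma invl_one [simp]: "invl \<one> = \<one>"
  using invl_mul[of \<one> "invl \<one>"] by simp

lemma nrm_nonneg [simp]: "x \<in> A0 \<Longrightarrow> 0 \<le> nrm x"
  and nrm_eq_0: "x \<in> A0 \<Longrightarrow> nrm x = 0 \<longleftrightarrow> x = 0"
  and nrm_add: "\<lbrakk>x \<in> A0; y \<in> A0\<rbrakk> \<Longrightarrow> nrm (x + y) \<le> nrm x + nrm y"
  and nrm_smul: "x \<in> A0 \<Longrightarrow> nrm (c \<star> x) = cmod c * nrm x"
  and nrm_mul: "\<lbrakk>x \<in> A0; y \<in> A0\<rbrakk> \<Longrightarrow> nrm (x \<odot> y) \<le> nrm x * nrm y"
  and nrm_cstar: "x \<in> A0 \<Longrightarrow> nrm (invl x \<odot> x) = (nrm x)\<^sup>2"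
  and nrm_one [simp]: "nrm \<one> = 1"
  using cs by (simp_all add: cstar_algebra_def)

lemma nrm_rscale: "x \<in> A0 \<Longrightarrow> nrm (complex_of_real r \<star> x) = \<bar>r\<bar> * nrm x"
  by (simp add: nrm_smul)

lemma nrm_complete:
  assumes "\<And>n. X n \<in> A0" "\<And>e. e > 0 \<Longrightarrow> \<exists>N. \<forall>m\<ge>N. \<forall>n\<ge>N. nrm (X m - X n) < e"
  shows "\<exists>x\<in>A0. \<forall>e>0. \<exists>N. \<forall>n\<ge>N. nrm (X (n::nat) - x) < e"
proof -
  have "\<forall>X::nat \<Rightarrow> 'a. (\<forall>n. X n \<in> A0) \<and> (\<forall>\<epsilon>>0. \<exists>N. \<forall>m\<ge>N. \<forall>n\<ge>N. nrm (X m - X n) < \<epsilon>)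
          \<longrightarrow> (\<exists>x\<in>A0. \<forall>\<epsilon>>0. \<exists>N. \<forall>n\<ge>N. nrm (X n - x) < \<epsilon>)"
    using cs unfolding cstar_algebra_def by (elim conjE)
  then show ?thesis using assms by blast
qed

lemma nrm_zero [simp]: "nrm 0 = 0"
  by (simp add: nrm_eq_0)

lemma nrm_minus: "x \<in> A0 \<Longrightarrow> nrm (- x) = nrm x"
  using nrm_smul[of x "-1"] by (simp add: minus_smul)

lemma nrm_minus_commute: "\<lbrakk>x \<in> A0; y \<in> A0\<rbrakk> \<Longrightarrow> nrm (x - y) = nrm (y - x)"
  using nrm_minus[of "x - y"] by simp

lemma nrm_diff: "\<lbrakk>x \<in> A0; y \<in> A0\<rbrakk> \<Longrightarrow> nrm (x - y) \<le> nrm x + nrm y"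
  using nrm_add[of x "- y"] by (simp add: nrm_minus)

lemma nrm_triangle: "\<lbrakk>x \<in> A0; y \<in> A0; z \<in> A0\<rbrakk> \<Longrightarrow> nrm (x - z) \<le> nrm (x - y) + nrm (y - z)"
  using nrm_add[of "x - y" "y - z"] by simp

lemma nrm_invl: assumes "x \<in> A0" shows "nrm (invl x) = nrm x"
proof -
  have *: "nrm y \<le> nrm (invl y)" if "y \<in> A0" for y
  proof (cases "nrm y = 0")
    case False
    have "nrm y * nrm y \<le> nrm (invl y) * nrm y"
      using nrm_cstar[OF that] nrm_mul[of "invl y" y] that by (simp add: power2_eq_square)
    moreover have "0 < nrm y" using False nrm_nonneg[OF that] by linarith
    ultimately show ?thesis by simp
  qed (use that in auto)
  from *[OF assms] *[of "invl x"] assms show ?thesis by simp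
qed

text \<open>Takes the place of power series: it yields the square roots of
  \<open>sqrt_one_minus\<close> and the Neumann series of \<open>W_bound\<close>.\<close>

lemma contraction_fixpoint:
  assumes R: "0 \<le> R" and c: "c < 1"
    and T: "\<And>y. \<lbrakk>y \<in> A0; nrm y \<le> R\<rbrakk> \<Longrightarrow> T y \<in> A0 \<and> nrm (T y) \<le> R"
    and con: "\<And>y z. \<lbrakk>y \<in> A0; nrm y \<le> R; z \<in> A0; nrm z \<le> R\<rbrakk> \<Longrightarrow> nrm (T y - T z) \<le> c * nrm (y - z)"
  shows "\<exists>y\<in>A0. nrm y \<le> R \<and> T y = y"
proof -
  define M where "M = {y\<in>A0. nrm y \<le> R}"
  \<comment> \<open>\<open>Metric_space\<close> asks for symmetry and nonnegativity everywhere,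
    while the norm has them only on \<open>A0\<close>; hence the default value 0.\<close>
  define d where "d = (\<lambda>y z. if y \<in> A0 \<and> z \<in> A0 then nrm (y - z) else 0)"
  interpret Metric_space M d
    by unfold_locales (auto simp: d_def M_def nrm_minus_commute nrm_eq_0 nrm_triangle)
  have mc: mcomplete
    unfolding mcomplete_def
  proof (intro allI impI)
    fix X assume X: "MCauchy X"
    then have "X n \<in> M" for n by (auto simp: MCauchy_def)
    then have XM: "X n \<in> A0" "nrm (X n) \<le> R" for n by (auto simp: M_def)
    have "\<exists>x\<in>A0. \<forall>e>0. \<exists>N. \<forall>n\<ge>N. nrm (X n - x) < e"
    proof (rule nrm_complete)
      fix e :: real assume "e > 0"
      with X obtain N where "\<And>m n. \<lbrakk>N \<le> m; N \<le> n\<rbrakk> \<Longrightarrow> d (X m) (X n) < e"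
        unfolding MCauchy_def by blast
      then show "\<exists>N. \<forall>m\<ge>N. \<forall>n\<ge>N. nrm (X m - X n) < e"
        using XM by (auto simp: d_def)
    qed (use XM in auto)
    then obtain x where x: "x \<in> A0" "\<And>e. e>0 \<Longrightarrow> \<exists>N. \<forall>n\<ge>N. nrm (X n - x) < e" by blast
    have "nrm x \<le> R"
    proof (rule field_le_epsilon)
      fix e :: real assume "e > 0"
      then obtain n where "nrm (X n - x) < e" using x(2) by blast
      moreover have "nrm x \<le> nrm (X n) + nrm (X n - x)"
        using nrm_diff[of "X n" "X n - x"] XM x(1) by simp
      ultimately show "nrm x \<le> R + e" using XM(2)[of n] by simp
    qed
    then show "\<exists>x. limitin mtopology X x sequentially"
      using x XM unfolding limit_metric_sequentially by (auto simp: d_def M_def)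
  qed
  have "M \<noteq> {}" using R by (auto simp: M_def intro: exI[of _ 0])
  moreover have "T \<in> M \<rightarrow> M" using T by (auto simp: M_def)
  moreover have "d (T y) (T z) \<le> c * d y z" if "y \<in> M" "z \<in> M" for y z
    using that T con by (auto simp: M_def d_def)
  ultimately obtain y where "y \<in> M" "T y = y"
    using Banach_fixedpoint_thm[OF mc _ _ c] by metis
  then show ?thesis by (auto simp: M_def)
qed

section \<open>Square roots and the positive cone described by the norm\<close>

definition sa :: "'a set" where "sa = {x\<in>A0. invl x = x}"

lemma sa_A0: "x \<in> sa \<Longrightarrow> x \<in> A0" and sa_invl: "x \<in> sa \<Longrightarrow> invl x = x"
  by (auto simp: sa_def)

lemma sa_intros [simp]: "0 \<in> sa" "\<one> \<in> sa" "\<lbrakk>x \<in> sa; y \<in> sa\<rbrakk> \<Longrightarrow> x + y \<in> sa"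
  "\<lbrakk>x \<in> sa; y \<in> sa\<rbrakk> \<Longrightarrow> x - y \<in> sa" "\<lbrakk>x \<in> sa; y \<in> sa\<rbrakk> \<Longrightarrow> x \<odot> y \<in> sa"
  "x \<in> sa \<Longrightarrow> complex_of_real r \<star> x \<in> sa" "x \<in> sa \<Longrightarrow> - x \<in> sa"
  by (auto simp: sa_def invl_add invl_diff invl_mul invl_smul invl_minus)

text \<open>With s = 1 - y the equation becomes y = (k + y^2) / 2, whose right-hand side maps the
  ball of radius \<open>nrm k\<close> into itself and contracts it by the factor
  \<open>nrm k\<close>.\<close>

lemma sqrt_one_minus:
  assumes k: "k \<in> sa" "nrm k < 1"
  shows "\<exists>s\<in>sa. s \<odot> s = \<one> - k"
proof -
  define T where "T = (\<lambda>y. (1/2) \<star> (k + y \<odot> y))"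
  let ?c = "nrm k"
  have kA: "k \<in> A0" using k sa_A0 by blast
  have con: "nrm (T y - T z) \<le> ?c * nrm (y - z)" if "y \<in> A0" "nrm y \<le> ?c" "z \<in> A0" "nrm z \<le> ?c" for y z
  proof -
    have "T y - T z = (1/2) \<star> ((y + z) \<odot> (y - z))"
      using that kA by (simp add: T_def distribs mul_comm[of z y])
    then have "nrm (T y - T z) \<le> 1/2 * (nrm (y + z) * nrm (y - z))"
      using that nrm_mul[of "y + z" "y - z"] by (simp add: nrm_smul)
    also have "\<dots> \<le> 1/2 * ((2 * ?c) * nrm (y - z))"
      using that nrm_add[of y z] by (intro mult_left_mono mult_right_mono) auto
    finally show ?thesis by simp
  qed
  have ball: "nrm (T y) \<le> ?c" if "y \<in> A0" "nrm y \<le> ?c" for y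
  proof -
    have "nrm (y \<odot> y) \<le> ?c * ?c"
      using nrm_mul[OF that(1,1)] mult_mono[OF that(2,2)] that kA by simp
    moreover have "?c * ?c \<le> ?c" using k kA mult_left_le[of ?c ?c] by simp
    ultimately have "nrm (k + y \<odot> y) \<le> 2 * ?c" using nrm_add[of k "y \<odot> y"] kA that by simp
    then show ?thesis using kA that by (simp add: T_def nrm_smul)
  qed
  have "\<exists>y\<in>A0. nrm y \<le> ?c \<and> T y = y"
    by (rule contraction_fixpoint[OF _ k(2)]) (use kA con ball in \<open>auto simp: T_def\<close>)
  then obtain y where y: "y \<in> A0" "nrm y \<le> ?c" "T y = y" by blast
  \<comment> \<open>The involution commutes with \<open>T\<close>, so \<open>invl y\<close> is a
    fixed point as well; the contraction estimate forces it to equal \<open>y\<close>.\<close>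
  have "T (invl y) = invl (T y)"
    using y(1) kA k(1) by (simp add: T_def invl_smul invl_add invl_mul sa_invl)
  with y have "nrm (invl y - y) \<le> ?c * nrm (invl y - y)"
    using con[of "invl y" y] by (simp add: nrm_invl)
  then have "(1 - ?c) * nrm (invl y - y) \<le> 0" by (simp add: algebra_simps)
  then have "nrm (invl y - y) = 0"
    using k(2) y(1) nrm_nonneg[of "invl y - y"] by (auto simp: mult_le_0_iff intro: order_antisym)
  then have "y \<in> sa" using y(1) by (simp add: nrm_eq_0 sa_def)
  moreover have "k + y \<odot> y = y + y"
    using smul_two[of "T y"] unfolding T_def smul_smul by (simp add: y(3)[unfolded T_def])
  then have yy: "y \<odot> y = y + y - k" by (simp add: eq_diff_eq add.commute)
  have "(\<one> - y) \<odot> (\<one> - y) = \<one> - k"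
    using y(1) by (simp add: mul_diff diff_mul yy)
  ultimately show ?thesis by (meson sa_intros)
qed

abbreviation sc :: "real \<Rightarrow> 'a" where "sc r \<equiv> complex_of_real r \<star> \<one>"

text \<open>By commutativity u = h + i s satisfies u*u = s^2 + h^2 = c, so the C*-identity gives the
  norm of u, and 2h = u + u*.\<close>

lemma sq_norm:
  assumes s: "s \<in> sa" and h: "h \<in> sa" and e: "s \<odot> s + h \<odot> h = sc c" and c: "0 \<le> c"
  shows "nrm (h \<odot> h) \<le> c"
proof -
  have A: "s \<in> A0" "h \<in> A0" using s h sa_A0 by auto
  let ?u = "h + \<i> \<star> s"
  have "invl ?u \<odot> ?u = sc c"
    using A s h e by (simp add: invl_add invl_smul sa_invl distribs mul_comm[of s h] add.commute)
  then have u: "(nrm ?u)\<^sup>2 = c" using A c nrm_cstar[of ?u] by (simp add: nrm_smul)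
  have "2 \<star> h = ?u + invl ?u" using A s h by (simp add: invl_add invl_smul sa_invl smul_two minus_smul)
  then have "nrm (2 \<star> h) \<le> 2 * nrm ?u" using nrm_add[of ?u "invl ?u"] A nrm_invl[of ?u] by simp
  then have "nrm h \<le> nrm ?u" using A by (simp add: nrm_smul)
  then have "(nrm h)\<^sup>2 \<le> c" unfolding u[symmetric] using A by (simp add: power_mono)
  then show ?thesis using nrm_cstar[OF A(2)] h by (simp add: sa_invl)
qed

text \<open>The classical norm characterisation of positive elements. Sums and scalings are handled
  by the triangle inequality, whereas for the elements y*y closure under addition is not visible at
  this stage.\<close>

definition ncone :: "'a set" where "ncone = {k\<in>sa. \<exists>t\<ge>0. nrm (sc t - k) \<le> t}"

lemma ncone_sa: "k \<in> ncone \<Longrightarrow> k \<in> sa" by (simp add: ncone_def)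

lemma nrm_sc [simp]: "nrm (sc r) = \<bar>r\<bar>" by (simp add: nrm_smul)

lemma sc_sa [simp]: "sc r \<in> sa" and sc_A0 [simp]: "sc r \<in> A0" by auto

lemma sc_add: "sc (r + s) = sc r + sc s"
  and sc_mul: "x \<in> A0 \<Longrightarrow> sc r \<odot> x = complex_of_real r \<star> x"
  by (simp_all add: distribs)

lemma ncone_add: assumes "k \<in> ncone" "l \<in> ncone" shows "k + l \<in> ncone"
proof -
  obtain t s where *: "t \<ge> 0" "nrm (sc t - k) \<le> t" "s \<ge> 0" "nrm (sc s - l) \<le> s" "k \<in> sa" "l \<in> sa"
    using assms by (auto simp: ncone_def)
  have "nrm (sc (t + s) - (k + l)) \<le> nrm (sc t - k) + nrm (sc s - l)"
    using nrm_add[of "sc t - k" "sc s - l"] * by (simp add: distribs sa_A0 algebra_simps)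
  with * have "nrm (sc (t + s) - (k + l)) \<le> t + s" by linarith
  with * show ?thesis unfolding ncone_def by (auto intro!: exI[of _ "t + s"])
qed

lemma ncone_scale: assumes "k \<in> ncone" "r \<ge> 0" shows "complex_of_real r \<star> k \<in> ncone"
proof -
  obtain t where *: "t \<ge> 0" "nrm (sc t - k) \<le> t" "k \<in> sa"
    using assms by (auto simp: ncone_def)
  have "sc (r * t) - complex_of_real r \<star> k = complex_of_real r \<star> (sc t - k)"
    by (simp add: distribs)
  then have "nrm (sc (r * t) - complex_of_real r \<star> k) \<le> r * t"
    using * assms(2) by (simp only: nrm_smul sa_A0 A0_diff sc_A0) (simp add: mult_left_mono)
  with * assms show ?thesis unfolding ncone_def by (auto intro!: exI[of _ "r * t"])
qed

lemma ncone_bound: "h \<in> sa \<Longrightarrow> nrm h \<le> t \<Longrightarrow> sc t - h \<in> ncone"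
  unfolding ncone_def using order_trans[OF nrm_nonneg[OF sa_A0], of h t] by (auto simp: sa_A0 intro!: exI[of _ t])

lemma ncone_sc: "r \<ge> 0 \<Longrightarrow> sc r \<in> ncone"
  using ncone_bound[of 0 r] by simp

text \<open>The shift by \<open>e\<close> makes the inequality strict: k + e = (t + e)(1 - m), where
  m = (t - k) / (t + e) has norm at most t / (t + e) < 1.\<close>

lemma ncone_sqrt:
  assumes "k \<in> ncone" "e > 0" shows "\<exists>s\<in>sa. s \<odot> s = k + sc e"
proof -
  obtain t where *: "t \<ge> 0" "nrm (sc t - k) \<le> t" "k \<in> sa"
    using assms by (auto simp: ncone_def)
  define m where "m = complex_of_real (1 / (t + e)) \<star> (sc t - k)"
  have "m \<in> sa" unfolding m_def using * by (intro sa_intros)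
  moreover have "nrm m < 1"
    unfolding m_def using * assms(2) sa_A0[OF *(3)]
    by (subst nrm_rscale) (auto simp: field_simps)
  ultimately obtain s where s: "s \<in> sa" "s \<odot> s = \<one> - m" using sqrt_one_minus by blast
  let ?s = "complex_of_real (sqrt (t + e)) \<star> s"
  have "?s \<odot> ?s = complex_of_real (t + e) \<star> (\<one> - m)"
    using s * assms(2) by (simp add: sa_A0 distribs flip: of_real_mult of_real_add)
  also have "complex_of_real (t + e) \<star> m = sc t - k"
    using * assms(2) by (simp add: m_def smul_smul flip: of_real_mult of_real_add of_real_divide)
  then have "complex_of_real (t + e) \<star> (\<one> - m) = k + sc e"
    by (simp add: smul_diff smul_add_left)
  finally show ?thesis using s(1) by (meson sa_intros)
qed

text \<open>The element t - h^2 is itself a square, so \<open>sq_norm\<close> applies with the roles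
  of \<open>h\<close> and of that root exchanged.\<close>

lemma sq_nrm_le:
  assumes h: "h \<in> sa" and t: "nrm (h \<odot> h) < t"
  shows "nrm (sc t - h \<odot> h) \<le> t"
proof -
  have A: "h \<in> A0" using h sa_A0 by blast
  have t0: "t > 0" using t nrm_nonneg[of "h \<odot> h"] A by (meson A0_mul order.strict_trans1)
  have "complex_of_real (1/t) \<star> (h \<odot> h) \<in> sa" "nrm (complex_of_real (1/t) \<star> (h \<odot> h)) < 1"
    using h t t0 A by (auto simp: nrm_rscale simp del: of_real_divide)
  then obtain s where s: "s \<in> sa" "s \<odot> s = \<one> - complex_of_real (1/t) \<star> (h \<odot> h)"
    using sqrt_one_minus by blast
  let ?s = "complex_of_real (sqrt t) \<star> s"
  have "?s \<odot> ?s = complex_of_real t \<star> (s \<odot> s)"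
    using s t0 by (simp add: sa_A0 distribs flip: of_real_mult)
  also have "\<dots> = sc t - h \<odot> h" unfolding s(2) using t0 by (simp add: distribs)
  finally have ss: "?s \<odot> ?s = sc t - h \<odot> h" .
  have "h \<odot> h + ?s \<odot> ?s = sc t" unfolding ss by simp
  then have "nrm (?s \<odot> ?s) \<le> t" using s(1) h t0 by (intro sq_norm[of h]) auto
  then show ?thesis by (simp add: ss)
qed

lemma sq_ncone: "h \<in> sa \<Longrightarrow> h \<odot> h \<in> ncone"
  using sq_nrm_le[of h "nrm (h \<odot> h) + 1"]
  by (auto simp: ncone_def sa_A0 intro!: exI[of _ "nrm (h \<odot> h) + 1"])

lemma ncone_closed:
  assumes k: "k \<in> sa" and e: "\<And>e. e > 0 \<Longrightarrow> k + sc e \<in> ncone"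
  shows "k \<in> ncone"
proof -
  have A: "k \<in> A0" using k sa_A0 by blast
  \<comment> \<open>One bound that exceeds the norm of k + d for every d < 1, so that d can tend to
    0 with \<open>?t\<close> fixed.\<close>
  let ?t = "nrm k + 2"
  have "nrm (sc ?t - k) \<le> ?t + d" if d: "0 < d" "d < 1" for d
  proof -
    obtain s where s: "s \<in> sa" "s \<odot> s = k + sc (d/2) + sc (d/2)"
      using ncone_sqrt[OF e[of "d/2"], of "d/2"] d by auto
    then have s2: "s \<odot> s = k + sc d" using sc_add[of "d/2" "d/2"] by (simp add: add.assoc)
    then have "nrm (s \<odot> s) < ?t" using nrm_add[of k "sc d"] A d by simp
    from sq_nrm_le[OF s(1) this] have "nrm (sc ?t - (k + sc d)) \<le> ?t" by (simp add: s2)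
    moreover have "nrm (sc ?t - k) \<le> nrm (sc ?t - (k + sc d)) + nrm (sc d)"
      using nrm_add[of "sc ?t - (k + sc d)" "sc d"] A by simp
    ultimately show ?thesis using d by simp
  qed
  note * = this
  have "nrm (sc ?t - k) \<le> ?t"
  proof (rule field_le_epsilon)
    fix e :: real assume "e > 0"
    then show "nrm (sc ?t - k) \<le> ?t + e" using *[of "min e (1/2)"] by linarith
  qed
  then show ?thesis using k A unfolding ncone_def by (auto intro!: exI[of _ ?t])
qed

text \<open>The shifted factors k + d and l + d have roots, and the product of the shifted factors
  is the square of the product of the roots. Adding d(N - (k + l + d)) and e - dN, where N =
  \<open>nrm k + nrm l + d\<close>, turns it into kl + e; both summands lie in the cone.\<close>

lemma ncone_mul: assumes k: "k \<in> ncone" and l: "l \<in> ncone" shows "k \<odot> l \<in> ncone"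
proof (rule ncone_closed)
  have S: "k \<in> sa" "l \<in> sa" using k l ncone_sa by auto
  then have A: "k \<in> A0" "l \<in> A0" using sa_A0 by auto
  show "k \<odot> l \<in> sa" using S by simp
  fix e :: real assume e: "e > 0"
  let ?N = "nrm k + nrm l + 1"
  have N: "?N > 0" using nrm_nonneg[OF A(1)] nrm_nonneg[OF A(2)] by linarith
  \<comment> \<open>The bound 1 gives d(\<open>nrm k + nrm l + d\<close>) <= d \<open>?N\<close>,
    and the other bound makes this at most \<open>e\<close>.\<close>
  define d where "d = min 1 (e / ?N)"
  have d: "d > 0" "d \<le> 1" using e N by (auto simp: d_def)
  have "d * ?N \<le> e / ?N * ?N" using N by (intro mult_right_mono) (auto simp: d_def)
  then have dN: "d * ?N \<le> e" using N by simp
  obtain s t where s: "s \<in> sa" "s \<odot> s = k + sc d" and t: "t \<in> sa" "t \<odot> t = l + sc d"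
    using ncone_sqrt[OF k d(1)] ncone_sqrt[OF l d(1)] by blast
  have "(s \<odot> t) \<odot> (s \<odot> t) = (s \<odot> s) \<odot> (t \<odot> t)"
    using s(1)[THEN sa_A0] t(1)[THEN sa_A0] by (simp add: mul_ac)
  then have 1: "(k + sc d) \<odot> (l + sc d) \<in> ncone"
    using sq_ncone[of "s \<odot> t"] s t by simp
  have "sc (nrm k + nrm l + d) - (k + l + sc d) \<in> ncone"
    using A S nrm_add[of k l] nrm_add[of "k + l" "sc d"] d by (intro ncone_bound) auto
  from ncone_scale[OF this, of d] d
  have 2: "complex_of_real d \<star> (sc (nrm k + nrm l + d) - (k + l + sc d)) \<in> ncone" by simp
  have "d * (nrm k + nrm l + d) \<le> d * ?N" using d by (intro mult_left_mono) auto
  then have 3: "sc (e - d * (nrm k + nrm l + d)) \<in> ncone" using dN by (intro ncone_sc) linarith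
  have "(k + sc d) \<odot> (l + sc d) + complex_of_real d \<star> (sc (nrm k + nrm l + d) - (k + l + sc d))
     + sc (e - d * (nrm k + nrm l + d)) = k \<odot> l + sc e"
    using A by (simp add: distribs algebra_simps)
  with ncone_add[OF ncone_add[OF 1 2] 3] show "k \<odot> l + sc e \<in> ncone" by metis
qed

text \<open>Recovers a norm bound from an order bound. This is the contradiction that keeps the
  preordering of \<open>exists_character\<close> proper.\<close>

lemma ncone_sq_nrm:
  assumes h: "h \<in> sa" and c: "c \<ge> 0" and C: "sc c - h \<odot> h \<in> ncone"
  shows "nrm (h \<odot> h) \<le> c"
proof (rule field_le_epsilon)
  fix e :: real assume e: "e > 0"
  obtain s where s: "s \<in> sa" "s \<odot> s = sc c - h \<odot> h + sc e"
    using ncone_sqrt[OF C e] by blast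
  have "s \<odot> s + h \<odot> h = sc (c + e)" by (simp add: s smul_add_left algebra_simps)
  from sq_norm[OF s(1) h this] c e show "nrm (h \<odot> h) \<le> c + e" by simp
qed

lemma ncone_neg: "r < 0 \<Longrightarrow> sc r \<notin> ncone"
proof
  assume r: "r < 0" "sc r \<in> ncone"
  let ?h = "sc (sqrt (- r))"
  have "?h \<odot> ?h = sc (- r)" using r by (simp add: distribs flip: of_real_mult)
  then have "sc 0 - ?h \<odot> ?h \<in> ncone" using r by (simp add: minus_smul)
  from ncone_sq_nrm[OF _ _ this] have "nrm (?h \<odot> ?h) \<le> 0" by simp
  moreover have "nrm (?h \<odot> ?h) = - r"
    unfolding \<open>?h \<odot> ?h = sc (- r)\<close> using r by (simp only: nrm_sc)
  ultimately show False using r by simp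
qed

subsection \<open>Total preorderings\<close>

text \<open>A preordering in the sense of real algebra: squares lie in \<open>ncone\<close> by
  \<open>sq_ncone\<close>. Containing all of \<open>ncone\<close> also puts t - x and t + x into it
  for t >= \<open>nrm x\<close>, which bounds the cuts.\<close>

definition preord :: "'a set \<Rightarrow> bool" where
  "preord Q \<longleftrightarrow> Q \<subseteq> sa \<and> ncone \<subseteq> Q \<and> (\<forall>x\<in>Q. \<forall>y\<in>Q. x + y \<in> Q \<and> x \<odot> y \<in> Q)"

lemma preord_ncone: "preord ncone"
  by (auto simp: preord_def ncone_sa ncone_add ncone_mul)

text \<open>Products stay of the form u + av because a^2 is a square and so already belongs to
  \<open>Q\<close>.\<close>

lemma preord_extend:
  assumes Q: "preord Q" and a: "a \<in> sa"
  defines "E \<equiv> {u + a \<odot> v | u v. u \<in> Q \<and> v \<in> Q}"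
  shows "preord E" "Q \<subseteq> E" "a \<in> E"
proof -
  have QA: "u \<in> sa" "u \<in> A0" if "u \<in> Q" for u using Q that sa_A0 by (auto simp: preord_def)
  have Q2: "u + v \<in> Q" "u \<odot> v \<in> Q" if "u \<in> Q" "v \<in> Q" for u v
    using Q that by (auto simp: preord_def)
  have Q0: "0 \<in> Q" "\<one> \<in> Q" using Q ncone_sc[of 0] ncone_sc[of 1] by (auto simp: preord_def)
  have aA: "a \<in> A0" and aa: "a \<odot> a \<in> Q" using a Q sa_A0 sq_ncone by (auto simp: preord_def)
  show QE: "Q \<subseteq> E"
  proof
    fix u assume "u \<in> Q"
    then show "u \<in> E" unfolding E_def using Q0 aA by (force intro: exI[of _ u] exI[of _ 0])
  qed
  show "a \<in> E" unfolding E_def using Q0 aA by (force intro: exI[of _ 0] exI[of _ \<one>])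
  have "x + y \<in> E \<and> x \<odot> y \<in> E" if "x \<in> E" "y \<in> E" for x y
  proof -
    obtain u v u' v' where *: "x = u + a \<odot> v" "y = u' + a \<odot> v'" and q: "u \<in> Q" "v \<in> Q" "u' \<in> Q" "v' \<in> Q"
      using \<open>x \<in> E\<close> \<open>y \<in> E\<close> unfolding E_def by blast
    note A = q[THEN QA(2)] aA
    have "x + y = (u + u') + a \<odot> (v + v')"
      unfolding * using A by (simp add: distribs)
    moreover have "x \<odot> y = (u \<odot> u' + (a \<odot> a) \<odot> (v \<odot> v')) + a \<odot> (u \<odot> v' + u' \<odot> v)"
      unfolding * using A by (simp add: distribs mul_ac)
    moreover have "u + u' \<in> Q" "v + v' \<in> Q" "u \<odot> u' + (a \<odot> a) \<odot> (v \<odot> v') \<in> Q"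
      "u \<odot> v' + u' \<odot> v \<in> Q" by (intro Q2 q aa)+
    ultimately show ?thesis unfolding E_def by blast
  qed
  moreover have "E \<subseteq> sa" unfolding E_def using QA(1) a by auto
  ultimately show "preord E" using QE Q by (auto simp: preord_def)
qed

lemma preord_maximal:
  assumes "preord Q" "sc (- 1) \<notin> Q"
  obtains M where "Q \<subseteq> M" "preord M" "sc (- 1) \<notin> M"
    "\<forall>a\<in>sa. a \<in> M \<or> - a \<in> M"
proof -
  define S where "S = {X. preord X \<and> sc (- 1) \<notin> X \<and> Q \<subseteq> X}"
  have "\<exists>M\<in>S. \<forall>X\<in>S. M \<subseteq> X \<longrightarrow> X = M"
  proof (rule subset_Zorn_nonempty)
    show "S \<noteq> {}" using assms by (auto simp: S_def)
    fix C assume C: "C \<noteq> {}" "subset.chain S C"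
    have CS: "X \<in> S" if "X \<in> C" for X using C that by (auto simp: subset.chain_def)
    have "x + y \<in> \<Union>C \<and> x \<odot> y \<in> \<Union>C" if xy: "x \<in> \<Union>C" "y \<in> \<Union>C" for x y
    proof -
      obtain X Y where XY: "X \<in> C" "Y \<in> C" "x \<in> X" "y \<in> Y" using xy by blast
      then have "X \<subseteq> Y \<or> Y \<subseteq> X" using C(2) by (auto simp: subset_chain_def)
      then obtain Z where "Z \<in> C" "x \<in> Z" "y \<in> Z" using XY by blast
      then show ?thesis using CS[of Z] unfolding S_def preord_def by blast
    qed
    moreover obtain X where "X \<in> C" using C(1) by blast
    then have "ncone \<subseteq> \<Union>C" "Q \<subseteq> \<Union>C" using CS[OF \<open>X \<in> C\<close>] unfolding S_def preord_def by blast+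
    moreover have "\<Union>C \<subseteq> sa" "sc (- 1) \<notin> \<Union>C" using CS unfolding S_def preord_def by blast+
    ultimately show "\<Union>C \<in> S" unfolding S_def preord_def by blast
  qed
  then obtain M where M: "M \<in> S" "\<And>X. X \<in> S \<Longrightarrow> M \<subseteq> X \<Longrightarrow> X = M" by blast
  then have PM: "preord M" "sc (- 1) \<notin> M" "Q \<subseteq> M" by (auto simp: S_def)
  have MA: "u \<in> A0" if "u \<in> M" for u using PM(1) that sa_A0 by (auto simp: preord_def)
  have M2: "u + v \<in> M" "u \<odot> v \<in> M" if "u \<in> M" "v \<in> M" for u v
    using PM(1) that by (auto simp: preord_def)
  show thesis
  proof
    show "\<forall>a\<in>sa. a \<in> M \<or> - a \<in> M"
    proof
      fix a assume a: "a \<in> sa"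
      have aA: "a \<in> A0" and aa: "a \<odot> a \<in> M" using a PM(1) sa_A0 sq_ncone by (auto simp: preord_def)
      show "a \<in> M \<or> - a \<in> M"
      proof (rule ccontr)
        assume no: "\<not> (a \<in> M \<or> - a \<in> M)"
        have bad: "\<exists>u\<in>M. \<exists>v\<in>M. sc (- 1) = u + b \<odot> v" if b: "b \<in> sa" "b \<notin> M" for b
        proof -
          let ?E = "{u + b \<odot> v | u v. u \<in> M \<and> v \<in> M}"
          note E = preord_extend[OF PM(1) b(1)]
          have "?E \<notin> S" using M(2)[OF _ E(2)] E(3) b(2) by blast
          then have "sc (- 1) \<in> ?E" using E PM(3) by (auto simp: S_def)
          then show ?thesis by blast
        qed
        obtain u v where uv: "u \<in> M" "v \<in> M" "- \<one> = u + a \<odot> v"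
          using bad[of a] a no by (auto simp: minus_smul)
        obtain u' v' where uv': "u' \<in> M" "v' \<in> M" "- \<one> = u' + (- a) \<odot> v'"
          using bad[of "- a"] a no by (auto simp: minus_smul)
        note A = uv(1,2)[THEN MA] uv'(1,2)[THEN MA] aA
        have 1: "a \<odot> v = - \<one> - u" unfolding uv(3) by simp
        have "- (a \<odot> v') = - \<one> - u'" unfolding uv'(3) using A by (simp add: minus_mul)
        then have 2: "a \<odot> v' = \<one> + u'" by (simp add: minus_equation_iff[of "a \<odot> v'"] add.commute)
        \<comment> \<open>The relations av = -(1 + u) and av' = 1 + u' are multiplied: the left side
          becomes a^2 vv', which lies in \<open>M\<close>, and moving the terms of the right side
          across exhibits -1 in \<open>M\<close>.\<close>
        have "(a \<odot> a) \<odot> (v \<odot> v') = (a \<odot> v) \<odot> (a \<odot> v')" using A by (simp add: mul_ac)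
        also have "\<dots> = - (\<one> + u + u' + u \<odot> u')" unfolding 1 2 using A by (simp add: distribs algebra_simps)
        finally have "sc (- 1) = (u + u' + u \<odot> u') + (a \<odot> a) \<odot> (v \<odot> v')" by (simp add: minus_smul)
        moreover have "(u + u' + u \<odot> u') + (a \<odot> a) \<odot> (v \<odot> v') \<in> M"
          by (intro M2 uv(1,2) uv'(1,2) aa)
        ultimately show False using PM(2) by simp
      qed
    qed
  qed (use PM in auto)
qed

text \<open>An Archimedean total preordering determines a character: the value at \<open>x\<close> is the cut
  of the real line defined by \<open>{r. x - r \<in> Q}\<close>.\<close>

definition near :: "'a set \<Rightarrow> 'a \<Rightarrow> real \<Rightarrow> bool" where
  "near Q x v \<longleftrightarrow> (\<forall>e>0. x - sc v + sc e \<in> Q \<and> sc v - x + sc e \<in> Q)"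

context
  fixes Q
  assumes Q: "preord Q" and proper: "sc (- 1) \<notin> Q" and total: "\<And>a. a \<in> sa \<Longrightarrow> a \<in> Q \<or> - a \<in> Q"
begin

lemma Q_A0: "u \<in> Q \<Longrightarrow> u \<in> A0"
  and Q_ncone: "u \<in> ncone \<Longrightarrow> u \<in> Q"
  and Q_add: "\<lbrakk>u \<in> Q; v \<in> Q\<rbrakk> \<Longrightarrow> u + v \<in> Q" and Q_mul: "\<lbrakk>u \<in> Q; v \<in> Q\<rbrakk> \<Longrightarrow> u \<odot> v \<in> Q"
  using Q sa_A0 by (auto simp: preord_def)

lemma Q_scale: "\<lbrakk>u \<in> Q; r \<ge> 0\<rbrakk> \<Longrightarrow> complex_of_real r \<star> u \<in> Q"
  using Q_mul[of "sc r" u] Q_ncone[OF ncone_sc, of r] Q_A0[of u] by (simp add: sc_mul)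

lemma Q_sc: "sc r \<in> Q \<longleftrightarrow> r \<ge> 0"
proof
  assume r: "sc r \<in> Q"
  show "r \<ge> 0"
  proof (rule ccontr)
    assume "\<not> r \<ge> 0"
    then have "complex_of_real (- 1 / r) \<star> sc r \<in> Q" using r by (intro Q_scale[OF r]) auto
    with \<open>\<not> r \<ge> 0\<close> proper show False by (simp add: smul_smul)
  qed
qed (simp add: Q_ncone ncone_sc)

text \<open>The value is the supremum of all r with x - r in \<open>Q\<close>. The bounds from
  \<open>ncone_bound\<close> make this set nonempty and bounded above, and totality supplies the
  inequality from the other side.\<close>

lemma near_exists: assumes x: "x \<in> sa" shows "\<exists>v. near Q x v"
proof -
  define R where "R = {r. x - sc r \<in> Q}"
  have xA: "x \<in> A0" using x sa_A0 by blast
  have down: "r \<in> R" if "s \<in> R" "r \<le> s" for r s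
  proof -
    have "x - sc s + sc (s - r) \<in> Q" using that by (intro Q_add) (auto simp: R_def Q_sc simp del: of_real_diff)
    then show ?thesis by (simp add: R_def smul_diff_left)
  qed
  have "sc (nrm x) + x \<in> Q" "sc (nrm x) - x \<in> Q"
    using Q_ncone ncone_bound[of "- x" "nrm x"] ncone_bound[of x "nrm x"] x xA by (simp_all add: nrm_minus)
  then have ne: "- nrm x \<in> R" and "sc (nrm x) - x \<in> Q" by (simp_all add: R_def minus_smul add.commute)
  have bd: "r \<le> nrm x" if "r \<in> R" for r
  proof -
    have "(x - sc r) + (sc (nrm x) - x) \<in> Q" using that \<open>sc (nrm x) - x \<in> Q\<close> by (intro Q_add) (auto simp: R_def)
    then have "sc (nrm x - r) \<in> Q" by (simp add: smul_diff_left)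
    then show ?thesis unfolding Q_sc by simp
  qed
  have bdd: "bdd_above R" using bd by (auto simp: bdd_above_def)
  show ?thesis unfolding near_def
  proof (intro exI[of _ "Sup R"] allI impI conjI)
    fix e :: real assume e: "e > 0"
    obtain s where "s \<in> R" "Sup R - e < s"
      using less_cSup_iff[OF _ bdd, of "Sup R - e"] ne e by auto
    then have "Sup R - e \<in> R" using down by (meson less_imp_le)
    then show "x - sc (Sup R) + sc e \<in> Q" by (simp add: R_def smul_diff_left algebra_simps)
    have "Sup R + e \<notin> R" using cSup_upper[OF _ bdd, of "Sup R + e"] e by auto
    then have "- (x - sc (Sup R + e)) \<in> Q" using total[of "x - sc (Sup R + e)"] x by (auto simp: R_def simp del: of_real_add)
    then show "sc (Sup R) - x + sc e \<in> Q" by (simp add: smul_add_left algebra_simps)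
  qed
qed

lemma near_le: assumes "near Q x v" "y - x \<in> Q" "near Q y w" shows "v \<le> w"
proof (rule field_le_epsilon)
  fix e :: real assume "e > 0"
  then have "(x - sc v + sc (e/2)) + (y - x) + (sc w - y + sc (e/2)) \<in> Q"
    using assms half_gt_zero[OF \<open>e > 0\<close>] by (meson Q_add near_def)
  moreover have "(x - sc v + sc (e/2)) + (y - x) + (sc w - y + sc (e/2)) = sc (w + e - v)"
    using sc_add[of "e/2" "e/2"] by (simp add: smul_diff_left smul_add_left algebra_simps)
  ultimately show "v \<le> w + e" using Q_sc[of "w + e - v"] by simp
qed

lemma near_unique: "\<lbrakk>near Q x v; near Q x w\<rbrakk> \<Longrightarrow> v = w"
  using near_le[of x v x w] near_le[of x w x v] Q_sc[of 0] by simp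

lemma near_add: assumes "near Q x v" "near Q y w" shows "near Q (x + y) (v + w)"
  unfolding near_def
proof (intro allI impI)
  fix e :: real assume e: "e > 0"
  have "(x - sc v + sc (e/2)) + (y - sc w + sc (e/2)) \<in> Q"
    "(sc v - x + sc (e/2)) + (sc w - y + sc (e/2)) \<in> Q"
    using assms half_gt_zero[OF e] Q_add unfolding near_def by blast+
  moreover have "sc e = sc (e/2) + sc (e/2)" using sc_add[of "e/2" "e/2"] by simp
  ultimately show "(x + y) - sc (v + w) + sc e \<in> Q \<and> sc (v + w) - (x + y) + sc e \<in> Q"
    by (simp add: smul_add_left algebra_simps)
qed

lemma near_sc: "near Q (sc r) r"
  by (auto simp: near_def Q_sc)

lemma near_scale: assumes "near Q x v" "x \<in> A0" shows "near Q (complex_of_real r \<star> x) (r * v)"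
proof -
  have *: "near Q (complex_of_real r \<star> x) (r * v)" if r: "r > 0" for r
    unfolding near_def
  proof (intro allI impI conjI)
    fix e :: real assume e: "e > 0"
    have "complex_of_real r \<star> (x - sc v + sc (e/r)) \<in> Q" "complex_of_real r \<star> (sc v - x + sc (e/r)) \<in> Q"
      using assms e r by (intro Q_scale; auto simp: near_def simp del: of_real_divide)+
    moreover have "complex_of_real r \<star> sc (e/r) = sc e" using r by (simp add: smul_smul)
    ultimately show "complex_of_real r \<star> x - sc (r * v) + sc e \<in> Q"
      "sc (r * v) - complex_of_real r \<star> x + sc e \<in> Q"
      by (simp_all add: smul_diff smul_add smul_smul)
  qed
  have neg: "near Q (- y) (- w)" if "near Q y w" for y w
    using that by (auto simp: near_def minus_smul add.commute)
  consider "r > 0" | "r = 0" | "- r > 0" by linarith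
  then show ?thesis
  proof cases
    case 3
    with neg[OF *[OF 3]] show ?thesis by (simp add: minus_smul)
  qed (use * near_sc[of 0] in auto)
qed

text \<open>With d^2 = e, the elements e + xy and e - xy are half sums of products of the four
  elements d + x, d - x, d + y, d - y of \<open>Q\<close>.\<close>

lemma near_zero_mul: assumes "near Q x 0" "near Q y 0" "x \<in> A0" "y \<in> A0" shows "near Q (x \<odot> y) 0"
  unfolding near_def
proof (intro allI impI)
  fix e :: real assume e: "e > 0"
  define d where "d = sqrt e"
  have d: "d > 0" "d * d = e" using e by (auto simp: d_def)
  have p: "x + sc d \<in> Q" "sc d - x \<in> Q" "y + sc d \<in> Q" "sc d - y \<in> Q"
    using assms d by (auto simp: near_def)
  have "(x + sc d) \<odot> (y + sc d) + (sc d - x) \<odot> (sc d - y) \<in> Q"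
    "(x + sc d) \<odot> (sc d - y) + (sc d - x) \<odot> (y + sc d) \<in> Q"
    using p by (auto intro!: Q_add Q_mul)
  moreover have "complex_of_real d * complex_of_real d = complex_of_real e"
    using d by (metis of_real_mult)
  then have "(x + sc d) \<odot> (y + sc d) + (sc d - x) \<odot> (sc d - y) = complex_of_real 2 \<star> (x \<odot> y + sc e)"
    "(x + sc d) \<odot> (sc d - y) + (sc d - x) \<odot> (y + sc d) = complex_of_real 2 \<star> (sc e - x \<odot> y)"
    using assms(3,4) smul_add_left[of "complex_of_real e" "complex_of_real e" \<one>]
    by (simp_all add: distribs smul_two)
  ultimately have "complex_of_real (1/2) \<star> complex_of_real 2 \<star> (x \<odot> y + sc e) \<in> Q"
    "complex_of_real (1/2) \<star> complex_of_real 2 \<star> (sc e - x \<odot> y) \<in> Q"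
    by (auto intro!: Q_scale simp del: of_real_divide)
  then show "x \<odot> y - sc 0 + sc e \<in> Q \<and> sc 0 - x \<odot> y + sc e \<in> Q"
    by (simp add: smul_smul)
qed

lemma near_mul: assumes "near Q x v" "near Q y w" "x \<in> A0" "y \<in> A0" shows "near Q (x \<odot> y) (v * w)"
proof -
  \<comment> \<open>Centering reduces to \<open>near_zero_mul\<close>, by xy = (x - v)(y - w) + wx +
    vy - vw.\<close>
  let ?x = "x + sc (- v)" let ?y = "y + sc (- w)"
  have 0: "near Q ?x 0" "near Q ?y 0"
    using near_add[OF assms(1) near_sc[of "- v"]] near_add[OF assms(2) near_sc[of "- w"]] by simp_all
  have "near Q (?x \<odot> ?y) 0" by (rule near_zero_mul) (use 0 assms in auto)
  from near_add[OF near_add[OF this near_scale[OF assms(1), of w]] near_scale[OF assms(2), of v]]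
  have "near Q (?x \<odot> ?y + complex_of_real w \<star> x + complex_of_real v \<star> y + sc (- (v * w))) (v * w)"
    using near_add[OF _ near_sc[of "- (v * w)"]] assms by fastforce
  also have "?x \<odot> ?y + complex_of_real w \<star> x + complex_of_real v \<star> y + sc (- (v * w)) = x \<odot> y"
    using assms by (simp add: distribs algebra_simps)
  finally show ?thesis .
qed

definition cut :: "'a \<Rightarrow> real" where "cut x = (THE v. near Q x v)"

lemma near_cut: "x \<in> sa \<Longrightarrow> near Q x (cut x)"
  unfolding cut_def using near_exists near_unique by (metis theI)

lemma cut_eq: "near Q x v \<Longrightarrow> cut x = v"
  unfolding cut_def using near_unique by (blast intro: the_equality)

lemma cut_ge: assumes "x - sc r \<in> Q" "x \<in> sa" shows "r \<le> cut x"
  using near_le[OF near_sc assms(1) near_cut[OF assms(2)]] .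

end

section \<open>Real and imaginary parts\<close>

definition re :: "'a \<Rightarrow> 'a" where "re x = (1/2) \<star> (x + invl x)"
definition im :: "'a \<Rightarrow> 'a" where "im x = (- \<i>/2) \<star> (x - invl x)"

lemma re_sa [simp]: "x \<in> A0 \<Longrightarrow> re x \<in> sa" and im_sa [simp]: "x \<in> A0 \<Longrightarrow> im x \<in> sa"
  by (auto simp: re_def im_def sa_def invl_add invl_diff invl_smul smul_diff smul_add minus_smul add.commute)

lemma re_im: "x \<in> A0 \<Longrightarrow> x = re x + \<i> \<star> im x"
  by (simp add: re_def im_def distribs flip: smul_add_left)

lemma re_im_unique: "\<lbrakk>h \<in> sa; k \<in> sa\<rbrakk> \<Longrightarrow> re (h + \<i> \<star> k) = h \<and> im (h + \<i> \<star> k) = k"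
  by (simp add: re_def im_def sa_A0 sa_invl invl_add invl_smul distribs flip: smul_add_left)

subsection \<open>Gelfand theory\<close>

abbreviation W :: "('a \<Rightarrow> complex) set" where "W \<equiv> gelfand smul A0 mul"

lemma W_add: "\<lbrakk>\<phi> \<in> W; x \<in> A0; y \<in> A0\<rbrakk> \<Longrightarrow> \<phi> (x + y) = \<phi> x + \<phi> y"
  and W_smul: "\<lbrakk>\<phi> \<in> W; x \<in> A0\<rbrakk> \<Longrightarrow> \<phi> (c \<star> x) = c * \<phi> x"
  and W_mul: "\<lbrakk>\<phi> \<in> W; x \<in> A0; y \<in> A0\<rbrakk> \<Longrightarrow> \<phi> (x \<odot> y) = \<phi> x * \<phi> y"
  by (auto simp: gelfand_def)

lemma W_minus: "\<lbrakk>\<phi> \<in> W; x \<in> A0\<rbrakk> \<Longrightarrow> \<phi> (- x) = - \<phi> x"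
  using W_smul[of \<phi> x "-1"] by (simp add: minus_smul)

lemma W_diff: "\<lbrakk>\<phi> \<in> W; x \<in> A0; y \<in> A0\<rbrakk> \<Longrightarrow> \<phi> (x - y) = \<phi> x - \<phi> y"
  using W_add[of \<phi> x "- y"] by (simp add: W_minus)

lemma W_zero: "\<phi> \<in> W \<Longrightarrow> \<phi> 0 = 0"
  using W_smul[of \<phi> 0 0] by simp

lemma W_one: assumes "\<phi> \<in> W" shows "\<phi> \<one> = 1"
proof -
  obtain x where "x \<in> A0" "\<phi> x \<noteq> 0" using assms by (auto simp: gelfand_def)
  then show ?thesis using W_mul[OF assms, of \<one> x] by simp
qed

text \<open>Otherwise y = x / \<phi>(x) has norm below 1 and z = y + yz has a solution, the Neumann
  series y + y^2 + ..., of norm at most c / (1 - c) with c = \<open>nrm y\<close>. Applying \<phi>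
  gives \<phi>(z) = 1 + \<phi>(z).\<close>

lemma W_bound: assumes W: "\<phi> \<in> W" and x: "x \<in> A0" shows "cmod (\<phi> x) \<le> nrm x"
proof (rule ccontr)
  assume less: "\<not> cmod (\<phi> x) \<le> nrm x"
  then have pos: "0 < cmod (\<phi> x)" using nrm_nonneg[OF x] by linarith
  define y where "y = (1 / \<phi> x) \<star> x"
  let ?c = "nrm y"
  have y: "y \<in> A0" "\<phi> y = 1" and c: "?c < 1"
    using x pos less W by (auto simp: y_def W_smul nrm_smul norm_divide)
  have c0: "0 \<le> ?c" using y by simp
  have "\<exists>z\<in>A0. nrm z \<le> ?c / (1 - ?c) \<and> y + y \<odot> z = z"
  proof (rule contraction_fixpoint[OF _ c])
    show "0 \<le> ?c / (1 - ?c)" using c c0 by simp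
    fix z assume z: "z \<in> A0" "nrm z \<le> ?c / (1 - ?c)"
    have "nrm (y + y \<odot> z) \<le> ?c + ?c * nrm z"
      using nrm_add[of y "y \<odot> z"] nrm_mul[of y z] y z by simp
    also have "\<dots> \<le> ?c + ?c * (?c / (1 - ?c))"
      using z c0 by (intro add_left_mono mult_left_mono)
    also have "\<dots> = ?c / (1 - ?c)" using c by (simp add: field_simps)
    finally show "y + y \<odot> z \<in> A0 \<and> nrm (y + y \<odot> z) \<le> ?c / (1 - ?c)" using y z by simp
  next
    fix z w assume "z \<in> A0" "w \<in> A0"
    then show "nrm (y + y \<odot> z - (y + y \<odot> w)) \<le> ?c * nrm (z - w)"
      using nrm_mul[of y "z - w"] y by (simp add: mul_diff)
  qed
  then obtain z where z: "z \<in> A0" "y + y \<odot> z = z" by blast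
  then have "\<phi> z = 1 + \<phi> z" using W_add[OF W y(1), of "y \<odot> z"] W_mul[OF W y(1) z(1)] y by simp
  then show False by simp
qed

text \<open>The squared modulus of \<phi>(h + it) is at most \<open>nrm (h \<odot> h)\<close> + t^2
  for every real t, but contains the linear term 2t Im \<phi>(h); \<open>t\<close> is chosen so that
  this term alone equals \<open>nrm (h \<odot> h)\<close> + 1.\<close>

lemma W_sa: assumes W: "\<phi> \<in> W" and h: "h \<in> sa" shows "Im (\<phi> h) = 0"
proof (rule ccontr)
  assume b: "Im (\<phi> h) \<noteq> 0"
  have A: "h \<in> A0" using h sa_A0 by blast
  define t where "t = (nrm (h \<odot> h) + 1) / (2 * Im (\<phi> h))"
  let ?u = "h + (\<i> * complex_of_real t) \<star> \<one>"
  have "invl ?u \<odot> ?u = h \<odot> h + sc (t * t)"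
    using A h by (simp add: invl_add invl_smul sa_invl distribs mult.assoc mult.left_commute)
  then have "(nrm ?u)\<^sup>2 \<le> nrm (h \<odot> h) + t\<^sup>2"
    using nrm_cstar[of ?u] nrm_add[of "h \<odot> h" "sc (t * t)"] nrm_sc[of "t * t"] A by (simp add: power2_eq_square)
  moreover have "(cmod (\<phi> ?u))\<^sup>2 \<le> (nrm ?u)\<^sup>2" using W_bound[OF W, of ?u] A by (intro power_mono) auto
  moreover have "\<phi> ?u = \<phi> h + \<i> * complex_of_real t" using W A by (simp add: W_add W_smul W_one)
  then have "(cmod (\<phi> ?u))\<^sup>2 = (Re (\<phi> h))\<^sup>2 + (Im (\<phi> h) + t)\<^sup>2" by (simp add: cmod_power2)
  moreover have "2 * Im (\<phi> h) * t = nrm (h \<odot> h) + 1" using b by (simp add: t_def)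
  ultimately have "(Re (\<phi> h))\<^sup>2 + (Im (\<phi> h))\<^sup>2 + 1 \<le> 0" by (simp add: power2_sum algebra_simps)
  then show False using zero_le_power2[of "Re (\<phi> h)"] zero_le_power2[of "Im (\<phi> h)"] by linarith
qed

lemma W_invl: assumes W: "\<phi> \<in> W" and x: "x \<in> A0" shows "\<phi> (invl x) = cnj (\<phi> x)"
proof -
  have A: "re x \<in> A0" "im x \<in> A0" and sa: "re x \<in> sa" "im x \<in> sa" using x sa_A0 by auto
  have "invl x = re x - \<i> \<star> im x"
    by (subst re_im[OF x]) (use A sa in \<open>simp add: invl_add invl_smul sa_invl minus_smul\<close>)
  then have "\<phi> (invl x) = \<phi> (re x) - \<i> * \<phi> (im x)" using A W by (simp add: W_diff W_smul)
  moreover have "\<phi> x = \<phi> (re x) + \<i> * \<phi> (im x)"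
    by (subst re_im[OF x]) (use A W in \<open>simp add: W_add W_smul\<close>)
  ultimately show ?thesis using W_sa[OF W sa(1)] W_sa[OF W sa(2)] by (simp add: complex_eq_iff)
qed

lemma re_add: "\<lbrakk>x \<in> A0; y \<in> A0\<rbrakk> \<Longrightarrow> re (x + y) = re x + re y"
  and im_add: "\<lbrakk>x \<in> A0; y \<in> A0\<rbrakk> \<Longrightarrow> im (x + y) = im x + im y"
  by (simp_all add: re_def im_def invl_add distribs algebra_simps)

lemma re_im_smul:
  assumes "x \<in> A0"
  shows "re (c \<star> x) = complex_of_real (Re c) \<star> re x + complex_of_real (- Im c) \<star> im x"
    and "im (c \<star> x) = complex_of_real (Re c) \<star> im x + complex_of_real (Im c) \<star> re x"
proof -
  have "c \<star> x = (complex_of_real (Re c) + \<i> * complex_of_real (Im c)) \<star> (re x + \<i> \<star> im x)"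
    using re_im[OF assms] by (simp flip: complex_eq)
  also have "\<dots> = (complex_of_real (Re c) \<star> re x + complex_of_real (- Im c) \<star> im x)
      + \<i> \<star> (complex_of_real (Re c) \<star> im x + complex_of_real (Im c) \<star> re x)"
    by (simp add: distribs distrib_left mult.commute mult.left_commute)
  finally have e: "c \<star> x = \<dots>" .
  show "re (c \<star> x) = complex_of_real (Re c) \<star> re x + complex_of_real (- Im c) \<star> im x"
    "im (c \<star> x) = complex_of_real (Re c) \<star> im x + complex_of_real (Im c) \<star> re x"
    unfolding e using assms by (auto intro!: re_im_unique[THEN conjunct1] re_im_unique[THEN conjunct2] simp del: of_real_minus)
qed

lemma re_im_mul:
  assumes "x \<in> A0" "y \<in> A0"
  shows "re (x \<odot> y) = re x \<odot> re y + complex_of_real (- 1) \<star> (im x \<odot> im y)"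
    and "im (x \<odot> y) = re x \<odot> im y + im x \<odot> re y"
proof -
  have A: "re x \<in> A0" "im x \<in> A0" "re y \<in> A0" "im y \<in> A0" using assms sa_A0 by auto
  have "x \<odot> y = (re x + \<i> \<star> im x) \<odot> (re y + \<i> \<star> im y)"
    using re_im[OF assms(1)] re_im[OF assms(2)] by simp
  also have "\<dots> = (re x \<odot> re y + complex_of_real (- 1) \<star> (im x \<odot> im y)) + \<i> \<star> (re x \<odot> im y + im x \<odot> re y)"
    using A by (simp add: distribs)
  finally have e: "x \<odot> y = \<dots>" .
  show "re (x \<odot> y) = re x \<odot> re y + complex_of_real (- 1) \<star> (im x \<odot> im y)"
    "im (x \<odot> y) = re x \<odot> im y + im x \<odot> re y"
    unfolding e using assms by (auto intro!: re_im_unique[THEN conjunct1] re_im_unique[THEN conjunct2] simp del: of_real_minus)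
qed

text \<open>The order conclusion is the purpose: putting h - r into the preordering forces the
  character to be at least r at h.\<close>

lemma preord_character:
  assumes Q: "preord Q" and proper: "sc (- 1) \<notin> Q" and total: "\<And>a. a \<in> sa \<Longrightarrow> a \<in> Q \<or> - a \<in> Q"
  obtains \<phi> where "\<phi> \<in> W" "\<And>h r. \<lbrakk>h \<in> sa; h - sc r \<in> Q\<rbrakk> \<Longrightarrow> r \<le> Re (\<phi> h)"
proof
  note cut = near_cut[OF Q proper total] and cut_eqI = cut_eq[OF Q proper total]
  define \<phi> where "\<phi> x = (if x \<in> A0 then Complex (cut Q (re x)) (cut Q (im x)) else 0)" for x
  have eqI: "\<phi> x = c" if "x \<in> A0" "near Q (re x) (Re c)" "near Q (im x) (Im c)" for x c
    using that cut_eqI by (simp add: \<phi>_def complex_eq_iff)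
  have nr: "near Q (re x) (Re (\<phi> x))" "near Q (im x) (Im (\<phi> x))" if "x \<in> A0" for x
    using that cut by (simp_all add: \<phi>_def)
  have RA: "re x \<in> A0" "im x \<in> A0" if "x \<in> A0" for x using that sa_A0 by auto
  have h0: "re h = h" "im h = 0" if "h \<in> sa" for h using re_im_unique[OF that, of 0] by simp_all
  have "\<phi> \<one> = 1" by (rule eqI) (use near_sc[OF Q proper total, of 1] near_sc[OF Q proper total, of 0] in \<open>simp_all add: h0\<close>)
  moreover have "\<phi> (x + y) = \<phi> x + \<phi> y" if "x \<in> A0" "y \<in> A0" for x y
    by (rule eqI) (use that nr near_add[OF Q proper total] in \<open>simp_all add: re_add im_add\<close>)
  moreover have "\<phi> (c \<star> x) = c * \<phi> x" if x: "x \<in> A0" for c x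
  proof (rule eqI)
    note s = near_scale[OF Q proper total nr(1)[OF x] RA(1)[OF x]] near_scale[OF Q proper total nr(2)[OF x] RA(2)[OF x]]
    show "near Q (re (c \<star> x)) (Re (c * \<phi> x))"
      using near_add[OF Q proper total s(1)[of "Re c"] s(2)[of "- Im c"]] unfolding re_im_smul[OF x] by simp
    show "near Q (im (c \<star> x)) (Im (c * \<phi> x))"
      using near_add[OF Q proper total s(2)[of "Re c"] s(1)[of "Im c"]] unfolding re_im_smul[OF x] by simp
  qed (use x in simp)
  moreover have "\<phi> (x \<odot> y) = \<phi> x * \<phi> y" if x: "x \<in> A0" "y \<in> A0" for x y
  proof (rule eqI)
    note n = nr[OF x(1)] nr[OF x(2)] and A = RA[OF x(1)] RA[OF x(2)]
    have m: "near Q (u \<odot> v) (a * b)" if "near Q u a" "near Q v b" "u \<in> A0" "v \<in> A0" for u v a b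
      using near_mul[OF Q proper total that] .
    show "near Q (re (x \<odot> y)) (Re (\<phi> x * \<phi> y))"
      using near_add[OF Q proper total m[OF n(1,3) A(1,3)] near_scale[OF Q proper total m[OF n(2,4) A(2,4)], of "-1"]] A
      unfolding re_im_mul[OF x] by simp
    show "near Q (im (x \<odot> y)) (Im (\<phi> x * \<phi> y))"
      using near_add[OF Q proper total m[OF n(1,4) A(1,4)] m[OF n(2,3) A(2,3)]]
      unfolding re_im_mul[OF x] by simp
  qed (use x in simp)
  moreover have "\<phi> a = 0" if "a \<notin> A0" for a using that by (simp add: \<phi>_def)
  ultimately show "\<phi> \<in> W" unfolding gelfand_def by (auto intro!: bexI[of _ \<one>])
  fix h r assume h: "h \<in> sa" "h - sc r \<in> Q"
  then show "r \<le> Re (\<phi> h)"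
    using cut_ge[OF Q proper total h(2,1)] by (simp add: \<phi>_def h0 sa_A0)
qed

text \<open>A character with value at least M = \<open>nrm (h \<odot> h)\<close> at h^2 is produced
  by forcing g = h^2 - M into a preordering; \<open>W_bound\<close> gives the reverse inequality.
  For x = 0 this still yields a character.\<close>

lemma exists_character:
  assumes x: "x \<in> A0"
  shows "\<exists>\<phi>\<in>W. cmod (\<phi> x) = nrm x"
proof -
  \<comment> \<open>\<open>ncone_sq_nrm\<close> controls squares of self-adjoint elements, so the
    fourth power of \<open>nrm x\<close> is attained first and the root is taken at the end.\<close>
  define h where "h = invl x \<odot> x"
  have h: "h \<in> sa" "h \<in> A0" using x by (auto simp: h_def sa_def invl_mul mul_comm)
  define M where "M = nrm (h \<odot> h)"
  have M: "M = (nrm h)\<^sup>2" "M \<ge> 0" using nrm_cstar[OF h(2)] h by (simp_all add: M_def sa_invl)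
  define g where "g = h \<odot> h - sc M"
  have g: "g \<in> sa" "g \<in> A0" using h by (auto simp: g_def)
  let ?E = "{u + g \<odot> v | u v. u \<in> ncone \<and> v \<in> ncone}"
  have "sc (- 1) \<notin> ?E"
  proof
    assume "sc (- 1) \<in> ?E"
    then obtain u v where uv: "u \<in> ncone" "v \<in> ncone" "- \<one> = u + g \<odot> v" by (auto simp: minus_smul)
    then have A: "u \<in> A0" "v \<in> A0" and S: "v \<in> sa" using ncone_sa sa_A0 by auto
    show False
    proof (cases "M = 0")
      case True
      then have "g = 0" using h by (simp add: g_def M_def nrm_eq_0)
      then show False using uv A ncone_neg[of "-1"] by (simp add: minus_smul)
    next
      case False
      with M have M0: "M > 0" by simp
      \<comment> \<open>If -1 = u + gv, then (N - v)(M - h^2) + u = -Ng - 1 lies in the cone once N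
        >= \<open>nrm v\<close>. Division by N bounds \<open>nrm (h \<odot> h)\<close> by M - 1/N <
        M. The second entry of the maximum makes M - 1/N nonnegative, as \<open>ncone_sq_nrm\<close>
        requires.\<close>
      define N where "N = max (nrm v) (1 / M)"
      have N1: "1 / M \<le> N" and N2: "nrm v \<le> N" by (auto simp: N_def)
      then have "N > 0" using M0 by (meson divide_pos_pos less_le_trans zero_less_one)
      with N1 N2 M0 have N: "N > 0" "nrm v \<le> N" "1 / N \<le> M" by (auto simp: field_simps)
      have "(sc N - v) \<odot> (sc M - h \<odot> h) \<in> ncone"
        using N S h by (intro ncone_mul ncone_bound) (auto simp: M_def)
      from ncone_add[OF this uv(1)]
      have 1: "(sc N - v) \<odot> (- g) + u \<in> ncone" by (simp add: g_def)
      have "v \<odot> g = - \<one> - u" unfolding uv(3) using A g by (simp add: mul_comm)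
      then have "(sc N - v) \<odot> (- g) + u = complex_of_real N \<star> (- g) - \<one>"
        using A g by (simp add: distribs algebra_simps)
      with ncone_scale[OF 1, of "1/N"] N
      have 2: "complex_of_real (1/N) \<star> (complex_of_real N \<star> (- g) - \<one>) \<in> ncone" by simp
      have "complex_of_real (1/N) \<star> (complex_of_real N \<star> (- g) - \<one>) = - g - sc (1/N)"
        using N(1) by (simp add: smul_diff smul_smul)
      also have "\<dots> = sc (M - 1/N) - h \<odot> h" by (simp add: g_def smul_diff_left)
      finally have "sc (M - 1/N) - h \<odot> h \<in> ncone" using 2 by simp
      from ncone_sq_nrm[OF h(1) _ this] N M0 show False by (simp add: M_def)
    qed
  qed
  note E = preord_extend[OF preord_ncone g(1)]
  obtain Q where Q: "?E \<subseteq> Q" "preord Q" "sc (- 1) \<notin> Q" "\<forall>a\<in>sa. a \<in> Q \<or> - a \<in> Q"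
    by (rule preord_maximal[OF E(1) \<open>sc (- 1) \<notin> ?E\<close>])
  obtain \<phi> where \<phi>: "\<phi> \<in> W" "\<And>h r. \<lbrakk>h \<in> sa; h - sc r \<in> Q\<rbrakk> \<Longrightarrow> r \<le> Re (\<phi> h)"
    using preord_character[OF Q(2,3)] Q(4) by blast
  have "M \<le> Re (\<phi> (h \<odot> h))" using \<phi>(2)[of "h \<odot> h" M] h E(3) Q(1) by (auto simp: g_def)
  also have "\<dots> \<le> cmod (\<phi> (h \<odot> h))" by (rule complex_Re_le_cmod)
  also have "\<dots> = ((cmod (\<phi> x))\<^sup>2)\<^sup>2"
    using \<phi>(1) h x by (simp add: W_mul h_def W_invl norm_mult power2_eq_square)
  also have "M = ((nrm x)\<^sup>2)\<^sup>2" using nrm_cstar[OF x] by (simp add: M h_def)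
  finally have "nrm x \<le> cmod (\<phi> x)" using x by (simp add: power_mono_iff)
  with W_bound[OF \<phi>(1) x] \<phi>(1) show ?thesis by (intro bexI[of _ \<phi>]) auto
qed

lemma W_eqI: assumes "x \<in> A0" "y \<in> A0" "\<And>\<phi>. \<phi> \<in> W \<Longrightarrow> \<phi> x = \<phi> y" shows "x = y"
proof -
  obtain \<phi> where "\<phi> \<in> W" "cmod (\<phi> (x - y)) = nrm (x - y)"
    using exists_character[of "x - y"] assms by auto
  moreover from this have "\<phi> x = \<phi> y" using assms(3) by blast
  ultimately show ?thesis using assms(1,2) nrm_eq_0[of "x - y"] by (auto simp: W_diff)
qed

section \<open>Compactness of the Gelfand space and surjectivity onto its continuous
  functions\<close>

lemma continuous_on_eval: "continuous_on S (\<lambda>\<phi>::'a \<Rightarrow> complex. \<phi> x)"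
  by (rule continuous_on_subset[OF continuous_on_product_coordinates]) simp

lemma compact_W: "compact W"
proof -
  \<comment> \<open>Being nonzero is not a closed condition on functionals; the equivalent condition
    \<phi>(1) = 1 is.\<close>
  have eq: "W = {\<phi>. (\<forall>x\<in>A0. \<forall>y\<in>A0. \<phi> (x + y) = \<phi> x + \<phi> y) \<and> (\<forall>c. \<forall>x\<in>A0. \<phi> (c \<star> x) = c * \<phi> x)
       \<and> (\<forall>x\<in>A0. \<forall>y\<in>A0. \<phi> (x \<odot> y) = \<phi> x * \<phi> y) \<and> \<phi> \<one> = 1 \<and> (\<forall>a. a \<notin> A0 \<longrightarrow> \<phi> a = 0)}" (is "_ = ?R")
  proof
    show "W \<subseteq> ?R" using W_one by (auto simp: gelfand_def)
    show "?R \<subseteq> W" by (auto simp: gelfand_def intro!: bexI[of _ \<one>])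
  qed
  have "closed W" unfolding eq Ball_def
    by (intro closed_Collect_conj closed_Collect_all closed_Collect_imp closed_Collect_eq
        continuous_intros continuous_on_eval open_Collect_const)
  \<comment> \<open>A product of discs, compact by Tychonoff; radius 0 off \<open>A0\<close> matches
    the convention that characters vanish there.\<close>
  moreover define B where "B = (\<Pi>\<^sub>E a\<in>UNIV. cball (0::complex) (if a \<in> A0 then nrm a else 0))"
  have "compactin (product_topology (\<lambda>i::'a. euclidean) UNIV) B"
    unfolding B_def compactin_PiE by auto
  then have "compact B" by (simp add: euclidean_product_topology)
  moreover have "W \<subseteq> B"
  proof
    fix \<phi> assume "\<phi> \<in> W"
    then have "\<phi> a = 0" if "a \<notin> A0" for a using that by (auto simp: gelfand_def)
    then show "\<phi> \<in> B" using W_bound[OF \<open>\<phi> \<in> W\<close>] by (auto simp: B_def)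
  qed
  ultimately show ?thesis using compact_Int_closed[of B W] by (simp add: Int_absorb1)
qed

text \<open>Transforms are uniformly dense by Stone-Weierstrass, and their range is closed because
  the transform is isometric and \<open>A0\<close> is complete.\<close>

lemma W_surj:
  assumes g: "continuous_on W g"
  shows "\<exists>x\<in>A0. \<forall>\<phi>\<in>W. \<phi> x = g \<phi>"
proof -
  define R where "R = {f. \<exists>x\<in>A0. \<forall>\<phi>\<in>W. \<phi> x = complex_of_real (f \<phi>)}"
  interpret function_ring_on "{f\<in>R. continuous_on W f}" W
  proof
    show "compact W" by (rule compact_W)
    fix f h assume "f \<in> {f\<in>R. continuous_on W f}" "h \<in> {f\<in>R. continuous_on W f}"
    then obtain x y where "x \<in> A0" "y \<in> A0" "\<forall>\<phi>\<in>W. \<phi> x = complex_of_real (f \<phi>)"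
      "\<forall>\<phi>\<in>W. \<phi> y = complex_of_real (h \<phi>)" "continuous_on W f" "continuous_on W h" by (auto simp: R_def)
    then show "(\<lambda>x. f x + h x) \<in> {f\<in>R. continuous_on W f}" "(\<lambda>x. f x * h x) \<in> {f\<in>R. continuous_on W f}"
      unfolding R_def mem_Collect_eq
      by (intro conjI continuous_intros bexI[of _ "x + y"] bexI[of _ "x \<odot> y"]; simp add: W_add W_mul)+
  next
    fix c :: real
    show "(\<lambda>_. c) \<in> {f\<in>R. continuous_on W f}"
      by (auto simp: R_def W_smul W_one intro!: bexI[of _ "sc c"])
  next
    fix \<phi> \<psi> assume W: "\<phi> \<in> W" "\<psi> \<in> W" "\<phi> \<noteq> \<psi>"
    then obtain x where x: "\<phi> x \<noteq> \<psi> x" by blast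
    then have xA: "x \<in> A0" using W by (auto simp: gelfand_def)
    have A: "re x \<in> A0" "im x \<in> A0" and s: "re x \<in> sa" "im x \<in> sa" using xA sa_A0 by auto
    have dec: "\<theta> x = \<theta> (re x) + \<i> * \<theta> (im x)" if "\<theta> \<in> W" for \<theta>
      by (subst re_im[OF xA]) (use A that in \<open>simp add: W_add W_smul\<close>)
    \<comment> \<open>The ring consists of real functions, so the separating element must be
      self-adjoint: the real or the imaginary part of \<open>x\<close> separates.\<close>
    then obtain h where h: "h \<in> sa" "\<phi> h \<noteq> \<psi> h" using x W s by metis
    then have hA: "h \<in> A0" using sa_A0 by blast
    have r: "\<theta> h = complex_of_real (Re (\<theta> h))" if "\<theta> \<in> W" for \<theta>
      using W_sa[OF that h(1)] by (simp add: complex_eq_iff)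
    show "\<exists>f\<in>{f\<in>R. continuous_on W f}. f \<phi> \<noteq> f \<psi>"
    proof (intro bexI[of _ "\<lambda>\<theta>. Re (\<theta> h)"] CollectI conjI)
      show "Re (\<phi> h) \<noteq> Re (\<psi> h)" using h(2) r W by metis
      show "(\<lambda>\<theta>. Re (\<theta> h)) \<in> R" using r hA by (auto simp: R_def)
    qed (intro continuous_intros continuous_on_eval)
  qed auto
  have real: "\<exists>x\<in>A0. \<forall>\<phi>\<in>W. \<phi> x = complex_of_real (f \<phi>)" if f: "continuous_on W f" for f
  proof -
    have "\<exists>x\<in>A0. \<forall>\<phi>\<in>W. cmod (complex_of_real (f \<phi>) - \<phi> x) < 1 / (1 + real n)" for n
    proof -
      have "\<exists>h\<in>{f\<in>R. continuous_on W f}. \<forall>x\<in>W. \<bar>f x - h x\<bar> < 1 / (1 + real n)"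
        by (rule Stone_Weierstrass_basic[OF f]) simp
      then obtain h x where h: "\<forall>\<phi>\<in>W. \<bar>f \<phi> - h \<phi>\<bar> < 1 / (1 + real n)"
        and x: "x \<in> A0" "\<forall>\<phi>\<in>W. \<phi> x = complex_of_real (h \<phi>)"
        unfolding R_def by blast
      have "cmod (complex_of_real (f \<phi>) - \<phi> x) = \<bar>f \<phi> - h \<phi>\<bar>" if "\<phi> \<in> W" for \<phi>
        using x that norm_of_real[of "f \<phi> - h \<phi>", where 'a=complex] by simp
      with h show ?thesis by (intro bexI[OF _ x(1)]) simp
    qed
    then obtain X where X: "\<And>n. X n \<in> A0" "\<And>n \<phi>. \<phi> \<in> W \<Longrightarrow> cmod (complex_of_real (f \<phi>) - \<phi> (X n)) < 1 / (1 + real n)"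
      by metis
    have "\<exists>x\<in>A0. \<forall>e>0. \<exists>N. \<forall>n\<ge>N. nrm (X n - x) < e"
    proof (rule nrm_complete[OF X(1)])
      fix e :: real assume e: "e > 0"
      obtain N where N: "1 / (1 + real N) < e / 2"
        using e reals_Archimedean[of "e/2"] by (auto simp: inverse_eq_divide)
      show "\<exists>N. \<forall>m\<ge>N. \<forall>n\<ge>N. nrm (X m - X n) < e"
      proof (intro exI[of _ N] allI impI)
        fix m n assume mn: "m \<ge> N" "n \<ge> N"
        \<comment> \<open>A character attaining the norm of the difference turns the uniform
          estimates into a norm Cauchy condition.\<close>
        obtain \<phi> where \<phi>: "\<phi> \<in> W" "cmod (\<phi> (X m - X n)) = nrm (X m - X n)"
          using exists_character[of "X m - X n"] X(1) by auto
        have *: "1 / (1 + real k) \<le> 1 / (1 + real N)" if "k \<ge> N" for k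
          using that by (intro divide_left_mono) auto
        have "cmod (\<phi> (X m) - \<phi> (X n)) \<le> cmod (complex_of_real (f \<phi>) - \<phi> (X m)) + cmod (complex_of_real (f \<phi>) - \<phi> (X n))"
          using norm_triangle_ineq4[of "complex_of_real (f \<phi>) - \<phi> (X n)" "complex_of_real (f \<phi>) - \<phi> (X m)"] by simp
        also have "\<dots> < e" using X(2)[OF \<phi>(1), of m] X(2)[OF \<phi>(1), of n] *[OF mn(1)] *[OF mn(2)] N by linarith
        finally show "nrm (X m - X n) < e" using \<phi> X(1) by (simp add: W_diff)
      qed
    qed
    then obtain x where x: "x \<in> A0" "\<And>e. e > 0 \<Longrightarrow> \<exists>N. \<forall>n\<ge>N. nrm (X n - x) < e" by blast
    have "\<phi> x = complex_of_real (f \<phi>)" if \<phi>: "\<phi> \<in> W" for \<phi>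
    proof -
      have "(\<lambda>n. \<phi> (X n)) \<longlonglongrightarrow> \<phi> x"
      proof (rule LIMSEQ_I)
        fix e :: real assume "e > 0"
        then obtain N where N: "\<forall>n\<ge>N. nrm (X n - x) < e" using x(2) by blast
        show "\<exists>N. \<forall>n\<ge>N. norm (\<phi> (X n) - \<phi> x) < e"
        proof (intro exI[of _ N] allI impI)
          fix n assume "n \<ge> N"
          then show "norm (\<phi> (X n) - \<phi> x) < e"
            using N W_bound[OF \<phi>, of "X n - x"] X(1) x(1) \<phi> by (auto simp: W_diff intro: le_less_trans)
        qed
      qed
      moreover have "(\<lambda>n. \<phi> (X n)) \<longlonglongrightarrow> complex_of_real (f \<phi>)"
      proof (rule LIMSEQ_I)
        fix e :: real assume e: "e > 0"
        obtain N where N: "1 / (1 + real N) < e"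
          using e reals_Archimedean[of e] by (auto simp: inverse_eq_divide)
        show "\<exists>N. \<forall>n\<ge>N. norm (\<phi> (X n) - complex_of_real (f \<phi>)) < e"
        proof (intro exI[of _ N] allI impI)
          fix n assume "n \<ge> N"
          then have "1 / (1 + real n) \<le> 1 / (1 + real N)" by (intro divide_left_mono) auto
          then show "norm (\<phi> (X n) - complex_of_real (f \<phi>)) < e"
            using X(2)[OF \<phi>, of n] N by (simp add: norm_minus_commute)
        qed
      qed
      ultimately show ?thesis by (rule LIMSEQ_unique)
    qed
    then show ?thesis using x(1) by blast
  qed
  obtain x y where xy: "x \<in> A0" "\<forall>\<phi>\<in>W. \<phi> x = complex_of_real (Re (g \<phi>))"
    "y \<in> A0" "\<forall>\<phi>\<in>W. \<phi> y = complex_of_real (Im (g \<phi>))"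
    using real[of "\<lambda>\<phi>. Re (g \<phi>)"] real[of "\<lambda>\<phi>. Im (g \<phi>)"] g by (auto intro: continuous_intros)
  then show ?thesis
    by (intro bexI[of _ "x + \<i> \<star> y"]) (auto simp: W_add W_smul complex_eq_iff)
qed

section \<open>Positivity, absolute values and nowhere dense zero sets\<close>

abbreviation P :: "'a set" where "P \<equiv> cpos A0 mul invl"

lemma nrm_leI: "\<lbrakk>x \<in> A0; \<And>\<phi>. \<phi> \<in> W \<Longrightarrow> cmod (\<phi> x) \<le> c\<rbrakk> \<Longrightarrow> nrm x \<le> c"
  using exists_character[of x] by force

text \<open>Nonnegative transforms have continuous square roots, which \<open>W_surj\<close>
  realises in \<open>A0\<close>. From here on positivity, sums and products in the cone are checked
  pointwise.\<close>

lemma P_iff: "x \<in> P \<longleftrightarrow> x \<in> A0 \<and> (\<forall>\<phi>\<in>W. Im (\<phi> x) = 0 \<and> 0 \<le> Re (\<phi> x))"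
proof safe
  assume "x \<in> P"
  then obtain y where y: "y \<in> A0" "x = invl y \<odot> y" by (auto simp: cpos_def)
  then show "x \<in> A0" by simp
  fix \<phi> assume \<phi>: "\<phi> \<in> W"
  have "\<phi> x = complex_of_real ((cmod (\<phi> y))\<^sup>2)"
    using y \<phi> by (simp add: W_mul W_invl mult.commute flip: complex_norm_square)
  then show "Im (\<phi> x) = 0" "0 \<le> Re (\<phi> x)" by simp_all
next
  assume x: "x \<in> A0" "\<forall>\<phi>\<in>W. Im (\<phi> x) = 0 \<and> 0 \<le> Re (\<phi> x)"
  have "continuous_on W (\<lambda>\<phi>. complex_of_real (sqrt (Re (\<phi> x))))"
    by (intro continuous_intros continuous_on_eval)
  then obtain y where y: "y \<in> A0" "\<forall>\<phi>\<in>W. \<phi> y = complex_of_real (sqrt (Re (\<phi> x)))"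
    using W_surj by blast
  have "x = invl y \<odot> y"
    using x y by (intro W_eqI) (auto simp: W_mul W_invl complex_eq_iff)
  then show "x \<in> P" using y(1) by (auto simp: cpos_def)
qed

lemma P_A0: "x \<in> P \<Longrightarrow> x \<in> A0"
  by (simp add: P_iff)

lemma P_val: "\<lbrakk>x \<in> P; \<phi> \<in> W\<rbrakk> \<Longrightarrow> \<phi> x = complex_of_real (Re (\<phi> x))"
  and P_Re: "\<lbrakk>x \<in> P; \<phi> \<in> W\<rbrakk> \<Longrightarrow> 0 \<le> Re (\<phi> x)"
  by (auto simp: P_iff complex_eq_iff)

lemma P_add: "\<lbrakk>x \<in> P; y \<in> P\<rbrakk> \<Longrightarrow> x + y \<in> P"
  by (auto simp: P_iff W_add)

lemma P_mul: "\<lbrakk>x \<in> P; y \<in> P\<rbrakk> \<Longrightarrow> x \<odot> y \<in> P"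
  by (auto simp: P_iff W_mul)

lemma P_scale: "\<lbrakk>x \<in> P; 0 \<le> r\<rbrakk> \<Longrightarrow> complex_of_real r \<star> x \<in> P"
  by (auto simp: P_iff W_smul)

lemma P_zero [simp]: "0 \<in> P" and P_one [simp]: "\<one> \<in> P"
  by (auto simp: P_iff W_zero W_one)

lemma upos_iff: "x \<in> upos A0 mul invl nrm \<longleftrightarrow> x \<in> P \<and> (\<forall>\<phi>\<in>W. Re (\<phi> x) \<le> 1)"
proof safe
  assume x: "x \<in> upos A0 mul invl nrm"
  then show "x \<in> P" by (simp add: upos_def)
  fix \<phi> assume "\<phi> \<in> W"
  then have "cmod (\<phi> x) \<le> 1" using W_bound[of \<phi> x] x by (force simp: upos_def P_A0)
  then show "Re (\<phi> x) \<le> 1" using complex_Re_le_cmod[of "\<phi> x"] by linarith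
next
  assume x: "x \<in> P" "\<forall>\<phi>\<in>W. Re (\<phi> x) \<le> 1"
  have "nrm x \<le> 1"
  proof (rule nrm_leI)
    fix \<phi> assume "\<phi> \<in> W"
    then show "cmod (\<phi> x) \<le> 1" using x by (subst P_val) (auto simp: P_Re)
  qed (use x P_A0 in auto)
  then show "x \<in> upos A0 mul invl nrm" using x by (simp add: upos_def)
qed

lemma absv:
  assumes x: "x \<in> A0"
  shows absv_P: "absv A0 mul invl x \<in> P"
    and absv_val: "\<And>\<phi>. \<phi> \<in> W \<Longrightarrow> \<phi> (absv A0 mul invl x) = complex_of_real (cmod (\<phi> x))"
proof -
  have "continuous_on W (\<lambda>\<phi>. complex_of_real (cmod (\<phi> x)))"
    by (intro continuous_intros continuous_on_eval)
  then obtain y where y: "y \<in> A0" "\<forall>\<phi>\<in>W. \<phi> y = complex_of_real (cmod (\<phi> x))"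
    using W_surj by blast
  have "Im (\<phi> y) = 0 \<and> 0 \<le> Re (\<phi> y)" if "\<phi> \<in> W" for \<phi>
    using bspec[OF y(2) that] by simp
  then have yP: "y \<in> P" using y by (simp add: P_iff)
  have yy: "y \<odot> y = invl x \<odot> x"
  proof (rule W_eqI)
    fix \<phi> assume "\<phi> \<in> W"
    then show "\<phi> (y \<odot> y) = \<phi> (invl x \<odot> x)"
      using bspec[OF y(2) \<open>\<phi> \<in> W\<close>] x y(1) complex_norm_square[of "\<phi> x"]
      by (simp add: W_mul W_invl mult.commute power2_eq_square)
  qed (use x y in auto)
  have un: "z = y" if z: "z \<in> P" "z \<odot> z = invl x \<odot> x" for z
  proof (rule W_eqI)
    fix \<phi> assume \<phi>: "\<phi> \<in> W"
    have "\<phi> z * \<phi> z = \<phi> y * \<phi> y"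
      using z yy \<phi> y(1) P_A0[OF z(1)] by (simp flip: W_mul)
    then have "Re (\<phi> z * \<phi> z) = Re (\<phi> y * \<phi> y)" by simp
    then have "(Re (\<phi> z))\<^sup>2 = (Re (\<phi> y))\<^sup>2"
      using z(1) yP \<phi> by (simp add: P_iff power2_eq_square)
    then have "Re (\<phi> z) = Re (\<phi> y)" using P_Re[OF z(1) \<phi>] P_Re[OF yP \<phi>] by (simp only: power2_eq_iff_nonneg)
    then show "\<phi> z = \<phi> y" using P_val[OF z(1) \<phi>] P_val[OF yP \<phi>] by simp
  qed (use z y P_A0 in auto)
  have "absv A0 mul invl x = y" unfolding absv_def
  proof (rule the_equality)
    show "y \<in> P \<and> y \<odot> y = invl x \<odot> x" using yP yy by (rule conjI)
    show "z = y" if "z \<in> P \<and> z \<odot> z = invl x \<odot> x" for z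
      using un[of z] that by (elim conjE)
  qed
  then show "absv A0 mul invl x \<in> P"
    "\<And>\<phi>. \<phi> \<in> W \<Longrightarrow> \<phi> (absv A0 mul invl x) = complex_of_real (cmod (\<phi> x))"
    using yP y by auto
qed

lemma W_completely_regular:
  assumes U: "openin (top_of_set W) U" and \<phi>: "\<phi> \<in> U"
  shows "\<exists>g. continuous_on W g \<and> g \<phi> \<noteq> (0::complex) \<and> (\<forall>\<psi>\<in>W - U. g \<psi> = 0)"
proof -
  have "Hausdorff_space (euclidean :: ('a \<Rightarrow> complex) topology)"
    by (metis Hausdorff_space_euclidean Hausdorff_space_product_topology euclidean_product_topology)
  then have "Hausdorff_space (top_of_set W)" "compact_space (top_of_set W)"
    using compact_W by (auto simp: compact_space_subtopology intro: Hausdorff_space_subtopology)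
  then have "completely_regular_space (top_of_set W)"
    using compact_Hausdorff_or_regular_imp_normal_space normal_imp_completely_regular_space by blast
  moreover have "closedin (top_of_set W) (W - U)" using U by (simp add: closedin_diff)
  moreover have "\<phi> \<in> topspace (top_of_set W) - (W - U)" using U \<phi> openin_imp_subset by auto
  ultimately obtain f :: "_ \<Rightarrow> real" where f: "continuous_map (top_of_set W) (top_of_set {0..1}) f"
    "f \<phi> = 0" "f ` (W - U) \<subseteq> {1}"
    unfolding completely_regular_space_def by (elim allE impE) (auto elim: that)
  have "continuous_on W f" using f(1) by (simp add: continuous_map_in_subtopology)
  then show ?thesis
    using f by (intro exI[of _ "\<lambda>\<psi>. complex_of_real (1 - f \<psi>)"]) (auto intro!: continuous_intros)
qed

text \<open>If z vanished on a nonempty open set, a nonzero continuous function supported there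
  would be the transform of some y with yz = 0.\<close>

lemma nowhere_dense_zeros:
  assumes z: "z \<in> A0" and reg: "\<And>y. \<lbrakk>y \<in> A0; y \<odot> z = 0\<rbrakk> \<Longrightarrow> y = 0"
  shows "nowhere_dense_in W {\<phi>\<in>W. \<phi> z = 0}"
  unfolding nowhere_dense_in_def
proof (intro allI impI)
  fix U assume U: "openin (top_of_set W) U \<and> U \<noteq> {}"
  then have UW: "U \<subseteq> W" using openin_imp_subset by blast
  have "open {\<phi>::'a \<Rightarrow> complex. \<phi> z \<noteq> 0}"
    by (intro open_Collect_neq continuous_intros continuous_on_eval)
  then have op: "openin (top_of_set W) (U \<inter> {\<phi>. \<phi> z \<noteq> 0})"
    using U openin_Int_open by blast
  have "\<exists>\<phi>\<in>U. \<phi> z \<noteq> 0"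
  proof (rule ccontr)
    assume no: "\<not> (\<exists>\<phi>\<in>U. \<phi> z \<noteq> 0)"
    obtain \<phi> where \<phi>: "\<phi> \<in> U" using U by blast
    obtain g :: "_ \<Rightarrow> complex" where g: "continuous_on W g" "g \<phi> \<noteq> 0" "\<forall>\<psi>\<in>W - U. g \<psi> = 0"
      using W_completely_regular[OF conjunct1[OF U] \<phi>] by metis
    obtain y where y: "y \<in> A0" "\<forall>\<psi>\<in>W. \<psi> y = g \<psi>" using W_surj[OF g(1)] by blast
    have "y \<odot> z = 0"
      using y z g no by (intro W_eqI) (auto simp: W_mul W_zero)
    then have "y = 0" using reg y by blast
    moreover have "\<phi> \<in> W" using \<phi> UW by blast
    ultimately show False using y(2) g(2) W_zero[of \<phi>] by simp
  qed
  then show "\<exists>V. openin (top_of_set W) V \<and> V \<noteq> {} \<and> V \<subseteq> U \<and> V \<inter> {\<phi>\<in>W. \<phi> z = 0} = {}"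
    using op by (intro exI[of _ "U \<inter> {\<phi>. \<phi> z \<noteq> 0}"]) auto
qed

end

section \<open>The quasi *-algebra structure of the completion\<close>

locale comm_lcqca = comm_cstar +
  fixes p :: "'l \<Rightarrow> 'a \<Rightarrow> real" and A :: "'a set"
  assumes lcqca: "lcqca smul A0 one mul invl nrm p A"
begin

lemma p_nonneg [simp]: "0 \<le> p l a" and p_add: "p l (a + b) \<le> p l a + p l b"
  and p_smul: "p l (c \<star> a) = cmod c * p l a"
  using lcqca by (auto simp: lcqca_def is_completion_def seminorm_family_def)

lemma p_zero [simp]: "p l 0 = 0"
  using p_smul[of l 0 0] by simp

lemma p_minus: "p l (- a) = p l a"
  using p_smul[of l "-1" a] by (simp add: minus_smul)

lemma p_minus_commute: "p l (a - b) = p l (b - a)"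
  using p_minus[of l "a - b"] by simp

lemma p_triangle: "p l (a - c) \<le> p l (a - b) + p l (b - c)"
  using p_add[of l "a - b" "b - c"] by simp

lemma p_eqI: assumes "\<And>l. p l (a - b) = 0" shows "a = b"
proof -
  have "\<forall>a. (\<forall>l. p l a = 0) \<longrightarrow> a = 0"
    using lcqca unfolding lcqca_def is_completion_def by blast
  with assms have "a - b = 0" by blast
  then show ?thesis by simp
qed

lemma p_eqI_le: assumes "\<And>l e. e > 0 \<Longrightarrow> p l (a - b) \<le> e" shows "a = b"
proof (rule p_eqI)
  fix l
  have "p l (a - b) \<le> 0"
  proof (rule field_le_epsilon)
    fix e :: real assume "e > 0"
    then show "p l (a - b) \<le> 0 + e" using assms[of e l] by simp
  qed
  then show "p l (a - b) = 0" using p_nonneg[of l "a - b"] by (rule order_antisym)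
qed

lemma dense: assumes "finite L" "e > 0" shows "\<exists>x\<in>A0. \<forall>l\<in>L. p l (x - b) < e"
proof -
  have "\<exists>x\<in>A0. \<forall>l\<in>L. p l (b - x) < e"
    using lcqca assms by (simp add: lcqca_def is_completion_def)
  then show ?thesis by (simp only: p_minus_commute[of _ b])
qed

lemma complete: "\<lbrakk>F \<noteq> bot; tcauchy p F\<rbrakk> \<Longrightarrow> \<exists>a. tconv p F a"
  using lcqca by (simp add: lcqca_def is_completion_def)

lemma T1:
  assumes "x \<in> A0"
  shows xadd_mul: "(a + b) \<odot> x = a \<odot> x + b \<odot> x"
    and xsmul_mul: "(c \<star> a) \<odot> x = c \<star> (a \<odot> x)"
    and tcont_right: "tcont p (\<lambda>a. a \<odot> x)" and tcont_left: "tcont p (\<lambda>a. x \<odot> a)"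
  using lcqca assms by (auto simp: lcqca_def T1_ext_def)

lemma xminus_mul: "x \<in> A0 \<Longrightarrow> (- a) \<odot> x = - (a \<odot> x)"
  using xsmul_mul[of x "-1" a] by (simp add: minus_smul)

lemma xdiff_mul: "x \<in> A0 \<Longrightarrow> (a - b) \<odot> x = a \<odot> x - b \<odot> x"
  using xadd_mul[of x a "- b"] by (simp add: xminus_mul)

lemma xmul_comm: assumes x: "x \<in> A0" shows "b \<odot> x = x \<odot> b"
proof (rule p_eqI_le)
  fix l and e :: real assume e: "e > 0"
  obtain L d where 1: "finite L" "d > 0" "\<And>c. (\<forall>m\<in>L. p m (c - b) < d) \<Longrightarrow> p l (c \<odot> x - b \<odot> x) < e/2"
    using tcont_right[OF x] half_gt_zero[OF e] unfolding tcont_def by meson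
  obtain L' d' where 2: "finite L'" "d' > 0" "\<And>c. (\<forall>m\<in>L'. p m (c - b) < d') \<Longrightarrow> p l (x \<odot> c - x \<odot> b) < e/2"
    using tcont_left[OF x] half_gt_zero[OF e] unfolding tcont_def by meson
  obtain y where y: "y \<in> A0" "\<forall>m\<in>L \<union> L'. p m (y - b) < min d d'"
    using dense[of "L \<union> L'" "min d d'" b] 1 2 by auto
  have "p l (y \<odot> x - b \<odot> x) < e/2" "p l (x \<odot> y - x \<odot> b) < e/2"
    using 1(3)[of y] 2(3)[of y] y(2) by auto
  then show "p l (b \<odot> x - x \<odot> b) \<le> e"
    using p_triangle[of l "b \<odot> x" "x \<odot> b" "y \<odot> x"] x y(1)
    by (simp add: mul_comm[of y x] p_minus_commute[of l "b \<odot> x"])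
qed

text \<open>The index \<open>l'\<close> does not depend on \<open>x\<close>, so estimates against an
  \<open>A0\<close>-factor of bounded norm are uniform. This uniformity carries the Cauchy argument
  of \<open>resolvent\<close>.\<close>

lemma T3_ext: "\<exists>l'. \<forall>x\<in>A0. \<forall>b. p l (b \<odot> x) \<le> nrm x * p l' b"
proof -
  have "T3 A0 mul nrm p" using lcqca by (simp add: lcqca_def)
  then obtain l' where l': "\<forall>x\<in>A0. \<forall>y\<in>A0. x \<odot> y = y \<odot> x \<longrightarrow> p l (x \<odot> y) \<le> nrm x * p l' y"
    unfolding T3_def by (elim allE exE) (rule that)
  have "p l (b \<odot> x) \<le> nrm x * p l' b" if x: "x \<in> A0" for x b
  proof (rule field_le_epsilon)
    fix e :: real assume e: "e > 0"
    \<comment> \<open>Ensures \<open>nrm x * k\<close> is at most half of \<open>e\<close>, also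
      when \<open>nrm x\<close> is 0.\<close>
    define k where "k = e / (2 * (nrm x + 1))"
    have nx: "0 \<le> nrm x" using x by simp
    then have k: "k > 0" "nrm x * k \<le> e / 2" using e by (auto simp: k_def field_simps)
    obtain L d where 1: "finite L" "d > 0" "\<And>c. (\<forall>m\<in>L. p m (c - b) < d) \<Longrightarrow> p l (c \<odot> x - b \<odot> x) < e/2"
      using tcont_right[OF x] half_gt_zero[OF e] unfolding tcont_def by meson
    obtain y where y: "y \<in> A0" "\<forall>m\<in>insert l' L. p m (y - b) < min d k"
      using dense[of "insert l' L" "min d k" b] 1 k by auto
    have "p l (b \<odot> x) \<le> p l (y \<odot> x - b \<odot> x) + p l (y \<odot> x)"
      using p_add[of l "b \<odot> x - y \<odot> x" "y \<odot> x"] by (simp add: p_minus_commute[of l "y \<odot> x"])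
    also have "p l (y \<odot> x - b \<odot> x) \<le> e/2" using 1(3)[of y] y(2) by (simp add: less_imp_le)
    also have "p l (y \<odot> x) \<le> nrm x * p l' y" using l' x y(1) mul_comm[OF y(1) x] by (metis mul_comm)
    also have "p l' y \<le> p l' b + k" using p_add[of l' "y - b" b] y(2) by simp
    finally have "p l (b \<odot> x) \<le> e/2 + nrm x * (p l' b + k)" using nx by (simp add: mult_left_mono)
    then show "p l (b \<odot> x) \<le> nrm x * p l' b + e" using k by (simp add: algebra_simps)
  qed
  then show ?thesis by blast
qed

text \<open>Identities extend from \<open>A0\<close> to the completion along maps that are Lipschitz
  with respect to finite sums of seminorms.\<close>

definition lip :: "('a \<Rightarrow> 'a) \<Rightarrow> bool" where
  "lip f \<longleftrightarrow> (\<forall>l. \<exists>L K. finite L \<and> 0 \<le> K \<and> (\<forall>b c. p l (f b - f c) \<le> K * (\<Sum>m\<in>L. p m (b - c))))"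

lemma lip_id: "lip (\<lambda>b. b)"
  unfolding lip_def
proof
  fix l show "\<exists>L K. finite L \<and> 0 \<le> K \<and> (\<forall>b c. p l (b - c) \<le> K * (\<Sum>m\<in>L. p m (b - c)))"
    by (intro exI[of _ "{l}"] exI[of _ 1]) simp
qed

lemma lip_smul: assumes "lip f" shows "lip (\<lambda>b. c \<star> f b)"
  unfolding lip_def
proof
  fix l
  obtain L K where "finite L" "0 \<le> K" and *: "\<And>b d. p l (f b - f d) \<le> K * (\<Sum>m\<in>L. p m (b - d))"
    using assms unfolding lip_def by metis
  moreover have "p l (c \<star> f b - c \<star> f d) \<le> (cmod c * K) * (\<Sum>m\<in>L. p m (b - d))" for b d
    using mult_left_mono[OF *[of b d], of "cmod c"] by (simp add: p_smul mult.assoc flip: smul_diff)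
  ultimately show "\<exists>L K. finite L \<and> 0 \<le> K \<and> (\<forall>b d. p l (c \<star> f b - c \<star> f d) \<le> K * (\<Sum>m\<in>L. p m (b - d)))"
    by (intro exI[of _ L] exI[of _ "cmod c * K"]) simp
qed

lemma lip_mul: assumes "lip f" "x \<in> A0" shows "lip (\<lambda>b. f b \<odot> x)"
  unfolding lip_def
proof
  fix l
  obtain l' where l': "\<And>b. p l (b \<odot> x) \<le> nrm x * p l' b" using T3_ext assms(2) by metis
  obtain L K where "finite L" "0 \<le> K" and *: "\<And>b d. p l' (f b - f d) \<le> K * (\<Sum>m\<in>L. p m (b - d))"
    using assms(1) unfolding lip_def by metis
  moreover have "p l (f b \<odot> x - f d \<odot> x) \<le> (nrm x * K) * (\<Sum>m\<in>L. p m (b - d))" for b d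
    using order_trans[OF l'[of "f b - f d"] mult_left_mono[OF *[of b d], of "nrm x"]] assms(2)
    by (simp add: xdiff_mul mult.assoc)
  ultimately show "\<exists>L K. finite L \<and> 0 \<le> K \<and> (\<forall>b d. p l (f b \<odot> x - f d \<odot> x) \<le> K * (\<Sum>m\<in>L. p m (b - d)))"
    using assms(2) by (intro exI[of _ L] exI[of _ "nrm x * K"]) simp
qed

lemma lip_add: assumes "lip f" "lip g" shows "lip (\<lambda>b. f b + g b)"
  unfolding lip_def
proof
  fix l
  obtain L K where 1: "finite L" "0 \<le> K" and f: "\<And>b d. p l (f b - f d) \<le> K * (\<Sum>m\<in>L. p m (b - d))"
    using assms(1) unfolding lip_def by metis
  obtain L' K' where 2: "finite L'" "0 \<le> K'" and g: "\<And>b d. p l (g b - g d) \<le> K' * (\<Sum>m\<in>L'. p m (b - d))"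
    using assms(2) unfolding lip_def by metis
  have "p l (f b + g b - (f d + g d)) \<le> (K + K') * (\<Sum>m\<in>L \<union> L'. p m (b - d))" for b d
  proof -
    have "p l (f b + g b - (f d + g d)) \<le> p l (f b - f d) + p l (g b - g d)"
      using p_add[of l "f b - f d" "g b - g d"] by (simp add: algebra_simps)
    also have "\<dots> \<le> K * (\<Sum>m\<in>L. p m (b - d)) + K' * (\<Sum>m\<in>L'. p m (b - d))"
      by (intro add_mono f g)
    also have "\<dots> \<le> K * (\<Sum>m\<in>L \<union> L'. p m (b - d)) + K' * (\<Sum>m\<in>L \<union> L'. p m (b - d))"
      using 1 2 by (intro add_mono mult_left_mono sum_mono2) auto
    finally show ?thesis by (simp add: algebra_simps)
  qed
  then show "\<exists>L K. finite L \<and> 0 \<le> K \<and> (\<forall>b d. p l (f b + g b - (f d + g d)) \<le> K * (\<Sum>m\<in>L. p m (b - d)))"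
    using 1 2 by (intro exI[of _ "L \<union> L'"] exI[of _ "K + K'"]) simp
qed

lemma lip_eqI:
  assumes f: "lip f" and g: "lip g" and eq: "\<And>x. x \<in> A0 \<Longrightarrow> f x = g x"
  shows "f b = g b"
proof -
  define h where "h = (\<lambda>b. f b + (-1) \<star> g b)"
  have "lip h" unfolding h_def by (intro lip_add lip_smul f g)
  have "h b = 0"
  proof (rule p_eqI_le)
    fix l and e :: real assume e: "e > 0"
    obtain L K where L: "finite L" "0 \<le> K" and *: "\<And>b d. p l (h b - h d) \<le> K * (\<Sum>m\<in>L. p m (b - d))"
      using \<open>lip h\<close> unfolding lip_def by metis
    \<comment> \<open>The added ones cover \<open>K = 0\<close> and an empty
      \<open>L\<close>.\<close>
    define k where "k = e / ((K + 1) * (card L + 1))"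
    have k: "k > 0" using e L by (simp add: k_def add_nonneg_pos)
    obtain x where x: "x \<in> A0" "\<forall>m\<in>L. p m (x - b) < k" using dense[OF L(1) k] by blast
    have "h x = 0" using eq[OF x(1)] by (simp add: h_def minus_smul)
    then have "p l (h b - 0) \<le> K * (\<Sum>m\<in>L. p m (b - x))" using *[of b x] by simp
    also have "\<dots> \<le> K * (\<Sum>m\<in>L. k)"
      using x(2) L by (intro mult_left_mono sum_mono) (auto simp: p_minus_commute[of _ b] less_imp_le)
    also have "\<dots> = (K * card L) * k" by simp
    also have "\<dots> \<le> ((K + 1) * (card L + 1)) * k" using L k by (intro mult_right_mono mult_mono) auto
    also have "\<dots> = e" using L by (simp add: k_def)
    finally show "p l (h b - 0) \<le> e" .
  qed
  then show ?thesis by (simp add: h_def minus_smul)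
qed

lemma xmul_assoc: assumes "x \<in> A0" "y \<in> A0" shows "b \<odot> x \<odot> y = b \<odot> (x \<odot> y)"
  by (rule lip_eqI) (use assms in \<open>auto intro!: lip_mul lip_id simp: mul_assoc\<close>)

lemma xmul_add: assumes "x \<in> A0" "y \<in> A0" shows "b \<odot> (x + y) = b \<odot> x + b \<odot> y"
  by (rule lip_eqI) (use assms in \<open>auto intro!: lip_mul lip_id lip_add simp: mul_add\<close>)

lemma xmul_smul: assumes "x \<in> A0" shows "b \<odot> (c \<star> x) = c \<star> (b \<odot> x)"
  by (rule lip_eqI) (use assms in \<open>auto intro!: lip_mul lip_id lip_smul simp: mul_smul\<close>)

lemma xmul_one [simp]: "b \<odot> \<one> = b"
  by (rule lip_eqI[where f="\<lambda>b. b \<odot> \<one>" and g="\<lambda>b. b"]) (auto intro!: lip_mul lip_id)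

lemma xmul_zero [simp]: "b \<odot> 0 = 0"
  using xmul_smul[of 0 b 0] by simp

lemma xmul_minus: "x \<in> A0 \<Longrightarrow> b \<odot> (- x) = - (b \<odot> x)"
  using xmul_smul[of x b "-1"] by (simp add: minus_smul)

lemma xmul_diff: "\<lbrakk>x \<in> A0; y \<in> A0\<rbrakk> \<Longrightarrow> b \<odot> (x - y) = b \<odot> x - b \<odot> y"
  using xmul_add[of x "- y" b] by (simp add: xmul_minus)

text \<open>\<open>tconv\<close> sees only the filter of values. Keeping the index lets the nets x,
  (1 + xm)^{-1} and xv(1 + xm)^{-1} run along one filter.\<close>

definition tlim :: "('i \<Rightarrow> 'a) \<Rightarrow> 'a \<Rightarrow> 'i filter \<Rightarrow> bool" where
  "tlim f a F \<longleftrightarrow> (\<forall>l. ((\<lambda>i. p l (f i - a)) \<longlongrightarrow> 0) F)"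

lemma tconv_iff: "tconv p (filtermap f F) a \<longleftrightarrow> tlim f a F"
  by (auto simp: tconv_def tlim_def tendsto_iff eventually_filtermap)

lemma tlim_le: assumes "\<And>l. \<exists>g. (g \<longlongrightarrow> 0) F \<and> eventually (\<lambda>i. p l (f i - a) \<le> g i) F" shows "tlim f a F"
  unfolding tlim_def
proof
  fix l
  obtain g where g: "(g \<longlongrightarrow> 0) F" "eventually (\<lambda>i. p l (f i - a) \<le> g i) F" using assms by blast
  show "((\<lambda>i. p l (f i - a)) \<longlongrightarrow> 0) F"
    by (rule tendsto_sandwich[OF _ g(2) tendsto_const g(1)]) simp
qed

lemma tlim_add: assumes "tlim f a F" "tlim g b F" shows "tlim (\<lambda>i. f i + g i) (a + b) F"
proof (rule tlim_le)
  fix l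
  have "((\<lambda>i. p l (f i - a) + p l (g i - b)) \<longlongrightarrow> 0) F"
    using tendsto_add[of "\<lambda>i. p l (f i - a)" 0 F "\<lambda>i. p l (g i - b)" 0] assms by (simp add: tlim_def)
  moreover have "p l (f i + g i - (a + b)) \<le> p l (f i - a) + p l (g i - b)" for i
    using p_add[of l "f i - a" "g i - b"] by (simp add: algebra_simps)
  ultimately show "\<exists>h. (h \<longlongrightarrow> 0) F \<and> eventually (\<lambda>i. p l (f i + g i - (a + b)) \<le> h i) F"
    by (intro exI conjI) auto
qed

lemma tlim_smul: assumes "tlim f a F" shows "tlim (\<lambda>i. c \<star> f i) (c \<star> a) F"
  using assms tendsto_mult_left[of _ 0 F "cmod c"] by (auto simp: tlim_def p_smul simp flip: smul_diff)

lemma tlim_const: "tlim (\<lambda>i. a) a F"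
  by (simp add: tlim_def)

lemma tlim_diff: assumes "tlim f a F" "tlim g b F" shows "tlim (\<lambda>i. f i - g i) (a - b) F"
  using tlim_add[OF assms(1) tlim_smul[OF assms(2), of "-1"]] by (simp add: minus_smul)

lemma tlim_mul: assumes "tlim f a F" "x \<in> A0" shows "tlim (\<lambda>i. f i \<odot> x) (a \<odot> x) F"
proof (rule tlim_le)
  fix l
  obtain l' where l': "\<And>b. p l (b \<odot> x) \<le> nrm x * p l' b" using T3_ext assms(2) by metis
  have "((\<lambda>i. nrm x * p l' (f i - a)) \<longlongrightarrow> 0) F"
    using tendsto_mult_left[of _ 0 F "nrm x"] assms(1) by (auto simp: tlim_def)
  then show "\<exists>h. (h \<longlongrightarrow> 0) F \<and> eventually (\<lambda>i. p l (f i \<odot> x - a \<odot> x) \<le> h i) F"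
    using l' assms(2) by (intro exI conjI) (auto simp flip: xdiff_mul)
qed

lemma tlim_unique: assumes "F \<noteq> bot" "tlim f a F" "tlim f b F" shows "a = b"
proof (rule p_eqI)
  fix l
  have "((\<lambda>i. p l ((f i - f i) - (a - b))) \<longlongrightarrow> 0) F"
    using tlim_diff[OF assms(2,3)] unfolding tlim_def by blast
  then have "((\<lambda>i. p l (a - b)) \<longlongrightarrow> 0) F" using p_minus[of l "a - b"] by simp
  then show "p l (a - b) = 0" using assms(1) by (simp add: tendsto_const_iff)
qed

lemma tlim_cong: "eventually (\<lambda>i. f i = g i) F \<Longrightarrow> tlim f a F \<longleftrightarrow> tlim g a F"
  unfolding tlim_def by (intro all_cong1 tendsto_cong) (auto elim: eventually_mono)

lemma tlim_compose: "\<lbrakk>tlim f a F; filterlim g F G\<rbrakk> \<Longrightarrow> tlim (\<lambda>i. f (g i)) a G"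
  unfolding tlim_def using filterlim_compose by blast

section \<open>Quasi-positive elements as limits of positive nets\<close>

abbreviation qP :: "'a set" where "qP \<equiv> qpos A0 mul invl p"

lemma qP_I: "\<lbrakk>F \<noteq> bot; eventually (\<lambda>i. f i \<in> P) F; tlim f a F\<rbrakk> \<Longrightarrow> a \<in> qP"
  unfolding qpos_def using tconv_iff[of f F a]
  by (auto intro!: exI[of _ "filtermap f F"] simp: eventually_filtermap filtermap_bot_iff)

lemma qP_E:
  assumes "a \<in> qP"
  obtains F where "F \<noteq> bot" "eventually (\<lambda>x. x \<in> P) F" "tlim (\<lambda>x. x) a F"
  using assms tconv_iff[of "\<lambda>x. x"] by (auto simp: qpos_def filtermap_ident)

lemma P_qP: "x \<in> P \<Longrightarrow> x \<in> qP"
  by (rule qP_I[of "principal {x}" "\<lambda>i. i"]) (auto simp: eventually_principal principal_eq_bot_iff tlim_def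
    intro!: tendsto_eventually)

lemma qP_add: assumes "a \<in> qP" "b \<in> qP" shows "a + b \<in> qP"
proof -
  obtain F where F: "F \<noteq> bot" "eventually (\<lambda>x. x \<in> P) F" "tlim (\<lambda>x. x) a F" using qP_E[OF assms(1)] .
  obtain G where G: "G \<noteq> bot" "eventually (\<lambda>x. x \<in> P) G" "tlim (\<lambda>x. x) b G" using qP_E[OF assms(2)] .
  show ?thesis
  proof (rule qP_I)
    show "F \<times>\<^sub>F G \<noteq> bot" using F G by (simp add: prod_filter_eq_bot)
    show "eventually (\<lambda>i. fst i + snd i \<in> P) (F \<times>\<^sub>F G)"
      using eventually_prodI[OF F(2) G(2)] by (rule eventually_mono) (auto intro: P_add)
    show "tlim (\<lambda>i. fst i + snd i) (a + b) (F \<times>\<^sub>F G)"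
      by (rule tlim_add[OF tlim_compose[OF F(3) filterlim_fst] tlim_compose[OF G(3) filterlim_snd]])
  qed
qed

lemma qP_mul: assumes "a \<in> qP" "x \<in> P" shows "a \<odot> x \<in> qP"
proof -
  obtain F where F: "F \<noteq> bot" "eventually (\<lambda>x. x \<in> P) F" "tlim (\<lambda>x. x) a F" using qP_E[OF assms(1)] .
  show ?thesis
    by (rule qP_I[OF F(1) _ tlim_mul[OF F(3) P_A0[OF assms(2)]]])
      (use F(2) in \<open>rule eventually_mono\<close>, auto intro: P_mul assms)
qed

lemma qP_scale: assumes "a \<in> qP" "0 \<le> r" shows "complex_of_real r \<star> a \<in> qP"
  using qP_mul[OF assms(1) P_scale[OF P_one assms(2)]] by (simp add: xmul_smul)

subsection \<open>Resolvents of quasi-positive elements\<close>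

abbreviation U :: "'a set" where "U \<equiv> upos A0 mul invl nrm"

lemma U_A0: "x \<in> U \<Longrightarrow> x \<in> A0" and U_P: "x \<in> U \<Longrightarrow> x \<in> P" and U_nrm: "x \<in> U \<Longrightarrow> nrm x \<le> 1"
  by (auto simp: upos_def P_A0)

lemma U_closed: assumes "F \<noteq> bot" "eventually (\<lambda>i. f i \<in> U) F" "tlim f a F" shows "a \<in> U"
proof -
  have "T4 A0 mul invl nrm p" using lcqca by (simp add: lcqca_def)
  moreover have "filtermap f F \<noteq> bot" "eventually (\<lambda>x. x \<in> U) (filtermap f F)" "tconv p (filtermap f F) a"
    using assms by (simp_all add: filtermap_bot_iff eventually_filtermap tconv_iff)
  ultimately show ?thesis unfolding T4_def by blast
qed

lemma P_val_of_real: "\<lbrakk>x \<in> P; \<phi> \<in> W\<rbrakk> \<Longrightarrow> \<exists>t\<ge>0. \<phi> x = complex_of_real t"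
  using P_val P_Re by blast

text \<open>Domination of v by m makes the transform of xv(1 + xm)^{-1} take values sq / (1 + st) in
  [0, 1], so these elements stay in the unit part of the positive cone. It is used with m = 1 for (1
  + a)^{-1} and with m = |x| for the denominators of the transform.\<close>

lemma resolvent:
  assumes a: "a \<in> qP" and m: "m \<in> P"
  shows "\<exists>z\<in>U. a \<odot> m \<odot> z = \<one> - z \<and>
           (\<forall>v\<in>P. (\<forall>\<phi>\<in>W. Re (\<phi> v) \<le> Re (\<phi> m)) \<longrightarrow> a \<odot> v \<odot> z \<in> U)"
proof -
  have mA: "m \<in> A0" using m P_A0 by blast
  obtain F where F: "F \<noteq> bot" "eventually (\<lambda>x. x \<in> P) F" "tlim (\<lambda>x. x) a F" using qP_E[OF a] .
  have nz: "1 + \<phi> x * \<phi> m \<noteq> 0" if xp: "x \<in> P" and ph: "\<phi> \<in> W" for x \<phi>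
  proof -
    obtain s where "s \<ge> 0" "\<phi> x = complex_of_real s" using P_val_of_real[OF xp ph] by blast
    moreover obtain t where "t \<ge> 0" "\<phi> m = complex_of_real t" using P_val_of_real[OF m ph] by blast
    ultimately have "\<phi> x * \<phi> m = complex_of_real (s * t)" "0 \<le> s * t" by simp_all
    then show ?thesis by (metis Re_complex_of_real add_nonneg_pos add.commute less_irrefl
          of_real_1 of_real_add of_real_eq_0_iff zero_less_one)
  qed
  have "\<exists>y\<in>A0. \<forall>\<phi>\<in>W. \<phi> y = 1 / (1 + \<phi> x * \<phi> m)" if "x \<in> P" for x
    using nz[OF that] by (intro W_surj continuous_intros continuous_on_eval) auto
  then obtain r where r: "\<And>x. x \<in> P \<Longrightarrow> r x \<in> A0"
    and rv: "\<And>x \<phi>. \<lbrakk>x \<in> P; \<phi> \<in> W\<rbrakk> \<Longrightarrow> \<phi> (r x) = 1 / (1 + \<phi> x * \<phi> m)" by metis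
  have prod_U: "x \<odot> v \<odot> r x \<in> U" if x: "x \<in> P" and v: "v \<in> P" "\<And>\<phi>. \<phi> \<in> W \<Longrightarrow> Re (\<phi> v) \<le> Re (\<phi> m)" for x v
  proof -
    have "Im (\<phi> (x \<odot> v \<odot> r x)) = 0 \<and> 0 \<le> Re (\<phi> (x \<odot> v \<odot> r x)) \<and> Re (\<phi> (x \<odot> v \<odot> r x)) \<le> 1" if \<phi>: "\<phi> \<in> W" for \<phi>
    proof -
      obtain s where s: "s \<ge> 0" "\<phi> x = complex_of_real s" using P_val_of_real[OF x \<phi>] by blast
      obtain t where t: "t \<ge> 0" "\<phi> m = complex_of_real t" using P_val_of_real[OF m \<phi>] by blast
      obtain q where q: "q \<ge> 0" "\<phi> v = complex_of_real q" using P_val_of_real[OF v(1) \<phi>] by blast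
      note * = s t q
      then have "q \<le> t" using v(2)[OF \<phi>] by simp
      then have st: "s * q \<le> s * t" "0 \<le> s * q" "0 \<le> s * t" using * by (auto intro: mult_left_mono)
      have "\<phi> (x \<odot> v \<odot> r x) = complex_of_real (s * q / (1 + s * t))"
        using x v \<phi> r[OF x] rv[OF x \<phi>] * by (simp add: W_mul P_A0)
      moreover have "0 \<le> s * q / (1 + s * t)" "s * q / (1 + s * t) \<le> 1" using st by (auto simp: divide_le_eq_1)
      ultimately show ?thesis by simp
    qed
    then show ?thesis using x v r by (auto simp: upos_iff P_iff P_A0)
  qed
  have r_U: "r x \<in> U" if x: "x \<in> P" for x
  proof -
    have "Im (\<phi> (r x)) = 0 \<and> 0 \<le> Re (\<phi> (r x)) \<and> Re (\<phi> (r x)) \<le> 1" if \<phi>: "\<phi> \<in> W" for \<phi>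
    proof -
      obtain s where s: "s \<ge> 0" "\<phi> x = complex_of_real s" using P_val_of_real[OF x \<phi>] by blast
      obtain t where t: "t \<ge> 0" "\<phi> m = complex_of_real t" using P_val_of_real[OF m \<phi>] by blast
      note * = s t
      have "\<phi> (r x) = complex_of_real (1 / (1 + s * t))" using rv[OF x \<phi>] * by simp
      moreover have "0 \<le> s * t" using * by simp
      ultimately show ?thesis by (simp add: divide_le_eq_1)
    qed
    then show ?thesis using x r by (auto simp: upos_iff P_iff)
  qed
  \<comment> \<open>The resolvent identity, with the factor y - x isolated: the remaining factor has
    norm at most \<open>nrm m\<close> whatever x and y are, so \<open>T3_ext\<close> makes
    \<open>r\<close> Lipschitz on \<open>P\<close>.\<close>
  have r_diff: "r x - r y = (y - x) \<odot> (m \<odot> r x \<odot> r y)" if "x \<in> P" "y \<in> P" for x y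
  proof (rule W_eqI)
    fix \<phi> assume "\<phi> \<in> W"
    then show "\<phi> (r x - r y) = \<phi> ((y - x) \<odot> (m \<odot> r x \<odot> r y))"
      using that r mA nz[OF that(1)] nz[OF that(2)]
      by (simp add: W_diff W_mul P_A0 rv) (simp add: field_simps)
  qed (use that r mA P_A0 in auto)
  have nrm_prod: "nrm (x \<odot> y) \<le> nrm x" if "x \<in> A0" "y \<in> U" for x y
    using nrm_mul[of x y] mult_left_le[OF U_nrm[OF that(2)], of "nrm x"] that U_A0 by auto
  have nm: "nrm (m \<odot> r x \<odot> r y) \<le> nrm m" if "x \<in> P" "y \<in> P" for x y
    using nrm_prod[of "m \<odot> r x" "r y"] nrm_prod[of m "r x"] r_U r that mA by fastforce
  have cauchy: "tcauchy p (filtermap r F)"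
    unfolding tcauchy_def
  proof (intro allI impI)
    fix l and e :: real assume e: "e > 0"
    obtain l' where l': "\<forall>x\<in>A0. \<forall>b. p l (b \<odot> x) \<le> nrm x * p l' b" using T3_ext by blast
    define d where "d = e / (2 * (nrm m + 1))"
    have m0: "0 \<le> nrm m" using mA by simp
    then have d: "d > 0" "nrm m * (2 * d) < e" using e by (auto simp: d_def field_simps)
    have "eventually (\<lambda>x. p l' (x - a) < d) F"
      using F(3) d(1) unfolding tlim_def tendsto_iff by (auto simp: dist_real_def)
    then have "eventually (\<lambda>x. r x \<in> r ` {x\<in>P. p l' (x - a) < d}) F"
      using F(2) by eventually_elim auto
    moreover have "p l (r x - r y) < e" if "x \<in> P" "y \<in> P" "p l' (x - a) < d" "p l' (y - a) < d" for x y
    proof -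
      have "p l (r x - r y) \<le> nrm (m \<odot> r x \<odot> r y) * p l' (y - x)"
        unfolding r_diff[OF that(1,2)] using l' that r mA by simp
      also have "\<dots> \<le> nrm m * p l' (y - x)" by (rule mult_right_mono[OF nm[OF that(1,2)]]) simp
      also have "\<dots> \<le> nrm m * (2 * d)"
        using p_triangle[of l' y x a] that by (intro mult_left_mono m0) (simp add: p_minus_commute[of l' a])
      finally show ?thesis using d by simp
    qed
    ultimately show "\<exists>S. eventually (\<lambda>b. b \<in> S) (filtermap r F) \<and> (\<forall>b\<in>S. \<forall>c\<in>S. p l (b - c) < e)"
      by (intro exI[of _ "r ` {x\<in>P. p l' (x - a) < d}"]) (auto simp: eventually_filtermap)
  qed
  have "filtermap r F \<noteq> bot" using F(1) by (simp add: filtermap_bot_iff)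
  then obtain z where z: "tlim r z F" using complete[OF _ cauchy] tconv_iff by blast
  have zU: "z \<in> U" by (rule U_closed[OF F(1) _ z]) (use F(2) r_U in \<open>auto elim: eventually_mono\<close>)
  have zA: "z \<in> A0" using zU U_A0 by blast
  \<comment> \<open>Both x and r x vary, so separate continuity is not enough. The difference is
    split as (r x - z)(xv) + (x - a)(vz), and the first summand needs a bound that survives the
    unbounded factor x.\<close>
  have lim: "tlim (\<lambda>x. x \<odot> v \<odot> r x) (a \<odot> v \<odot> z) F"
    if v: "v \<in> P" "\<And>\<phi>. \<phi> \<in> W \<Longrightarrow> Re (\<phi> v) \<le> Re (\<phi> m)" for v
  proof (rule tlim_le)
    fix l
    have vA: "v \<in> A0" using v P_A0 by blast
    obtain l' where l': "\<forall>x\<in>A0. \<forall>b. p l (b \<odot> x) \<le> nrm x * p l' b" using T3_ext by blast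
    define g where "g = (\<lambda>x. nrm m * p l' (x - a) + nrm (v \<odot> z) * p l' (x - a))"
    have pa: "((\<lambda>x. p l' (x - a)) \<longlongrightarrow> 0) F" using F(3) by (simp add: tlim_def)
    have "(g \<longlongrightarrow> 0) F"
      unfolding g_def using tendsto_add[OF tendsto_mult_left[OF pa] tendsto_mult_left[OF pa]] by simp
    moreover have "p l (x \<odot> v \<odot> r x - a \<odot> v \<odot> z) \<le> g x" if x: "x \<in> P" for x
    proof -
      have xA: "x \<in> A0" using x P_A0 by blast
      \<comment> \<open>The factor x is absorbed: regrouping the resolvent identity joins it with v
        and r x into an element of \<open>U\<close>, so the bound \<open>nrm m\<close> is again
        uniform. Letting y tend to a then replaces r y by z.\<close>
      have 1: "p l ((r x - r y) \<odot> (x \<odot> v)) \<le> nrm m * p l' (y - x)" if y: "y \<in> P" for y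
      proof -
        have yA: "y \<in> A0" using y P_A0 by blast
        have "(r x - r y) \<odot> (x \<odot> v) = (y - x) \<odot> (m \<odot> r y \<odot> (x \<odot> v \<odot> r x))"
          unfolding r_diff[OF x y] using xA yA vA mA r x y by (simp add: mul_ac)
        then have "p l ((r x - r y) \<odot> (x \<odot> v)) \<le> nrm (m \<odot> r y \<odot> (x \<odot> v \<odot> r x)) * p l' (y - x)"
          using l' xA vA mA r x y by simp
        also have "nrm (m \<odot> r y \<odot> (x \<odot> v \<odot> r x)) \<le> nrm m"
          using nrm_prod[of "m \<odot> r y" "x \<odot> v \<odot> r x"] nrm_prod[of m "r y"] prod_U[OF x v] r_U[OF y] r y mA by fastforce
        finally show ?thesis by (simp add: mult_right_mono)
      qed
      have "tlim (\<lambda>y. (r x - r y) \<odot> (x \<odot> v)) ((r x - z) \<odot> (x \<odot> v)) F"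
        by (intro tlim_mul tlim_diff tlim_const z) (use xA vA in auto)
      then have L: "((\<lambda>y. p l ((r x - r y) \<odot> (x \<odot> v) - (r x - z) \<odot> (x \<odot> v))) \<longlongrightarrow> 0) F" by (simp add: tlim_def)
      have "((\<lambda>y. p l ((r x - r y) \<odot> (x \<odot> v) - (r x - z) \<odot> (x \<odot> v)) + nrm m * (p l' (y - a) + p l' (x - a)))
          \<longlongrightarrow> 0 + nrm m * (0 + p l' (x - a))) F"
        by (intro tendsto_intros L pa)
      moreover have "eventually (\<lambda>y. p l ((r x - z) \<odot> (x \<odot> v)) \<le>
          p l ((r x - r y) \<odot> (x \<odot> v) - (r x - z) \<odot> (x \<odot> v)) + nrm m * (p l' (y - a) + p l' (x - a))) F"
        using F(2)
      proof eventually_elim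
        case (elim y)
        have "p l' (y - x) \<le> p l' (y - a) + p l' (x - a)"
          using p_triangle[of l' y x a] by (simp add: p_minus_commute[of l' a])
        then have "nrm m * p l' (y - x) \<le> nrm m * (p l' (y - a) + p l' (x - a))"
          using mA by (intro mult_left_mono) auto
        moreover have "p l ((r x - z) \<odot> (x \<odot> v)) \<le>
           p l ((r x - r y) \<odot> (x \<odot> v) - (r x - z) \<odot> (x \<odot> v)) + p l ((r x - r y) \<odot> (x \<odot> v))"
          using p_triangle[of l "(r x - z) \<odot> (x \<odot> v)" 0 "(r x - r y) \<odot> (x \<odot> v)"]
          by (simp add: p_minus_commute[of l "(r x - r y) \<odot> (x \<odot> v)"])
        ultimately show ?case using 1[OF elim] by linarith
      qed
      ultimately have 2: "p l ((r x - z) \<odot> (x \<odot> v)) \<le> nrm m * p l' (x - a)"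
        using tendsto_lowerbound[OF _ _ F(1)] by fastforce
      have "x \<odot> v \<odot> r x - a \<odot> v \<odot> z = (r x - z) \<odot> (x \<odot> v) + (x - a) \<odot> (v \<odot> z)"
        using xA vA zA r[OF x] by (simp add: xdiff_mul xmul_assoc mul_diff mul_ac)
      then have "p l (x \<odot> v \<odot> r x - a \<odot> v \<odot> z) \<le> p l ((r x - z) \<odot> (x \<odot> v)) + p l ((x - a) \<odot> (v \<odot> z))"
        by (simp add: p_add)
      also have "p l ((x - a) \<odot> (v \<odot> z)) \<le> nrm (v \<odot> z) * p l' (x - a)" using l' vA zA by simp
      finally show ?thesis using 2 by (simp add: g_def)
    qed
    ultimately show "\<exists>g. (g \<longlongrightarrow> 0) F \<and> eventually (\<lambda>x. p l (x \<odot> v \<odot> r x - a \<odot> v \<odot> z) \<le> g x) F"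
      using F(2) by (intro exI[of _ g]) (auto elim: eventually_mono)
  qed
  \<comment> \<open>The equation defining \<open>r x\<close>; with v = m, \<open>lim\<close> allows
    it to pass to the limit.\<close>
  have "x \<odot> m \<odot> r x = \<one> - r x" if x: "x \<in> P" for x
  proof (rule W_eqI)
    fix \<phi> assume "\<phi> \<in> W"
    then show "\<phi> (x \<odot> m \<odot> r x) = \<phi> (\<one> - r x)"
      using x r mA nz[OF x] by (simp add: W_diff W_mul W_one P_A0 rv) (simp add: field_simps)
  qed (use x r mA P_A0 in auto)
  then have "eventually (\<lambda>x. x \<odot> m \<odot> r x = \<one> - r x) F" using F(2) by (auto elim: eventually_mono)
  from tlim_cong[OF this] lim[OF m] have "tlim (\<lambda>x. \<one> - r x) (a \<odot> m \<odot> z) F" by simp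
  moreover have "tlim (\<lambda>x. \<one> - r x) (\<one> - z) F" by (intro tlim_diff tlim_const z)
  ultimately have "a \<odot> m \<odot> z = \<one> - z" using tlim_unique F(1) by blast
  moreover have "a \<odot> v \<odot> z \<in> U" if "v \<in> P" "\<forall>\<phi>\<in>W. Re (\<phi> v) \<le> Re (\<phi> m)" for v
    by (rule U_closed[OF F(1) _ lim]) (use that F(2) prod_U in \<open>auto elim: eventually_mono\<close>)
  ultimately show ?thesis using zU by blast
qed

text \<open>The resolvents \<open>(1 + \<epsilon>b)\<^sup>-\<^sup>1\<close> are multiples of \<open>(1 + b)\<^sup>-\<^sup>1\<close> and tend to \<open>1\<close> as \<open>\<epsilon>\<close> tends to \<open>0\<close>.\<close>

lemma resolvent_regular:
  assumes b: "b \<in> qP" and z: "z \<in> A0" "b \<odot> z = \<one> - z" and e: "e \<odot> z = 0"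
  shows "e = 0"
proof (rule p_eqI_le)
  fix l and d :: real assume d: "d > 0"
  obtain l' where l': "\<forall>x\<in>A0. \<forall>b. p l (b \<odot> x) \<le> nrm x * p l' b" using T3_ext by blast
  obtain l'' where l'': "\<forall>x\<in>A0. \<forall>b. p l' (b \<odot> x) \<le> nrm x * p l'' b" using T3_ext by blast
  obtain x where x: "x \<in> A0" "p l' (x - e) < d / 2"
    using dense[of "{l'}" "d/2" e] d by auto
  define k where "k = nrm x * p l'' b"
  have k: "k \<ge> 0" using x(1) by (simp add: k_def)
  \<comment> \<open>The scale \<epsilon> of the resolvent (1 + \<epsilon>b)^{-1}, small enough for
    the bound \<open>r * k\<close> on the seminorm of (1 - y)x to stay below d/2.\<close>
  define r where "r = d / (2 * (k + 1))"
  have r: "r > 0" "r * k \<le> d / 2" using d k by (auto simp: r_def field_simps)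
  let ?b = "complex_of_real r \<star> b"
  have "?b \<in> qP" using b r by (intro qP_scale) auto
  from resolvent[OF this P_one] obtain y where y: "y \<in> U" "?b \<odot> y = \<one> - y" by auto
  have yA: "y \<in> A0" using y U_A0 by blast
  \<comment> \<open>This is (1 + b)y, which lies in \<open>A0\<close> because by = (1/r)(1 - y).
    Hence zk = y, and e annihilates y together with z.\<close>
  let ?k = "complex_of_real (1/r) \<star> (\<one> - y) + y"
  have "complex_of_real r \<star> (b \<odot> y) = \<one> - y" using y(2) yA by (simp add: xsmul_mul)
  then have "complex_of_real (1/r) \<star> complex_of_real r \<star> (b \<odot> y) = complex_of_real (1/r) \<star> (\<one> - y)" by simp
  then have by': "b \<odot> y = complex_of_real (1/r) \<star> (\<one> - y)" using r(1) by (simp add: smul_smul)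
  have "(b \<odot> z) \<odot> y = (b \<odot> y) \<odot> z" using z(1) yA by (simp add: xmul_assoc mul_comm)
  then have "(\<one> - z) \<odot> y = (complex_of_real (1/r) \<star> (\<one> - y)) \<odot> z" by (simp only: z(2) by')
  moreover have "z \<odot> ?k = (complex_of_real (1/r) \<star> (\<one> - y)) \<odot> z + z \<odot> y"
    using z(1) yA by (simp add: mul_add smul_mul mul_smul mul_comm[of z "\<one> - y"])
  ultimately have "z \<odot> ?k = (\<one> - z) \<odot> y + z \<odot> y" by simp
  then have zk: "z \<odot> ?k = y" using z(1) yA by (simp add: diff_mul)
  have "e \<odot> y = e \<odot> z \<odot> ?k" using z(1) yA by (simp only: xmul_assoc zk A0_add A0_smul A0_diff A0_one)
  then have "e \<odot> y = 0" using e yA by simp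
  then have ey: "e = e \<odot> (\<one> - y)" using yA by (simp add: xmul_diff)
  have "\<one> - y \<in> U"
    using y(1) by (auto simp: upos_iff P_iff W_diff W_one)
  then have n1: "nrm (\<one> - y) \<le> 1" by (rule U_nrm)
  \<comment> \<open>\<open>e\<close> is only in the completion, so e(1 - y) cannot be estimated by
    smallness of 1 - y. The first summand is small because x is close to e, the second because y is
    close to 1 and x has finite norm.\<close>
  have "e = (e - x) \<odot> (\<one> - y) + (\<one> - y) \<odot> x"
    using ey x(1) yA by (simp add: xdiff_mul mul_comm)
  then have "p l e \<le> p l ((e - x) \<odot> (\<one> - y)) + p l ((\<one> - y) \<odot> x)" by (metis p_add)
  moreover have "p l ((e - x) \<odot> (\<one> - y)) \<le> p l' (e - x)"
  proof -
    have "p l ((e - x) \<odot> (\<one> - y)) \<le> nrm (\<one> - y) * p l' (e - x)" using l' yA by simp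
    also have "\<dots> \<le> p l' (e - x)" using mult_right_mono[OF n1, of "p l' (e - x)"] by simp
    finally show ?thesis .
  qed
  moreover have "p l ((\<one> - y) \<odot> x) \<le> r * k"
  proof -
    have "p l' (\<one> - y) \<le> nrm y * p l'' ?b" unfolding y(2)[symmetric] using l'' yA by simp
    also have "\<dots> \<le> p l'' ?b" using mult_right_mono[OF U_nrm[OF y(1)], of "p l'' ?b"] by simp
    also have "\<dots> = r * p l'' b" using r(1) by (simp add: p_smul)
    finally have "nrm x * p l' (\<one> - y) \<le> nrm x * (r * p l'' b)" using x(1) by (intro mult_left_mono) auto
    moreover have "p l ((\<one> - y) \<odot> x) \<le> nrm x * p l' (\<one> - y)" using l' x(1) by simp
    ultimately show ?thesis by (simp add: k_def mult_ac)
  qed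
  ultimately show "p l (e - 0) \<le> d"
    using x(2) r(2) by (simp add: p_minus_commute[of l' e])
qed

text \<open>\<open>c\<close> enters only through its product with \<open>z\<close>, the part
  accessible to characters. The third condition excludes 0/0 at a character; the last lets
  \<open>z\<close> be cancelled against arbitrary elements of the completion.\<close>

definition rep :: "'a \<Rightarrow> 'a \<Rightarrow> 'a \<Rightarrow> bool" where
  "rep c w z \<longleftrightarrow> w \<in> A0 \<and> z \<in> A0 \<and> c \<odot> z = w \<and> (\<forall>\<phi>\<in>W. \<phi> z = 0 \<longrightarrow> \<phi> w \<noteq> 0) \<and> (\<forall>e. e \<odot> z = 0 \<longrightarrow> e = 0)"

lemma resinv_eq:
  assumes z: "z \<in> A0" "b \<odot> z = \<one> - z"
  shows "resinv A0 \<one> mul b = z"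
  unfolding resinv_def
proof (rule the_equality)
  have 1: "(\<one> + b) \<odot> z = \<one>" using z by (simp add: xadd_mul)
  then show "z \<in> A0 \<and> (\<one> + b) \<odot> z = \<one> \<and> z \<odot> (\<one> + b) = \<one>" using z(1) xmul_comm[OF z(1), of "\<one> + b"] by simp
  fix y assume y: "y \<in> A0 \<and> (\<one> + b) \<odot> y = \<one> \<and> y \<odot> (\<one> + b) = \<one>"
  then have "y = (\<one> + b) \<odot> z \<odot> y" by (simp add: 1)
  also have "\<dots> = (\<one> + b) \<odot> y \<odot> z" using conjunct1[OF y] z(1) by (simp only: xmul_assoc mul_comm[of z y])
  also have "\<dots> = z" using y z(1) by simp
  finally show "y = z" .
qed

text \<open>Two things need work: that axz lies in \<open>A0\<close>, and that numerator and
  denominator have no common zero.\<close>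

lemma rep_triple:
  assumes a: "a \<in> qP" and x: "x \<in> A0" and y: "y \<in> A0"
  defines "z \<equiv> resinv A0 \<one> mul (a \<odot> absv A0 mul invl x)"
  shows "rep (a \<odot> x + y) ((a \<odot> x + y) \<odot> z) z"
proof -
  let ?m = "absv A0 mul invl x"
  have m: "?m \<in> P" "\<And>\<phi>. \<phi> \<in> W \<Longrightarrow> \<phi> ?m = complex_of_real (cmod (\<phi> x))"
    using absv_P[OF x] absv_val[OF x] by auto
  have mA: "?m \<in> A0" using m P_A0 by blast
  obtain z0 where z0: "z0 \<in> U" "a \<odot> ?m \<odot> z0 = \<one> - z0"
    and dom: "\<And>v. \<lbrakk>v \<in> P; \<And>\<phi>. \<phi> \<in> W \<Longrightarrow> Re (\<phi> v) \<le> cmod (\<phi> x)\<rbrakk> \<Longrightarrow> a \<odot> v \<odot> z0 \<in> U"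
    using resolvent[OF a m(1)] m(2) by (metis Re_complex_of_real)
  have zz: "z = z0" unfolding z_def by (rule resinv_eq) (use z0 U_A0 in auto)
  have zA: "z \<in> A0" using z0 U_A0 zz by simp
  \<comment> \<open>The positive and negative parts of the real and imaginary parts of x are each
    dominated by |x|, which is the hypothesis under which \<open>resolvent\<close> keeps avz in
    \<open>A0\<close>.\<close>
  have part: "\<exists>v\<in>P. a \<odot> v \<odot> z \<in> A0 \<and> (\<forall>\<phi>\<in>W. \<phi> v = complex_of_real (f \<phi>))"
    if cf: "continuous_on W f" and "\<And>\<phi>. \<phi> \<in> W \<Longrightarrow> 0 \<le> f \<phi> \<and> f \<phi> \<le> cmod (\<phi> x)" for f
  proof -
    obtain v where v: "v \<in> A0" "\<forall>\<phi>\<in>W. \<phi> v = complex_of_real (f \<phi>)"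
      using W_surj[of "\<lambda>\<phi>. complex_of_real (f \<phi>)"] continuous_on_of_real[OF cf] by blast
    have "Im (\<phi> v) = 0 \<and> 0 \<le> Re (\<phi> v) \<and> Re (\<phi> v) \<le> cmod (\<phi> x)" if "\<phi> \<in> W" for \<phi>
      using bspec[OF v(2) that] \<open>\<And>\<phi>. \<phi> \<in> W \<Longrightarrow> 0 \<le> f \<phi> \<and> f \<phi> \<le> cmod (\<phi> x)\<close>[OF that] by simp
    then have "v \<in> P" "a \<odot> v \<odot> z \<in> U" using dom[of v] v(1) by (auto simp: P_iff zz)
    then show ?thesis using v U_A0 by blast
  qed
  have ab: "0 \<le> max (Re c) 0 \<and> max (Re c) 0 \<le> cmod c" "0 \<le> max (- Re c) 0 \<and> max (- Re c) 0 \<le> cmod c"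
    "0 \<le> max (Im c) 0 \<and> max (Im c) 0 \<le> cmod c" "0 \<le> max (- Im c) 0 \<and> max (- Im c) 0 \<le> cmod c" for c
    using abs_Re_le_cmod[of c] abs_Im_le_cmod[of c] by auto
  have p: "continuous_on W (\<lambda>\<phi>. Re (\<phi> x))" "continuous_on W (\<lambda>\<phi>. Im (\<phi> x))"
    by (intro continuous_intros continuous_on_eval)+
  obtain v1 where v1: "v1 \<in> A0" "a \<odot> v1 \<odot> z \<in> A0" "\<forall>\<phi>\<in>W. \<phi> v1 = complex_of_real (max (Re (\<phi> x)) 0)"
    using part[OF continuous_on_max[OF p(1) continuous_on_const] ab(1)] P_A0 by blast
  obtain v2 where v2: "v2 \<in> A0" "a \<odot> v2 \<odot> z \<in> A0" "\<forall>\<phi>\<in>W. \<phi> v2 = complex_of_real (max (- Re (\<phi> x)) 0)"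
    using part[OF continuous_on_max[OF continuous_on_minus[OF p(1)] continuous_on_const] ab(2)] P_A0 by blast
  obtain v3 where v3: "v3 \<in> A0" "a \<odot> v3 \<odot> z \<in> A0" "\<forall>\<phi>\<in>W. \<phi> v3 = complex_of_real (max (Im (\<phi> x)) 0)"
    using part[OF continuous_on_max[OF p(2) continuous_on_const] ab(3)] P_A0 by blast
  obtain v4 where v4: "v4 \<in> A0" "a \<odot> v4 \<odot> z \<in> A0" "\<forall>\<phi>\<in>W. \<phi> v4 = complex_of_real (max (- Im (\<phi> x)) 0)"
    using part[OF continuous_on_max[OF continuous_on_minus[OF p(2)] continuous_on_const] ab(4)] P_A0 by blast
  have xv: "x = v1 - v2 + \<i> \<star> (v3 - v4)"
  proof (rule W_eqI)
    fix \<phi> assume \<phi>: "\<phi> \<in> W"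
    show "\<phi> x = \<phi> (v1 - v2 + \<i> \<star> (v3 - v4))"
      using \<phi> v1(1) v2(1) v3(1) v4(1) bspec[OF v1(3) \<phi>] bspec[OF v2(3) \<phi>] bspec[OF v3(3) \<phi>] bspec[OF v4(3) \<phi>]
      by (simp add: W_add W_diff W_smul complex_eq_iff max_def)
  qed (use x v1 v2 v3 v4 in auto)
  define g where "g = a \<odot> x \<odot> z"
  have "g = a \<odot> v1 \<odot> z - a \<odot> v2 \<odot> z + \<i> \<star> (a \<odot> v3 \<odot> z - a \<odot> v4 \<odot> z)"
    unfolding g_def by (subst xv) (use v1 v2 v3 v4 zA in \<open>simp add: xmul_add xmul_diff xmul_smul xadd_mul xdiff_mul xsmul_mul\<close>)
  then have gA: "g \<in> A0" using v1 v2 v3 v4 by simp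
  have w: "(a \<odot> x + y) \<odot> z = g + y \<odot> z" using zA by (simp add: xadd_mul g_def)
  \<comment> \<open>Multiplication by u = (1 + a)^{-1} replaces a by 1 - u, giving gu = (1 - u)xz
    and (1 - z)u = (1 - u)|x|z, both within \<open>A0\<close>.\<close>
  obtain u where u: "u \<in> U" "a \<odot> u = \<one> - u" using resolvent[OF a P_one] by auto
  have uA: "u \<in> A0" using u U_A0 by blast
  have "g \<odot> u = a \<odot> u \<odot> (x \<odot> z)" unfolding g_def using x zA uA by (simp add: xmul_assoc mul_ac)
  then have gu: "g \<odot> u = (\<one> - u) \<odot> (x \<odot> z)" by (simp add: u)
  have "a \<odot> ?m \<odot> z \<odot> u = a \<odot> u \<odot> (?m \<odot> z)" using mA zA uA by (simp add: xmul_assoc mul_ac)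
  then have zu: "(\<one> - z) \<odot> u = (\<one> - u) \<odot> (?m \<odot> z)" by (simp add: u z0 zz)
  \<comment> \<open>D = 0 expresses |axz| = 1 - z. It is checked on characters after multiplying by
    u twice, and u is then cancelled. At a zero of z it leaves \<phi>(g) of modulus 1.\<close>
  define D where "D = invl g \<odot> g - (\<one> - z) \<odot> (\<one> - z)"
  have DA: "D \<in> A0" using gA zA by (simp add: D_def)
  have "D \<odot> u \<odot> u = 0"
  proof (rule W_eqI)
    fix \<phi> assume \<phi>: "\<phi> \<in> W"
    obtain s where s: "\<phi> u = complex_of_real s" using P_val_of_real[OF U_P[OF u(1)] \<phi>] by blast
    obtain t where t: "\<phi> z = complex_of_real t" using P_val_of_real[OF U_P[OF z0(1)] \<phi>] zz by blast
    have G: "\<phi> g * s = (1 - s) * (\<phi> x * t)"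
      using arg_cong[OF gu, of \<phi>] \<phi> gA uA zA x by (simp add: W_mul W_diff W_one s t)
    have Z: "(1 - t) * s = (1 - s) * (cmod (\<phi> x) * t)"
      using arg_cong[OF zu, of \<phi>] \<phi> uA zA mA
      by (simp add: W_mul W_diff W_one s t m(2)) (metis (no_types) of_real_1 of_real_diff of_real_eq_iff of_real_mult)
    have "cnj (\<phi> g) * \<phi> g * s * s = cnj (\<phi> g * s) * (\<phi> g * s)" by simp
    also have "\<dots> = complex_of_real ((1 - s) * t * ((1 - s) * t)) * (\<phi> x * cnj (\<phi> x))" unfolding G by simp
    also have "\<phi> x * cnj (\<phi> x) = complex_of_real (cmod (\<phi> x) * cmod (\<phi> x))"
      using complex_norm_square[of "\<phi> x"] by (simp add: power2_eq_square)
    also have "complex_of_real ((1 - s) * t * ((1 - s) * t)) * complex_of_real (cmod (\<phi> x) * cmod (\<phi> x))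
        = complex_of_real (((1 - s) * (cmod (\<phi> x) * t)) * ((1 - s) * (cmod (\<phi> x) * t)))"
      by (simp only: of_real_mult mult_ac)
    also have "\<dots> = complex_of_real ((1 - t) * s * ((1 - t) * s))" by (simp only: Z)
    finally have "(cnj (\<phi> g) * \<phi> g - (1 - complex_of_real t) * (1 - complex_of_real t)) * s * s = 0"
      by (simp add: algebra_simps)
    then show "\<phi> (D \<odot> u \<odot> u) = \<phi> 0"
      using \<phi> gA zA uA by (simp add: D_def W_mul W_diff W_one W_zero W_invl s t)
  qed (use DA uA in auto)
  then have "D \<odot> u = 0" "D = 0"
    using resolvent_regular[OF a uA u(2)] by blast+
  have "\<phi> ((a \<odot> x + y) \<odot> z) \<noteq> 0" if \<phi>: "\<phi> \<in> W" "\<phi> z = 0" for \<phi>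
  proof -
    have "\<phi> D = 0" using \<open>D = 0\<close> \<phi> W_zero by simp
    then have "\<phi> g \<noteq> 0" using \<phi> gA zA by (auto simp: D_def W_diff W_mul W_one W_invl)
    then show ?thesis unfolding w using \<phi> gA y zA by (simp add: W_add W_mul)
  qed
  moreover have "a \<odot> ?m \<in> qP" using qP_mul[OF a m(1)] .
  ultimately show ?thesis
    unfolding rep_def using gA y zA w resolvent_regular[of "a \<odot> ?m" z] z0(2) zz by auto
qed

text \<open>From ws = (cs)z: if \<phi>(z) were 0 then \<phi>(w) would be 0 too, a common zero. The
  test element s may vary with \<phi> and need not itself be cancellable, so it can be fitted to
  each identity.\<close>

lemma rep_eval:
  assumes r: "rep c w z" and s: "s \<in> A0" "c \<odot> s \<in> A0" and \<phi>: "\<phi> \<in> W" "\<phi> s \<noteq> 0"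
  shows "\<phi> z \<noteq> 0" "\<phi> w / \<phi> z = \<phi> (c \<odot> s) / \<phi> s"
proof -
  have A: "w \<in> A0" "z \<in> A0" "c \<odot> z = w" using r by (auto simp: rep_def)
  have "w \<odot> s = c \<odot> s \<odot> z" unfolding A(3)[symmetric] using A(2) s(1) by (simp only: xmul_assoc mul_comm[of z s])
  from arg_cong[OF this, of \<phi>] have e: "\<phi> w * \<phi> s = \<phi> (c \<odot> s) * \<phi> z" using A s \<phi> by (simp add: W_mul)
  then show "\<phi> z \<noteq> 0" using r \<phi> by (auto simp: rep_def)
  then show "\<phi> w / \<phi> z = \<phi> (c \<odot> s) / \<phi> s" using e \<phi> by (simp add: field_simps)
qed

section \<open>Extended Gelfand transforms\<close>

definition quot :: "'a \<Rightarrow> 'a \<Rightarrow> ('a \<Rightarrow> complex) \<Rightarrow> complex option" where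
  "quot w z = (\<lambda>\<phi>. if \<phi> \<in> W then (if \<phi> z \<noteq> 0 then Some (\<phi> w / \<phi> z) else None) else Some 0)"

lemma quot_unique: assumes "rep c w z" "rep c w' z'" shows "quot w z = quot w' z'"
proof
  fix \<phi>
  have A: "c \<odot> z = w" "c \<odot> z' = w'" "z \<in> A0" "z' \<in> A0" "w \<in> A0" "w' \<in> A0" using assms by (auto simp: rep_def)
  have "\<phi> z \<noteq> 0 \<and> \<phi> w / \<phi> z = \<phi> w' / \<phi> z'" if "\<phi> \<in> W" "\<phi> z' \<noteq> 0"
    using rep_eval[OF assms(1) A(4) _ that] by (simp add: A(2,6))
  moreover have "\<phi> z' \<noteq> 0" if "\<phi> \<in> W" "\<phi> z \<noteq> 0"
    using rep_eval(1)[OF assms(2) A(3) _ that] by (simp add: A(1,5))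
  ultimately show "quot w z \<phi> = quot w' z' \<phi>" by (simp add: quot_def) metis
qed

lemma tendsto_eval: "((\<lambda>\<psi>::'a \<Rightarrow> complex. \<psi> x) \<longlongrightarrow> \<phi> x) (at \<phi> within S)"
  using continuous_on_eval[of UNIV x] by (auto simp: continuous_on_def intro: tendsto_within_subset)

lemma quot_cont:
  assumes nz: "\<And>\<phi>. \<lbrakk>\<phi> \<in> W; \<phi> z = 0\<rbrakk> \<Longrightarrow> \<phi> w \<noteq> 0"
  shows "cont_star W (quot w z)"
  unfolding cont_star_def
proof
  fix \<phi> assume \<phi>: "\<phi> \<in> W"
  have inW: "eventually (\<lambda>\<psi>. \<psi> \<in> W) (at \<phi> within W)" by (simp add: eventually_at_topological) auto
  show "case quot w z \<phi> of
      None \<Rightarrow> \<forall>M. eventually (\<lambda>v. case quot w z v of None \<Rightarrow> True | Some c \<Rightarrow> M < cmod c) (at \<phi> within W)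
    | Some c \<Rightarrow> eventually (\<lambda>v. quot w z v \<noteq> None) (at \<phi> within W)
        \<and> ((\<lambda>v. the (quot w z v)) \<longlongrightarrow> c) (at \<phi> within W)"
  proof (cases "\<phi> z = 0")
    case True
    have "eventually (\<lambda>\<psi>. case quot w z \<psi> of None \<Rightarrow> True | Some c \<Rightarrow> M < cmod c) (at \<phi> within W)" for M
    proof -
      \<comment> \<open>Near a pole the numerator keeps modulus above d, while the denominator drops
        below d / (|M| + 1), so the quotient exceeds M.\<close>
      define d where "d = cmod (\<phi> w) / 2"
      have d: "d > 0" using nz[OF \<phi> True] by (simp add: d_def)
      define e where "e = d / (\<bar>M\<bar> + 1)"
      have e: "e > 0" using d by (simp add: e_def add_nonneg_pos)
      have "eventually (\<lambda>\<psi>. dist (\<psi> w) (\<phi> w) < d) (at \<phi> within W)" "eventually (\<lambda>\<psi>. dist (\<psi> z) (\<phi> z) < e) (at \<phi> within W)"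
        using tendstoD[OF tendsto_eval d] tendstoD[OF tendsto_eval e] by blast+
      then show ?thesis using inW
      proof eventually_elim
        case (elim \<psi>)
        have "cmod (\<phi> w) \<le> cmod (\<psi> w) + dist (\<psi> w) (\<phi> w)"
          using norm_triangle_sub[of "\<phi> w" "\<psi> w"] by (simp add: dist_norm norm_minus_commute)
        then have w: "cmod (\<psi> w) > d" using elim(1) by (simp add: d_def)
        have z: "cmod (\<psi> z) < e" using elim(2) True by simp
        have "M < cmod (\<psi> w / \<psi> z)" if "\<psi> z \<noteq> 0"
        proof -
          have "M * cmod (\<psi> z) \<le> (\<bar>M\<bar> + 1) * cmod (\<psi> z)" by (intro mult_right_mono) auto
          also have "\<dots> \<le> (\<bar>M\<bar> + 1) * e" using z by (intro mult_left_mono) auto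
          also have "\<dots> = d" by (simp add: e_def)
          finally have "M * cmod (\<psi> z) < cmod (\<psi> w)" using w by simp
          then show ?thesis using that by (simp add: norm_divide pos_less_divide_eq)
        qed
        then show ?case using elim(3) by (simp add: quot_def)
      qed
    qed
    then show ?thesis using True \<phi> by (simp add: quot_def)
  next
    case False
    have "eventually (\<lambda>\<psi>. \<psi> z \<noteq> 0) (at \<phi> within W)"
      by (rule tendsto_imp_eventually_ne[OF tendsto_eval[of z \<phi>] False])
    then have ev: "eventually (\<lambda>\<psi>. quot w z \<psi> = Some (\<psi> w / \<psi> z)) (at \<phi> within W)"
      using inW by eventually_elim (simp add: quot_def)
    have "((\<lambda>\<psi>. \<psi> w / \<psi> z) \<longlongrightarrow> \<phi> w / \<phi> z) (at \<phi> within W)"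
      by (intro tendsto_divide tendsto_eval False)
    then have "((\<lambda>v. the (quot w z v)) \<longlongrightarrow> \<phi> w / \<phi> z) (at \<phi> within W)"
      by (rule Lim_transform_eventually) (use ev in \<open>auto elim: eventually_mono\<close>)
    moreover have "eventually (\<lambda>v. quot w z v \<noteq> None) (at \<phi> within W)" using ev by (auto elim: eventually_mono)
    ultimately show ?thesis using False \<phi> by (simp add: quot_def)
  qed
qed

section \<open>The transform on the elements ax + y\<close>

abbreviation Aq :: "'a set" where "Aq \<equiv> A \<inter> qP"
abbreviation \<Phi> :: "'a \<Rightarrow> ('a \<Rightarrow> complex) \<Rightarrow> complex option" where "\<Phi> \<equiv> Phi smul A0 \<one> mul invl Aq"
abbreviation MM :: "'a set" where "MM \<equiv> Mset A0 mul Aq"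

lemma A_closed: "A0 \<subseteq> A" "\<lbrakk>a \<in> A; b \<in> A\<rbrakk> \<Longrightarrow> a + b \<in> A" "a \<in> A \<Longrightarrow> c \<star> a \<in> A"
  using lcqca by (auto simp: lcqca_def)

lemma Aq_add: "\<lbrakk>a \<in> Aq; b \<in> Aq\<rbrakk> \<Longrightarrow> a + b \<in> Aq"
  and Aq_scale: "\<lbrakk>a \<in> Aq; 0 \<le> r\<rbrakk> \<Longrightarrow> complex_of_real r \<star> a \<in> Aq"
  and Aq_zero: "0 \<in> Aq"
  using A_closed P_qP by (auto simp: qP_add qP_scale)

lemma MM_I: "\<lbrakk>a \<in> Aq; x \<in> A0; y \<in> A0\<rbrakk> \<Longrightarrow> a \<odot> x + y \<in> MM"
  by (auto simp: Mset_def)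

lemma Aq_mul_MM: "\<lbrakk>a \<in> Aq; x \<in> A0\<rbrakk> \<Longrightarrow> a \<odot> x \<in> MM"
  using MM_I[of a x 0] by simp

lemma Aq_MM: "a \<in> Aq \<Longrightarrow> a \<in> MM"
  using Aq_mul_MM[of a \<one>] by simp

lemma A0_MM: "x \<in> A0 \<Longrightarrow> x \<in> MM"
  using MM_I[of 0 0 x] Aq_zero by simp

text \<open>\<open>Phi\<close> picks some representation ax + y of \<open>c\<close>; whichever it
  is, \<open>rep_triple\<close> turns it into a fraction, and \<open>quot_unique\<close> then
  removes the dependence on the choice.\<close>

lemma Phi_rep: assumes c: "c \<in> MM" obtains w z where "rep c w z" "\<Phi> c = quot w z"
proof -
  define R where "R = (\<lambda>r. fst r \<in> Aq \<and> fst (snd r) \<in> A0 \<and> snd (snd r) \<in> A0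
                        \<and> c = fst r \<odot> fst (snd r) + snd (snd r))"
  define r where "r = Eps R"
  obtain a x y where "a \<in> Aq" "x \<in> A0" "y \<in> A0" "c = a \<odot> x + y" using c by (auto simp: Mset_def)
  then have "R (a, x, y)" by (simp add: R_def)
  then have "R r" unfolding r_def by (rule someI)
  then have r: "fst r \<in> Aq" "fst (snd r) \<in> A0" "snd (snd r) \<in> A0" "c = fst r \<odot> fst (snd r) + snd (snd r)"
    by (simp_all add: R_def)
  define z where "z = resinv A0 \<one> mul (fst r \<odot> absv A0 mul invl (fst (snd r)))"
  have "rep c (c \<odot> z) z"
    unfolding z_def using rep_triple[of "fst r" "fst (snd r)" "snd (snd r)"] r by simp
  moreover have "\<Phi> c = quot (c \<odot> z) z"
    unfolding Phi_def quot_def Let_def R_def[symmetric] r_def[symmetric] phi'_def z_def[symmetric]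
    unfolding r(4)[symmetric] by simp
  ultimately show thesis using that by blast
qed

lemma Phi_eq: "\<lbrakk>c \<in> MM; rep c w z\<rbrakk> \<Longrightarrow> \<Phi> c = quot w z"
  using Phi_rep quot_unique by metis

lemma Phi_cont: assumes "c \<in> MM" shows "cont_star W (\<Phi> c)"
proof -
  obtain w z where r: "rep c w z" and e: "\<Phi> c = quot w z" using Phi_rep[OF assms] .
  show ?thesis unfolding e by (rule quot_cont) (use r in \<open>auto simp: rep_def\<close>)
qed

lemma Phi_ext: "ext_fun W (\<Phi> c)"
  by (simp add: ext_fun_def Phi_def)

lemma Phi_eval:
  assumes "c \<in> MM" "s \<in> A0" "c \<odot> s \<in> A0" "\<phi> \<in> W" "\<phi> s \<noteq> 0"
  shows "\<Phi> c \<phi> = Some (\<phi> (c \<odot> s) / \<phi> s)"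
proof -
  obtain w z where r: "rep c w z" and e: "\<Phi> c = quot w z" using Phi_rep[OF assms(1)] .
  show ?thesis unfolding e using rep_eval[OF r assms(2-)] assms(4) by (simp add: quot_def)
qed

lemma Phi_A0: assumes "x \<in> A0" shows "\<Phi> x = fin_fun W (\<lambda>\<phi>. \<phi> x)"
proof
  fix \<phi>
  show "\<Phi> x \<phi> = fin_fun W (\<lambda>\<phi>. \<phi> x) \<phi>"
    using Phi_eval[OF A0_MM[OF assms] A0_one, of \<phi>] Phi_ext[of x] assms
    by (cases "\<phi> \<in> W") (auto simp: fin_fun_def W_one ext_fun_def)
qed

lemma Phi_A0_val: "\<lbrakk>x \<in> A0; \<phi> \<in> W\<rbrakk> \<Longrightarrow> \<Phi> x \<phi> = Some (\<phi> x)"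
  by (simp add: Phi_A0 fin_fun_def)

text \<open>Here (1 + a)^{-1} serves as denominator. The explicit form (1 - u) / u with values of u
  in [0, 1] makes the poles and the sign of the transform visible.\<close>

lemma Phi_Aq:
  assumes a: "a \<in> Aq"
  obtains u where "u \<in> U" "a \<odot> u = \<one> - u" "\<forall>e. e \<odot> u = 0 \<longrightarrow> e = 0"
    "\<forall>\<phi>\<in>W. \<Phi> a \<phi> = (if \<phi> u \<noteq> 0 then Some ((1 - \<phi> u) / \<phi> u) else None)"
proof -
  obtain u where u: "u \<in> U" "a \<odot> u = \<one> - u" using resolvent[of a \<one>] a by auto
  have uA: "u \<in> A0" using u U_A0 by blast
  have reg: "e = 0" if "e \<odot> u = 0" for e using resolvent_regular[of a u e] a u uA that by blast
  have "rep a (\<one> - u) u"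
    using u uA reg by (auto simp: rep_def W_diff W_one)
  then have "\<Phi> a = quot (\<one> - u) u" using Phi_eq Aq_MM[OF a] by blast
  then have "\<Phi> a \<phi> = (if \<phi> u \<noteq> 0 then Some ((1 - \<phi> u) / \<phi> u) else None)" if "\<phi> \<in> W" for \<phi>
    using that uA by (simp add: quot_def W_diff W_one)
  with u reg show thesis by (intro that[of u]) auto
qed

lemma agreesI:
  assumes "c \<in> MM" "\<And>\<phi>. \<lbrakk>\<phi> \<in> W; D \<phi>\<rbrakk> \<Longrightarrow> \<exists>s\<in>A0. c \<odot> s \<in> A0 \<and> \<phi> s \<noteq> 0 \<and> \<phi> (c \<odot> s) = e \<phi> * \<phi> s"
  shows "agrees W D e (\<Phi> c)"
  unfolding agrees_def
proof (intro conjI ballI impI)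
  show "cont_star W (\<Phi> c)" "ext_fun W (\<Phi> c)" using Phi_cont[OF assms(1)] Phi_ext by auto
  fix \<phi> assume \<phi>: "\<phi> \<in> W" "D \<phi>"
  then obtain s where "s \<in> A0" "c \<odot> s \<in> A0" "\<phi> s \<noteq> 0" "\<phi> (c \<odot> s) = e \<phi> * \<phi> s" using assms(2) by blast
  then show "\<Phi> c \<phi> = Some (e \<phi>)" using Phi_eval[OF assms(1), of s \<phi>] \<phi> by simp
qed

lemma Phi_mul_add:
  assumes a: "a \<in> Aq" and x: "x \<in> A0" and y: "y \<in> A0"
  shows "agrees W (\<lambda>w. \<Phi> a w \<noteq> None) (\<lambda>w. the (\<Phi> a w) * w x + w y) (\<Phi> (a \<odot> x + y))"
proof (rule agreesI)
  show "a \<odot> x + y \<in> MM" by (rule MM_I[OF a x y])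
  obtain u where u: "u \<in> U" "a \<odot> u = \<one> - u" "\<forall>e. e \<odot> u = 0 \<longrightarrow> e = 0"
    "\<forall>\<phi>\<in>W. \<Phi> a \<phi> = (if \<phi> u \<noteq> 0 then Some ((1 - \<phi> u) / \<phi> u) else None)" using Phi_Aq[OF a] .
  have uA: "u \<in> A0" using u U_A0 by blast
  fix \<phi> assume \<phi>: "\<phi> \<in> W" "\<Phi> a \<phi> \<noteq> None"
  then have nz: "\<phi> u \<noteq> 0" using bspec[OF u(4) \<phi>(1)] by auto
  \<comment> \<open>The test element is u = (1 + a)^{-1}, which vanishes only at poles of the
    transform of a.\<close>
  have "(a \<odot> x + y) \<odot> u = a \<odot> u \<odot> x + y \<odot> u" using x y uA by (simp add: xadd_mul xmul_assoc mul_comm)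
  then have "(a \<odot> x + y) \<odot> u = (\<one> - u) \<odot> x + y \<odot> u" by (simp add: u(2))
  then show "\<exists>s\<in>A0. (a \<odot> x + y) \<odot> s \<in> A0 \<and> \<phi> s \<noteq> 0 \<and>
      \<phi> ((a \<odot> x + y) \<odot> s) = (the (\<Phi> a \<phi>) * \<phi> x + \<phi> y) * \<phi> s"
    using nz uA x y \<phi>(1) bspec[OF u(4) \<phi>(1)]
    by (intro bexI[OF _ uA]) (simp add: W_add W_mul W_diff W_one field_simps)
qed

text \<open>The common denominator uv of the fractions for a and b serves as test element wherever
  both transforms are finite.\<close>

lemma Phi_sum_mul:
  assumes a: "a \<in> Aq" and b: "b \<in> Aq" and x: "x \<in> A0"
  shows "agrees W (\<lambda>w. \<Phi> a w \<noteq> None \<and> \<Phi> b w \<noteq> None)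
    (\<lambda>w. (the (\<Phi> a w) + the (\<Phi> b w)) * w x) (\<Phi> ((a + b) \<odot> x))"
proof (rule agreesI)
  show "(a + b) \<odot> x \<in> MM" by (rule Aq_mul_MM[OF Aq_add[OF a b] x])
  obtain u where u: "u \<in> U" "a \<odot> u = \<one> - u" "\<forall>e. e \<odot> u = 0 \<longrightarrow> e = 0"
    "\<forall>\<phi>\<in>W. \<Phi> a \<phi> = (if \<phi> u \<noteq> 0 then Some ((1 - \<phi> u) / \<phi> u) else None)" using Phi_Aq[OF a] .
  obtain v where v: "v \<in> U" "b \<odot> v = \<one> - v" "\<forall>e. e \<odot> v = 0 \<longrightarrow> e = 0"
    "\<forall>\<phi>\<in>W. \<Phi> b \<phi> = (if \<phi> v \<noteq> 0 then Some ((1 - \<phi> v) / \<phi> v) else None)" using Phi_Aq[OF b] .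
  have A: "u \<in> A0" "v \<in> A0" using u v U_A0 by auto
  fix \<phi> assume \<phi>: "\<phi> \<in> W" "\<Phi> a \<phi> \<noteq> None \<and> \<Phi> b \<phi> \<noteq> None"
  then have nz: "\<phi> u \<noteq> 0" "\<phi> v \<noteq> 0" using bspec[OF u(4) \<phi>(1)] bspec[OF v(4) \<phi>(1)] by auto
  have "(a + b) \<odot> x \<odot> (u \<odot> v) = a \<odot> (x \<odot> (u \<odot> v)) + b \<odot> (x \<odot> (u \<odot> v))"
    using x A by (simp add: xadd_mul xmul_assoc)
  also have "x \<odot> (u \<odot> v) = u \<odot> (v \<odot> x)" using x A by (simp add: mul_ac)
  also have "b \<odot> (u \<odot> (v \<odot> x)) = b \<odot> (v \<odot> (u \<odot> x))" using x A by (simp add: mul_ac)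
  finally have "(a + b) \<odot> x \<odot> (u \<odot> v) = (\<one> - u) \<odot> (v \<odot> x) + (\<one> - v) \<odot> (u \<odot> x)"
    using x A by (simp flip: u(2) v(2) xmul_assoc)
  then show "\<exists>s\<in>A0. (a + b) \<odot> x \<odot> s \<in> A0 \<and> \<phi> s \<noteq> 0 \<and>
      \<phi> ((a + b) \<odot> x \<odot> s) = (the (\<Phi> a \<phi>) + the (\<Phi> b \<phi>)) * \<phi> x * \<phi> s"
    using nz A x \<phi>(1) bspec[OF u(4) \<phi>(1)] bspec[OF v(4) \<phi>(1)]
    by (intro bexI[of _ "u \<odot> v"]) (simp_all add: W_add W_mul W_diff W_one field_simps)
qed

lemma agrees_cong:
  "\<lbrakk>agrees W D e h; \<And>\<phi>. \<lbrakk>\<phi> \<in> W; D \<phi>\<rbrakk> \<Longrightarrow> e \<phi> = e' \<phi>\<rbrakk> \<Longrightarrow> agrees W D e' h"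
  by (auto simp: agrees_def)

lemma Phi_nowhere_dense: assumes a: "a \<in> Aq" shows "nowhere_dense_in W {w\<in>W. \<Phi> a w = None}"
proof -
  obtain u where u: "u \<in> U" "a \<odot> u = \<one> - u" "\<forall>e. e \<odot> u = 0 \<longrightarrow> e = 0"
    "\<forall>\<phi>\<in>W. \<Phi> a \<phi> = (if \<phi> u \<noteq> 0 then Some ((1 - \<phi> u) / \<phi> u) else None)" using Phi_Aq[OF a] .
  have "{w\<in>W. \<Phi> a w = None} = {w\<in>W. w u = 0}" using u(4) by (auto split: if_splits)
  then show ?thesis using nowhere_dense_zeros[of u] u U_A0 by simp
qed

lemma Phi_pos: assumes a: "a \<in> Aq" shows "\<Phi> a \<in> pos_cfuns W"
proof -
  obtain u where u: "u \<in> U" "a \<odot> u = \<one> - u" "\<forall>e. e \<odot> u = 0 \<longrightarrow> e = 0"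
    "\<forall>\<phi>\<in>W. \<Phi> a \<phi> = (if \<phi> u \<noteq> 0 then Some ((1 - \<phi> u) / \<phi> u) else None)" using Phi_Aq[OF a] .
  have "case \<Phi> a \<phi> of None \<Rightarrow> True | Some c \<Rightarrow> Im c = 0 \<and> 0 \<le> Re c" if \<phi>: "\<phi> \<in> W" for \<phi>
  proof -
    obtain t where t: "t \<ge> 0" "\<phi> u = complex_of_real t" using P_val_of_real[OF U_P[OF u(1)] \<phi>] by blast
    moreover have "t \<le> 1" using u(1) \<phi> t by (force simp: upos_iff)
    moreover have "(1 - \<phi> u) / \<phi> u = complex_of_real ((1 - t) / t)" using t by simp
    ultimately show ?thesis unfolding bspec[OF u(4) \<phi>] by (simp only: split: if_split option.split) simp
  qed
  then show ?thesis using Phi_cont[OF Aq_MM[OF a]] Phi_nowhere_dense[OF a] by (simp add: pos_cfuns_def)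
qed

lemma Phi_add: "\<lbrakk>a \<in> Aq; b \<in> Aq\<rbrakk> \<Longrightarrow> agrees W (\<lambda>w. \<Phi> a w \<noteq> None \<and> \<Phi> b w \<noteq> None)
    (\<lambda>w. the (\<Phi> a w) + the (\<Phi> b w)) (\<Phi> (a + b))"
  using Phi_sum_mul[of a b \<one>] by (simp add: W_one agrees_def)

lemma Phi_mul: "\<lbrakk>a \<in> Aq; x \<in> A0\<rbrakk> \<Longrightarrow> agrees W (\<lambda>w. \<Phi> a w \<noteq> None) (\<lambda>w. the (\<Phi> a w) * w x) (\<Phi> (a \<odot> x))"
  using Phi_mul_add[of a x 0] by (simp add: W_zero agrees_def)

text \<open>Moving the scalar onto x leaves a in \<open>Aq\<close>, so this reduces to
  \<open>Phi_mul\<close>, for complex scalars as well.\<close>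

lemma Phi_scale_mul: assumes "a \<in> Aq" "x \<in> A0"
  shows "agrees W (\<lambda>w. \<Phi> a w \<noteq> None) (\<lambda>w. c * the (\<Phi> a w) * w x) (\<Phi> ((c \<star> a) \<odot> x))"
proof -
  have "(c \<star> a) \<odot> x = a \<odot> (c \<star> x)" using assms by (simp add: xsmul_mul xmul_smul)
  moreover have "agrees W (\<lambda>w. \<Phi> a w \<noteq> None) (\<lambda>w. c * the (\<Phi> a w) * w x) (\<Phi> (a \<odot> (c \<star> x)))"
    by (rule agrees_cong[OF Phi_mul]) (use assms in \<open>auto simp: W_smul\<close>)
  ultimately show ?thesis by simp
qed

lemma Phi_scale: "a \<in> Aq \<Longrightarrow> agrees W (\<lambda>w. \<Phi> a w \<noteq> None) (\<lambda>w. c * the (\<Phi> a w)) (\<Phi> (c \<star> a))"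
  using Phi_scale_mul[of a \<one> c] by (simp add: W_one agrees_def)

section \<open>The wedge, injectivity, the range and the isometry\<close>

lemma Phi_wedge: "wedge W (\<Phi> ` Aq)"
  unfolding wedge_def
proof (intro conjI ballI allI impI)
  show "\<Phi> ` Aq \<subseteq> pos_cfuns W" using Phi_pos by blast
next
  fix f g assume "f \<in> \<Phi> ` Aq" "g \<in> \<Phi> ` Aq"
  then obtain a b where "a \<in> Aq" "b \<in> Aq" "f = \<Phi> a" "g = \<Phi> b" by blast
  then show "\<exists>h\<in>\<Phi> ` Aq. \<forall>w\<in>W. f w \<noteq> None \<and> g w \<noteq> None \<longrightarrow> h w = Some (the (f w) + the (g w))"
    using Phi_add[of a b] Aq_add[of a b] unfolding agrees_def by (intro bexI[of _ "\<Phi> (a + b)"]) auto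
next
  fix f and r :: real assume "f \<in> \<Phi> ` Aq" "0 \<le> r"
  then obtain a where "a \<in> Aq" "f = \<Phi> a" by blast
  then show "\<exists>h\<in>\<Phi> ` Aq. \<forall>w\<in>W. f w \<noteq> None \<longrightarrow> h w = Some (complex_of_real r * the (f w))"
    using Phi_scale[of a "complex_of_real r"] Aq_scale[of a r] \<open>0 \<le> r\<close> unfolding agrees_def
    by (intro bexI[of _ "\<Phi> (complex_of_real r \<star> a)"]) auto
qed

text \<open>Equal quotients give wz' = w'z on characters, poles included since then z and z' both
  vanish. Hence (c - d)zz' = 0, and the two denominators are cancelled in the completion.\<close>

lemma Phi_inj: "inj_on \<Phi> MM"
proof (rule inj_onI)
  fix c d assume cd: "c \<in> MM" "d \<in> MM" "\<Phi> c = \<Phi> d"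
  obtain w z where r: "rep c w z" and e: "\<Phi> c = quot w z" using Phi_rep[OF cd(1)] .
  obtain w' z' where r': "rep d w' z'" and e': "\<Phi> d = quot w' z'" using Phi_rep[OF cd(2)] .
  have A: "w \<in> A0" "z \<in> A0" "w' \<in> A0" "z' \<in> A0" "c \<odot> z = w" "d \<odot> z' = w'" using r r' by (auto simp: rep_def)
  have "w \<odot> z' = w' \<odot> z"
  proof (rule W_eqI)
    fix \<phi> assume \<phi>: "\<phi> \<in> W"
    have "quot w z \<phi> = quot w' z' \<phi>" using e e' cd(3) by simp
    then show "\<phi> (w \<odot> z') = \<phi> (w' \<odot> z)"
      using A \<phi> by (auto simp: quot_def W_mul field_simps split: if_splits)
  qed (use A in auto)
  moreover have "d \<odot> z \<odot> z' = d \<odot> z' \<odot> z" using A(2,4) by (simp only: xmul_assoc mul_comm[of z z'])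
  ultimately have "(c - d) \<odot> z \<odot> z' = 0" using A by (simp add: xdiff_mul)
  then have "(c - d) \<odot> z = 0" using r' by (auto simp: rep_def)
  then have "c - d = 0" using r by (auto simp: rep_def)
  then show "c = d" by simp
qed

lemma Phi_range: "\<Phi> ` MM = Ffun W (\<Phi> ` Aq)"
proof (intro equalityI subsetI)
  fix k assume "k \<in> \<Phi> ` MM"
  then obtain a x y where c: "a \<in> Aq" "x \<in> A0" "y \<in> A0" "k = \<Phi> (a \<odot> x + y)" by (auto simp: Mset_def)
  have "\<forall>w\<in>W. \<Phi> a w \<noteq> None \<longrightarrow> k w = Some (the (\<Phi> a w) * w x + w y)"
    using Phi_mul_add[OF c(1-3)] by (simp add: agrees_def c(4))
  moreover have "cont_star W k" "ext_fun W k" using Phi_cont[OF MM_I[OF c(1-3)]] Phi_ext c(4) by auto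
  ultimately show "k \<in> Ffun W (\<Phi> ` Aq)"
    unfolding Ffun_def using c(1) continuous_on_eval[of W x] continuous_on_eval[of W y] by blast
next
  fix k assume "k \<in> Ffun W (\<Phi> ` Aq)"
  then obtain a g h where a: "a \<in> Aq" and k: "cont_star W k" "ext_fun W k" and g: "continuous_on W g" "continuous_on W h"
    and kv: "\<forall>w\<in>W. \<Phi> a w \<noteq> None \<longrightarrow> k w = Some (the (\<Phi> a w) * g w + h w)"
    unfolding Ffun_def by blast
  obtain x where x: "x \<in> A0" "\<forall>\<phi>\<in>W. \<phi> x = g \<phi>" using W_surj[OF g(1)] by blast
  obtain y where y: "y \<in> A0" "\<forall>\<phi>\<in>W. \<phi> y = h \<phi>" using W_surj[OF g(2)] by blast
  let ?c = "a \<odot> x + y"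
  have c: "?c \<in> MM" by (rule MM_I[OF a x(1) y(1)])
  have "k = \<Phi> ?c"
  proof
    fix \<phi>
    show "k \<phi> = \<Phi> ?c \<phi>"
    proof (cases "\<phi> \<in> W")
      case True
      show ?thesis
      \<comment> \<open>A member of \<open>Ffun\<close> is prescribed only off the poles of the
        transform of a; continuity determines it at the poles, which form a nowhere dense
        set.\<close>
      proof (rule cont_star_eqI[OF k(1) Phi_cont[OF c] Phi_nowhere_dense[OF a] _ True])
        fix w assume w: "w \<in> W" "w \<notin> {w\<in>W. \<Phi> a w = None}"
        then show "k w = \<Phi> ?c w"
          using Phi_mul_add[OF a x(1) y(1)] bspec[OF x(2) w(1)] bspec[OF y(2) w(1)] bspec[OF kv w(1)]
          by (auto simp: agrees_def)
      qed
    next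
      case False
      then show ?thesis using k(2) Phi_ext[of ?c] by (simp add: ext_fun_def)
    qed
  qed
  then show "k \<in> \<Phi> ` MM" using c by blast
qed

lemma Phi_A0_range: "\<Phi> ` A0 = Cfun W"
proof (intro equalityI subsetI)
  fix k assume "k \<in> \<Phi> ` A0"
  then show "k \<in> Cfun W" using Phi_A0 continuous_on_eval by (auto simp: Cfun_def)
next
  fix k assume "k \<in> Cfun W"
  then obtain g where g: "continuous_on W g" "k = fin_fun W g" by (auto simp: Cfun_def)
  obtain x where x: "x \<in> A0" "\<forall>\<phi>\<in>W. \<phi> x = g \<phi>" using W_surj[OF g(1)] by blast
  then have "\<Phi> x = k" by (auto simp: Phi_A0 g(2) fin_fun_def)
  then show "k \<in> \<Phi> ` A0" using x(1) by blast
qed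

lemma Phi_isometry: assumes "x \<in> A0" shows "nrm x = (SUP w\<in>W. cmod (the (\<Phi> x w)))"
proof (rule cSup_eq_maximum[symmetric])
  show "nrm x \<in> (\<lambda>w. cmod (the (\<Phi> x w))) ` W"
    using exists_character[OF assms] by (force simp: Phi_A0_val assms)
  fix r assume "r \<in> (\<lambda>w. cmod (the (\<Phi> x w))) ` W"
  then show "r \<le> nrm x" using W_bound assms by (auto simp: Phi_A0_val)
qed

end

theorem theorem5p8:
  fixes A0 A :: "'a::ab_group_add set" and smul :: "complex \<Rightarrow> 'a \<Rightarrow> 'a" and one :: 'a and mul :: "'a \<Rightarrow> 'a \<Rightarrow> 'a"
    and invl :: "'a \<Rightarrow> 'a" and nrm :: "'a \<Rightarrow> real" and p :: "'l \<Rightarrow> 'a \<Rightarrow> real"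
  assumes lcqca: "lcqca smul A0 one mul invl nrm p A"
    and comm: "\<forall>x\<in>A0. \<forall>y\<in>A0. mul x y = mul y x"
  defines "W \<equiv> gelfand smul A0 mul"
    and "Aq \<equiv> A \<inter> qpos A0 mul invl p"
    and "\<Phi> \<equiv> Phi smul A0 one mul invl (A \<inter> qpos A0 mul invl p)"
    and "Fp \<equiv> Phi smul A0 one mul invl (A \<inter> qpos A0 mul invl p) ` (A \<inter> qpos A0 mul invl p)"
  shows
   "wedge W Fp
    \<and> bij_betw \<Phi> (Mset A0 mul Aq) (Ffun W Fp)
    \<comment> \<open>(i)\<close>
    \<and> \<Phi> ` Aq = Fp
    \<and> (\<forall>a\<in>Aq. \<forall>b\<in>Aq. agrees W (\<lambda>w. \<Phi> a w \<noteq> None \<and> \<Phi> b w \<noteq> None)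
                          (\<lambda>w. the (\<Phi> a w) + the (\<Phi> b w)) (\<Phi> (a + b)))
    \<and> (\<forall>a\<in>Aq. \<forall>r::real. r \<ge> 0 \<longrightarrow> agrees W (\<lambda>w. \<Phi> a w \<noteq> None)
                          (\<lambda>w. complex_of_real r * the (\<Phi> a w)) (\<Phi> (smul (complex_of_real r) a)))
    \<comment> \<open>(ii)\<close>
    \<and> \<Phi> ` A0 = Cfun W
    \<and> inj_on \<Phi> A0
    \<and> (\<forall>x\<in>A0. \<forall>y\<in>A0. \<Phi> (x + y) = fin_fun W (\<lambda>w. the (\<Phi> x w) + the (\<Phi> y w)))
    \<and> (\<forall>c. \<forall>x\<in>A0. \<Phi> (smul c x) = fin_fun W (\<lambda>w. c * the (\<Phi> x w)))
    \<and> (\<forall>x\<in>A0. \<forall>y\<in>A0. \<Phi> (mul x y) = fin_fun W (\<lambda>w. the (\<Phi> x w) * the (\<Phi> y w)))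
    \<and> (\<forall>x\<in>A0. \<Phi> (invl x) = fin_fun W (\<lambda>w. cnj (the (\<Phi> x w))))
    \<and> (\<forall>x\<in>A0. nrm x = (SUP w\<in>W. cmod (the (\<Phi> x w))))
    \<comment> \<open>(iii)\<close>
    \<and> (\<forall>a\<in>Aq. \<forall>x\<in>A0. agrees W (\<lambda>w. \<Phi> a w \<noteq> None)
                          (\<lambda>w. the (\<Phi> a w) * the (\<Phi> x w)) (\<Phi> (mul a x)))
    \<and> (\<forall>a\<in>Aq. \<forall>b\<in>Aq. \<forall>x\<in>A0. agrees W (\<lambda>w. \<Phi> a w \<noteq> None \<and> \<Phi> b w \<noteq> None)
                          (\<lambda>w. (the (\<Phi> a w) + the (\<Phi> b w)) * the (\<Phi> x w)) (\<Phi> (mul (a + b) x)))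
    \<and> (\<forall>a\<in>Aq. \<forall>x\<in>A0. \<forall>r::real. r \<ge> 0 \<longrightarrow> agrees W (\<lambda>w. \<Phi> a w \<noteq> None)
                          (\<lambda>w. complex_of_real r * the (\<Phi> a w) * the (\<Phi> x w))
                          (\<Phi> (mul (smul (complex_of_real r) a) x)))
    \<and> (\<forall>a\<in>Aq. \<forall>x1\<in>A0. \<forall>x2\<in>A0. agrees W (\<lambda>w. \<Phi> a w \<noteq> None)
                          (\<lambda>w. the (\<Phi> a w) * (the (\<Phi> x1 w) + the (\<Phi> x2 w))) (\<Phi> (mul a (x1 + x2))))"
proof -
  interpret comm_lcqca smul A0 one mul invl nrm p A
    by unfold_locales (use lcqca comm in \<open>auto simp: lcqca_def\<close>)
  note defs = W_def Aq_def \<Phi>_def Fp_def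
  show ?thesis
  proof (intro conjI ballI allI impI)
    show "bij_betw \<Phi> (Mset A0 mul Aq) (Ffun W Fp)"
      using Phi_inj Phi_range unfolding defs by (simp add: bij_betw_def)
    show "inj_on \<Phi> A0" using inj_on_subset[OF Phi_inj] A0_MM unfolding defs by blast
  next
    fix a b assume "a \<in> Aq" "b \<in> Aq"
    then show "agrees W (\<lambda>w. \<Phi> a w \<noteq> None \<and> \<Phi> b w \<noteq> None) (\<lambda>w. the (\<Phi> a w) + the (\<Phi> b w)) (\<Phi> (a + b))"
      unfolding defs by (rule Phi_add)
  next
    fix a and r :: real assume "a \<in> Aq"
    then show "agrees W (\<lambda>w. \<Phi> a w \<noteq> None) (\<lambda>w. complex_of_real r * the (\<Phi> a w)) (\<Phi> (smul (complex_of_real r) a))"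
      unfolding defs by (rule Phi_scale)
  next
    fix x y assume "x \<in> A0" "y \<in> A0"
    then show "\<Phi> (x + y) = fin_fun W (\<lambda>w. the (\<Phi> x w) + the (\<Phi> y w))"
      "\<Phi> (mul x y) = fin_fun W (\<lambda>w. the (\<Phi> x w) * the (\<Phi> y w))"
      unfolding defs by (auto simp: Phi_A0 fin_fun_def W_add W_mul)
  next
    fix c x assume "x \<in> A0"
    then show "\<Phi> (smul c x) = fin_fun W (\<lambda>w. c * the (\<Phi> x w))"
      "\<Phi> (invl x) = fin_fun W (\<lambda>w. cnj (the (\<Phi> x w)))"
      unfolding defs by (auto simp: Phi_A0 fin_fun_def W_smul W_invl)
  next
    fix a x assume "a \<in> Aq" "x \<in> A0"
    then show "agrees W (\<lambda>w. \<Phi> a w \<noteq> None) (\<lambda>w. the (\<Phi> a w) * the (\<Phi> x w)) (\<Phi> (mul a x))"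
      unfolding defs by (intro agrees_cong[OF Phi_mul]) (auto simp: Phi_A0_val)
  next
    fix a b x assume "a \<in> Aq" "b \<in> Aq" "x \<in> A0"
    then show "agrees W (\<lambda>w. \<Phi> a w \<noteq> None \<and> \<Phi> b w \<noteq> None)
        (\<lambda>w. (the (\<Phi> a w) + the (\<Phi> b w)) * the (\<Phi> x w)) (\<Phi> (mul (a + b) x))"
      unfolding defs by (intro agrees_cong[OF Phi_sum_mul]) (auto simp: Phi_A0_val)
  next
    fix a x and r :: real assume "a \<in> Aq" "x \<in> A0"
    then show "agrees W (\<lambda>w. \<Phi> a w \<noteq> None) (\<lambda>w. complex_of_real r * the (\<Phi> a w) * the (\<Phi> x w))
        (\<Phi> (mul (smul (complex_of_real r) a) x))"
      unfolding defs by (intro agrees_cong[OF Phi_scale_mul]) (auto simp: Phi_A0_val)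
  next
    fix a x y assume "a \<in> Aq" "x \<in> A0" "y \<in> A0"
    then show "agrees W (\<lambda>w. \<Phi> a w \<noteq> None) (\<lambda>w. the (\<Phi> a w) * (the (\<Phi> x w) + the (\<Phi> y w))) (\<Phi> (mul a (x + y)))"
      unfolding defs by (intro agrees_cong[OF Phi_mul]) (auto simp: Phi_A0_val W_add)
  qed (use Phi_wedge Phi_A0_range Phi_isometry in \<open>auto simp: defs\<close>)
qed

end
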